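(* Consider problem (P) under the standing assumptions of the context, and let $\{x^k\}$ be generated by the algorithm sESQM described in the context. Suppose that: (CQ) $0\notin \partial g(x)+\mathcal{N}_{\mathcal{C}}(x)$ for every $x\in\mathcal{C}$ with $g(x)\ge 0$; (Parameters) $\{\mu_k\}$ is positive and nonincreasing, $\lim_{k\to\infty}\mu_k=0$, and $S_K:=\sum_{k=\lceil K/2\rceil}^{K}\mu_k\to\infty$ as $K\to\infty$; moreover $\lim_{k\to\infty}\widehat\gamma_k=0$ and there is $M_{\widehat\gamma}>1$ with $0<\widehat\gamma_{k+1}<\widehat\gamma_k\le M_{\widehat\gamma}\widehat\gamma_{k+1}$ for all $k\in\mathbb{N}_0$; (Convexity) $f$ is convex, $P_2=0$, and $c$ is $(-\mathrm{hzn}\,h)$-convex. Let $\psi_*$ be the optimal value of (P), and let $M_L,\eta_\gamma,C_3,C_4,\alpha_{3,1},\alpha_{3,2},\alpha_4,\bar k,\bar\gamma$ be as defined in the context. Let $\epsilon>0$ and an integer $K\ge2(\bar k+1)$ satisfy $$S_K^{-1}\le\frac{\min\{\eta_\gamma^2c_2^2,\ \eta_\gamma\epsilon/2\}}{2C_4\eta_\gamma B_1+M_Lm_{\mathcal{C}}^2},$$ $$\mu_{\lceil K/2\rceil}\le\min\left\{\frac{\eta_\gamma c_2^2}{2C_3},\ \frac{\eta_\gamma\epsilon}{2+2[\alpha_{3,1}]_+},\ \frac{\epsilon}{4C_3},\ \frac{\epsilon}{3\alpha_3^\varphi+[\alpha_{3,1}^h]_+},\ \frac{\eta_\gamma\epsilon}{\alpha_4+2\alpha_3^\varphi+[\alpha_{3,2}^\varphi]_+}\right\},$$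 where $B_1:=m_\psi+\eta_\gamma^{-1}(m_g+([\alpha_{3,2}]_++\alpha_4)\mu_0)-\psi_*$, $m_{\mathcal{C}}:=\sup_{x,z\in\mathcal{C}}\|x-z\|$, $m_\psi:=\sup_{x\in\mathcal{C}}\psi(x)$, $m_g:=\sup_{x\in\mathcal{C}}g^+(x)\ge0$. Then there exists $\widehat k\in[\lceil K/2\rceil,K]$ such that $$|\psi(x^{\widehat k+1})-\psi_*|\le\epsilon\quad\text{and}\quad g(x^{\widehat k+1})\le\epsilon.$$ If, in addition, $\sum_{k=0}^\infty\mu_k^2<\infty$, then $\{x^k\}$ converges to a point that is a solution of both (P) and the problem $\min_{x\in\mathbb{X}}\psi(x)+\bar\gamma^{-1}g^+(x)$.
   Context: **Notation.** $\mathbb{N}_0=\{0,1,2,\dots\}$; $[s]_+=\max\{s,0\}$; $\phi^+=\max\{\phi,0\}$; $\delta_{\mathcal{C}}$ is the indicator function (0 on $\mathcal{C}$, $+\infty$ off it); $\mathcal{N}_{\mathcal{C}}=\partial\delta_{\mathcal{C}}$ is the normal cone; $\partial_\epsilon\phi(x)=\{\xi:\phi(z)\ge\phi(x)+\langle\xi,z-x\rangle-\epsilon\ \forall z\}$ for convex $\phi$; $\partial$ is the limiting subdifferential (the usual one for convex functions); in the present setting $\partial g(x)=Dc(x)^*\partial h(c(x))$. "$L$-smooth on $\mathcal{C}$" means the derivative is $L$-Lipschitz on $\mathcal{C}$. $Dc(x)^*$ is the adjoint of the derivative. $\mathrm{hzn}\,h:=\{d\in\mathbb{Y}:h(y+d)\le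 h(y)\ \forall y\in\mathbb{Y}\}$; for a convex cone $\mathcal{K}$, $c$ is $\mathcal{K}$-convex if $tc(x)+(1-t)c(z)-c(tx+(1-t)z)\in\mathcal{K}$ for all $x,z\in\mathbb{X}$, $t\in[0,1]$. **Problem (P).** $\mathbb{X},\mathbb{Y}$ are finite-dimensional real Hilbert spaces: $$\min_{x\in\mathbb{X}}\ \psi(x):=f(x)+P_1(x)-P_2(x)+\delta_{\mathcal{C}}(x)\quad\text{s.t.}\quad g(x):=h(c(x))\le 0.$$ Standing assumptions: (i) $\mathcal{C}\subseteq\mathbb{X}$ is compact and convex and $\mathcal{F}:=\{x\in\mathcal{C}:g(x)\le0\}\ne\emptyset$; (ii) $f:\mathbb{X}\to\mathbb{R}$ and $c:\mathbb{X}\to\mathbb{Y}$ are continuously differentiable, $L_f$-smooth and $L_c$-smooth on $\mathcal{C}$ respectively ($L_f>0$, $L_c\ge0$), and $c$ is $M_c$-Lipschitz on $\mathcal{C}$ with $M_c>0$; (iii) $P_1,P_2:\mathbb{X}\to\mathbb{R}$ are convex; (iv) $h:\mathbb{Y}\to\mathbb{R}$ is convex and $M_h$-Lipschitz with $M_h>0$. **Smoothing.** A family of convex $C^1$ functions $\{\phi_\mu\}_{\mu>0}$ is a smoothing approximation (SA) of a convex $\phi:\mathbb{Y}\to\mathbb{R}$ with parameters $(\alpha_1^\phi,\alpha_2^\phi,\alpha_{3,1}^\phi,\alpha_{3,2}^\phi)$, where $\alpha_1^\phi\ge0$, $\alpha_2^\phi>0$, $\alpha_{3,1}^\phi,\alpha_{3,2}^\phi\in\mathbb{R}$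 and $\alpha_3^\phi:=\alpha_{3,1}^\phi+\alpha_{3,2}^\phi>0$, if for all $\mu>0$: $\nabla\phi_\mu$ is $(\alpha_1^\phi+\alpha_2^\phi/\mu)$-Lipschitz and $\phi-\alpha_{3,1}^\phi\mu\le\phi_\mu\le\phi+\alpha_{3,2}^\phi\mu$ pointwise. Fixed throughout: an SA $\{h_\mu\}$ of $h$ with parameters $(\alpha_1^h,\alpha_2^h,\alpha_{3,1}^h,\alpha_{3,2}^h)$ and a constant $\alpha_4^h\ge0$ with $h_{\mu_1}(y)\le h_{\mu_0}(y)+\alpha_4^h(\mu_0-\mu_1)$ for all $\mu_0\ge\mu_1>0$, $y\in\mathbb{Y}$; and an SA $\{\varphi_\mu\}$ of $[\cdot]_+:\mathbb{R}\to\mathbb{R}$ with parameters $(\alpha_1^\varphi,\alpha_2^\varphi,\alpha_{3,1}^\varphi,\alpha_{3,2}^\varphi)$ and a constant $\alpha_4^\varphi\ge0$ with $\varphi_{\mu_1}(s)\le\varphi_{\mu_0}(s)+\alpha_4^\varphi(\mu_0-\mu_1)$ for all $\mu_0\ge\mu_1>0$, $s\in\mathbb{R}$. Set $H_\mu:=\varphi_\mu\circ h_\mu$, $g_\mu:=H_\mu\circ c$, $\alpha_1=\alpha_1^h+M_h^2\alpha_1^\varphi$, $\alpha_2=\alpha_2^h+M_h^2\alpha_2^\varphi$, $\alpha_{3,1}=[\alpha_{3,1}^h]_++\alpha_{3,1}^\varphi$, $\alpha_{3,2}=[\alpha_{3,2}^h]_++\alpha_{3,2}^\varphi$, $\alpha_4=\alpha_4^h+\alpha_4^\varphi$,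 and $L_\mu:=M_hL_c+\alpha_1M_c^2+\alpha_2M_c^2/\mu$. **Algorithm sESQM.** Inputs: $x^0\in\mathcal{C}$, $\mu_0>0$, $\overline L\ge\underline L>0$, $c_1>0$, $c_2>0$, a strictly decreasing positive sequence $\{\widehat\gamma_k\}$, and the SAs above. Set $t_0=0$. For $k=0,1,2,\dots$: Step 1: take $\xi^k\in\partial P_2(x^k)$, $L_{k,0}\in[\underline L,\overline L]$; set $\gamma_k=\widehat\gamma_{t_k}$, $\widetilde L=L_{k,0}$. Step 2: compute $\widetilde x=\arg\min_{x\in\mathbb{X}}\{\gamma_k(\langle\nabla f(x^k)-\xi^k,x\rangle+P_1(x))+\ell_k(x)+\frac{\widetilde L}{2\mu_k}\|x-x^k\|^2+\delta_{\mathcal{C}}(x)\}$ with $\ell_k(x):=g_{\mu_k}(x^k)+\langle\nabla g_{\mu_k}(x^k),x-x^k\rangle$. Step 3: if $\gamma_k\psi(\widetilde x)+g_{\mu_k}(\widetilde x)\le\gamma_k\psi(x^k)+g_{\mu_k}(x^k)-\frac{c_1}{2\mu_k}\|\widetilde x-x^k\|^2$ go to Step 4; otherwise replace $\widetilde L$ by $2\widetilde L$ and go to Step 2. Step 4: set $x^{k+1}=\widetilde x$, $L_k=\widetilde L$. If $h_{\mu_k}(c(x^{k+1}))>2\alpha_3^\varphi\mu_k$ and $\|x^{k+1}-x^k\|\le c_2\mu_k\gamma_k$, set $t_{k+1}=t_k+1$; otherwise $t_{k+1}=t_k$. Step 5: choose $\mu_{k+1}\in(0,\mu_k]$. **Constants.**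 $M_L:=\max\{\overline L,\ c_1+\gamma_0\mu_0L_f+\mu_0L_{\mu_0}\}$; $M_f:=\sup_{x\in\mathcal{C}}\|\nabla f(x)\|$; $M_{P_i}:=\sup\{\|\xi\|:\xi\in\partial P_i(x),x\in\mathcal{C}\}$, $i=1,2$. $\eta_1>0$ is a constant (which exists under the standing assumptions and (CQ)) such that $\mathrm{dist}(0,Dc(x)^*u+\mathcal{N}_{\mathcal{C}}(x))\ge\eta_1$ for every $x\in\mathcal{C}$ with $g(x)\ge-\eta_1$ and every $u\in\partial_{\eta_1}h(c(x))$. With $k_0:=\min\{k\in\mathbb{N}_0:\mu_k\le\eta_1/\max\{\alpha_3^h,[\alpha_{3,2}^h]_+\}\}$, $$\eta_\gamma:=\min\left\{\frac{\eta_1}{2M_{\widehat\gamma}(M_f+M_{P_1}+M_{P_2}+c_2(M_L+\mu_0L_{\mu_0}))},\widehat\gamma_{k_0+1}\right\}.$$ $\bar k:=\min\{k\in\mathbb{N}_0:t_j=t_k\ \forall j\ge k\}-1$ (finite under the hypotheses), $\bar\gamma:=\gamma_{\bar k+1}$. $a_1:=[\mu_0\widehat\gamma_0L_f+\mu_0L_{\mu_0}-\underline L]_+$, $$C_3=\frac{([\alpha_{3,2}]_++\alpha_4)M_L}{\eta_\gamma\underline L},\qquad C_4=\frac{2\underline L+\mu_0a_1M_L}{c_1\underline L}.$$ *)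

theory Defs
  imports "HOL-Analysis.Analysis"
begin

text \<open>The derivative as a bounded linear map, so that continuity and Lipschitz continuity of
  \<open>x \<mapsto> D c(x)\<close> refer to the operator norm. It is meaningful only where the function is differentiable.\<close>

definition fderiv :: "('a::real_normed_vector \<Rightarrow> 'b::real_normed_vector) \<Rightarrow> 'a \<Rightarrow> ('a \<Rightarrow>\<^sub>L 'b)" where
  "fderiv f x = Blinfun (frechet_derivative f (at x))"

definition continuously_differentiable ::
    "('a::real_normed_vector \<Rightarrow> 'b::real_normed_vector) \<Rightarrow> bool" where
  "continuously_differentiable f \<longleftrightarrow>
     (\<forall>x. f differentiable (at x)) \<and> continuous_on UNIV (fderiv f)"

definition smooth_const_on ::
    "real \<Rightarrow> 'a::real_normed_vector set \<Rightarrow> ('a \<Rightarrow> 'b::real_normed_vector) \<Rightarrow> bool" where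
  "smooth_const_on L S f \<longleftrightarrow> L-lipschitz_on S (fderiv f)"

definition gradient :: "('a::real_inner \<Rightarrow> real) \<Rightarrow> 'a \<Rightarrow> 'a" where
  "gradient f x = (THE v. GDERIV f x :> v)"

definition indicator_fun :: "'a set \<Rightarrow> 'a \<Rightarrow> ereal" where
  "indicator_fun C x = (if x \<in> C then 0 else \<infinity>)"

text \<open>Extended-real values let the normal cone be the subdifferential of the indicator function;
  at a point where a proper \<open>\<phi>\<close> is infinite the set is empty, as usual.\<close>

definition eps_subdifferential :: "real \<Rightarrow> ('a::real_inner \<Rightarrow> ereal) \<Rightarrow> 'a \<Rightarrow> 'a set" where
  "eps_subdifferential e \<phi> x = {\<xi>. \<forall>z. \<phi> z \<ge> \<phi> x + ereal (\<xi> \<bullet> (z - x)) - ereal e}"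

definition subdifferential :: "('a::real_inner \<Rightarrow> ereal) \<Rightarrow> 'a \<Rightarrow> 'a set" where
  "subdifferential \<phi> x = eps_subdifferential 0 \<phi> x"

definition normal_cone :: "'a::real_inner set \<Rightarrow> 'a \<Rightarrow> 'a set" where
  "normal_cone C = subdifferential (indicator_fun C)"

definition regular_subdifferential :: "('a::real_inner \<Rightarrow> real) \<Rightarrow> 'a \<Rightarrow> 'a set" where
  "regular_subdifferential \<phi> x =
     {v. 0 \<le> Liminf (at x) (\<lambda>z. ereal ((\<phi> z - \<phi> x - v \<bullet> (z - x)) / norm (z - x)))}"

definition limiting_subdifferential :: "('a::real_inner \<Rightarrow> real) \<Rightarrow> 'a \<Rightarrow> 'a set" where
  "limiting_subdifferential \<phi> x =
     {v. \<exists>xs vs. xs \<longlonglongrightarrow> x \<and> (\<lambda>n. \<phi> (xs n)) \<longlonglongrightarrow> \<phi> x \<and>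
           (\<forall>n. vs n \<in> regular_subdifferential \<phi> (xs n)) \<and> vs \<longlonglongrightarrow> v}"

definition hzn :: "('b::real_vector \<Rightarrow> real) \<Rightarrow> 'b set" where
  "hzn h = {d. \<forall>y. h (y + d) \<le> h y}"

definition cone_convex ::
    "'b::real_vector set \<Rightarrow> ('a::real_vector \<Rightarrow> 'b) \<Rightarrow> bool" where
  "cone_convex \<K> c \<longleftrightarrow>
     (\<forall>x z t. 0 \<le> t \<and> t \<le> 1 \<longrightarrow>
        t *\<^sub>R c x + (1 - t) *\<^sub>R c z - c (t *\<^sub>R x + (1 - t) *\<^sub>R z) \<in> \<K>)"

text \<open>For convex real-valued functions the limiting subdifferential is the convex one; this is why
  the convex notion is used below for all convex functions, and the limiting one only for
  the (possibly nonconvex) constraint function.\<close>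

lemma regular_subdifferential_convex:
  fixes \<phi> :: "'a::euclidean_space \<Rightarrow> real"
  assumes cv: "convex_on UNIV \<phi>" and v: "v \<in> regular_subdifferential \<phi> x"
  shows "\<phi> z \<ge> \<phi> x + v \<bullet> (z - x)"
proof (rule ccontr)
  assume "\<not> ?thesis"
  then have neg: "\<phi> z - \<phi> x - v \<bullet> (z - x) < 0" by simp
  then have zx: "z \<noteq> x" by auto
  define q where "q = (\<phi> z - \<phi> x - v \<bullet> (z - x)) / norm (z - x)"
  have q: "q < 0" unfolding q_def using neg zx by (simp add: divide_neg_pos)
  have "ereal q < Liminf (at x) (\<lambda>z. ereal ((\<phi> z - \<phi> x - v \<bullet> (z - x)) / norm (z - x)))"
    using v q unfolding regular_subdifferential_def
    by (metis (mono_tags, lifting) ereal_less(4) mem_Collect_eq order_less_le_trans zero_ereal_def ereal_less_eq(3) less_ereal.simps(1))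
  then have ev: "\<forall>\<^sub>F w in at x. q < (\<phi> w - \<phi> x - v \<bullet> (w - x)) / norm (w - x)"
    using less_LiminfD by fastforce
  then obtain d where d: "d > 0"
    and dd: "\<And>w. w \<noteq> x \<Longrightarrow> dist w x < d \<Longrightarrow> q < (\<phi> w - \<phi> x - v \<bullet> (w - x)) / norm (w - x)"
    unfolding eventually_at by auto
  define s where "s = min 1 (d / (2 * norm (z - x)))"
  have s: "0 < s" "s \<le> 1" "s * norm (z - x) < d"
  proof -
    show "0 < s" "s \<le> 1" using d zx by (auto simp: s_def)
    have "s * norm (z - x) \<le> d / (2 * norm (z - x)) * norm (z - x)"
      by (rule mult_right_mono) (auto simp: s_def)
    then show "s * norm (z - x) < d" using d zx by simp
  qed
  define w where "w = x + s *\<^sub>R (z - x)"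
  have wx: "w - x = s *\<^sub>R (z - x)" by (simp add: w_def)
  have "w \<noteq> x" "dist w x < d" using s zx by (auto simp: w_def dist_norm)
  from dd[OF this] have "q * norm (w - x) < \<phi> w - \<phi> x - v \<bullet> (w - x)"
    using \<open>w \<noteq> x\<close> by (simp add: pos_less_divide_eq)
  moreover have "\<phi> w \<le> (1 - s) * \<phi> x + s * \<phi> z"
  proof -
    have "w = (1 - s) *\<^sub>R x + s *\<^sub>R z" by (simp add: w_def algebra_simps)
    then show ?thesis using convex_onD[OF cv, of s x z] s by simp
  qed
  moreover have "q * norm (w - x) = s * (\<phi> z - \<phi> x - v \<bullet> (z - x))"
    using s zx by (simp add: wx q_def)
  ultimately show False by (simp add: wx algebra_simps)
qed

lemma limiting_subdifferential_convex:
  fixes \<phi> :: "'a::euclidean_space \<Rightarrow> real"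
  assumes cv: "convex_on UNIV \<phi>"
  shows "limiting_subdifferential \<phi> x = subdifferential (\<lambda>z. ereal (\<phi> z)) x"
proof (intro set_eqI iffI)
  fix v assume "v \<in> limiting_subdifferential \<phi> x"
  then obtain xs vs where lim: "xs \<longlonglongrightarrow> x" "(\<lambda>n. \<phi> (xs n)) \<longlonglongrightarrow> \<phi> x" "vs \<longlonglongrightarrow> v"
    and reg: "\<And>n. vs n \<in> regular_subdifferential \<phi> (xs n)"
    unfolding limiting_subdifferential_def by blast
  have "\<phi> x + v \<bullet> (z - x) \<le> \<phi> z" for z
  proof (rule LIMSEQ_le_const2)
    show "(\<lambda>n. \<phi> (xs n) + vs n \<bullet> (z - xs n)) \<longlonglongrightarrow> \<phi> x + v \<bullet> (z - x)"
      by (intro tendsto_intros lim)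
    show "\<exists>N. \<forall>n\<ge>N. \<phi> (xs n) + vs n \<bullet> (z - xs n) \<le> \<phi> z"
      using regular_subdifferential_convex[OF cv reg] by blast
  qed
  then show "v \<in> subdifferential (\<lambda>z. ereal (\<phi> z)) x"
    by (simp add: subdifferential_def eps_subdifferential_def)
next
  fix v assume "v \<in> subdifferential (\<lambda>z. ereal (\<phi> z)) x"
  then have v: "\<And>z. \<phi> x + v \<bullet> (z - x) \<le> \<phi> z"
    by (simp add: subdifferential_def eps_subdifferential_def)
  have "v \<in> regular_subdifferential \<phi> x"
    unfolding regular_subdifferential_def mem_Collect_eq
    by (rule Liminf_bounded, rule always_eventually, use v in \<open>auto intro!: divide_nonneg_nonneg simp: algebra_simps\<close>)
  then show "v \<in> limiting_subdifferential \<phi> x"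
    unfolding limiting_subdifferential_def mem_Collect_eq
    by (intro exI[of _ "\<lambda>_. x"] exI[of _ "\<lambda>_. v"]) auto
qed

definition smoothing_approximation ::
    "('b::euclidean_space \<Rightarrow> real) \<Rightarrow> (real \<Rightarrow> 'b \<Rightarrow> real) \<Rightarrow> real \<Rightarrow> real \<Rightarrow> real \<Rightarrow> real \<Rightarrow> bool" where
  "smoothing_approximation \<phi> \<phi>s a1 a2 a31 a32 \<longleftrightarrow>
     a1 \<ge> 0 \<and> a2 > 0 \<and> a31 + a32 > 0 \<and>
     (\<forall>\<mu>>0. convex_on UNIV (\<phi>s \<mu>) \<and> continuously_differentiable (\<phi>s \<mu>) \<and>
        (a1 + a2 / \<mu>)-lipschitz_on UNIV (gradient (\<phi>s \<mu>)) \<and>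
        (\<forall>y. \<phi> y - a31 * \<mu> \<le> \<phi>s \<mu> y \<and> \<phi>s \<mu> y \<le> \<phi> y + a32 * \<mu>))"

definition smoothing_monotone :: "(real \<Rightarrow> 'b \<Rightarrow> real) \<Rightarrow> real \<Rightarrow> bool" where
  "smoothing_monotone \<phi>s a4 \<longleftrightarrow>
     (\<forall>\<nu>0 \<nu>1 y. 0 < \<nu>1 \<and> \<nu>1 \<le> \<nu>0 \<longrightarrow> \<phi>s \<nu>1 y \<le> \<phi>s \<nu>0 y + a4 * (\<nu>0 - \<nu>1))"

definition sESQM_model ::
    "('a::real_inner \<Rightarrow> real) \<Rightarrow> ('a \<Rightarrow> real) \<Rightarrow> 'a set \<Rightarrow> ('a \<Rightarrow> real) \<Rightarrow>
     real \<Rightarrow> real \<Rightarrow> 'a \<Rightarrow> 'a \<Rightarrow> real \<Rightarrow> 'a \<Rightarrow> ereal" where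
  "sESQM_model f P1 C g\<mu> \<gamma> \<mu> xk \<xi> L x =
     ereal (\<gamma> * ((gradient f xk - \<xi>) \<bullet> x + P1 x)
            + (g\<mu> xk + gradient g\<mu> xk \<bullet> (x - xk))
            + L / (2 * \<mu>) * (norm (x - xk))\<^sup>2)
     + indicator_fun C x"

definition sESQM_descent ::
    "('a::real_normed_vector \<Rightarrow> ereal) \<Rightarrow> ('a \<Rightarrow> real) \<Rightarrow> real \<Rightarrow> real \<Rightarrow> real \<Rightarrow> 'a \<Rightarrow> 'a \<Rightarrow> bool" where
  "sESQM_descent \<psi> g\<mu> \<gamma> \<mu> c1 xk y \<longleftrightarrow>
     ereal \<gamma> * \<psi> y + ereal (g\<mu> y)
       \<le> ereal \<gamma> * \<psi> xk + ereal (g\<mu> xk) - ereal (c1 / (2 * \<mu>) * (norm (y - xk))\<^sup>2)"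

text \<open>One pass from \<open>xk\<close> to \<open>xk'\<close>: trial \<open>i\<close> of the doubling line search uses the constant
  \<open>2 ^ i * L0\<close> and produces the trial point \<open>y i\<close>; trial \<open>j\<close> is the first one to be accepted.\<close>

definition sESQM_step ::
    "('a::real_inner \<Rightarrow> real) \<Rightarrow> ('a \<Rightarrow> real) \<Rightarrow> ('a \<Rightarrow> real) \<Rightarrow> 'a set \<Rightarrow> ('a \<Rightarrow> ereal) \<Rightarrow> ('a \<Rightarrow> real) \<Rightarrow>
     real \<Rightarrow> real \<Rightarrow> real \<Rightarrow> real \<Rightarrow> real \<Rightarrow> 'a \<Rightarrow> 'a \<Rightarrow> bool" where
  "sESQM_step f P1 P2 C \<psi> g\<mu> \<gamma> \<mu> Llo Lup c1 xk xk' \<longleftrightarrow>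
     (\<exists>\<xi> L0 y j.
        \<xi> \<in> subdifferential (\<lambda>z. ereal (P2 z)) xk \<and> Llo \<le> L0 \<and> L0 \<le> Lup \<and>
        (\<forall>i\<le>j. is_arg_min (sESQM_model f P1 C g\<mu> \<gamma> \<mu> xk \<xi> (2 ^ i * L0)) (\<lambda>_. True) (y i)) \<and>
        (\<forall>i<j. \<not> sESQM_descent \<psi> g\<mu> \<gamma> \<mu> c1 xk (y i)) \<and>
        sESQM_descent \<psi> g\<mu> \<gamma> \<mu> c1 xk (y j) \<and>
        xk' = y j)"

text \<open>\<open>\<theta>\<close> is the smoothing constraint \<open>h\<^sub>\<mu> \<circ> c\<close> tested when updating \<open>t\<close>,
  \<open>gs\<close> its composition with the smoothing of the positive part, and
  \<open>a3\<close> the total approximation constant of the latter.\<close>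

definition sESQM_run ::
    "('a::real_inner \<Rightarrow> real) \<Rightarrow> ('a \<Rightarrow> real) \<Rightarrow> ('a \<Rightarrow> real) \<Rightarrow> 'a set \<Rightarrow> ('a \<Rightarrow> ereal) \<Rightarrow>
     (real \<Rightarrow> 'a \<Rightarrow> real) \<Rightarrow> (real \<Rightarrow> 'a \<Rightarrow> real) \<Rightarrow> real \<Rightarrow>
     real \<Rightarrow> real \<Rightarrow> real \<Rightarrow> real \<Rightarrow> (nat \<Rightarrow> real) \<Rightarrow> (nat \<Rightarrow> real) \<Rightarrow>
     (nat \<Rightarrow> 'a) \<Rightarrow> (nat \<Rightarrow> nat) \<Rightarrow> bool" where
  "sESQM_run f P1 P2 C \<psi> \<theta> gs a3 Llo Lup c1 c2 \<gamma>hat \<mu> x t \<longleftrightarrow>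
     x 0 \<in> C \<and> 0 < \<mu> 0 \<and> t 0 = 0 \<and>
     (\<forall>k. sESQM_step f P1 P2 C \<psi> (gs (\<mu> k)) (\<gamma>hat (t k)) (\<mu> k) Llo Lup c1 (x k) (x (Suc k)) \<and>
          t (Suc k) =
            (if \<theta> (\<mu> k) (x (Suc k)) > 2 * a3 * \<mu> k \<and>
                norm (x (Suc k) - x k) \<le> c2 * \<mu> k * \<gamma>hat (t k)
             then t k + 1 else t k) \<and>
          0 < \<mu> (Suc k) \<and> \<mu> (Suc k) \<le> \<mu> k)"

end

theory Submission
  imports Defs
begin

text \<open>With \<open>P2 = 0\<close> each iteration is a proximal gradient step on the merit function
  \<open>\<gamma> \<psi> + g\<^sub>\<mu>\<close>, where \<open>g\<^sub>\<mu> = \<phi>\<^sub>\<mu> \<circ> h\<^sub>\<mu> \<circ> c\<close> smooths the positive part of the constraint. The convexity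
  hypotheses give \<open>g\<^sub>\<mu>\<close> the gradient inequality of a convex function (\<open>gs_above_gradient\<close>), so that a step
  with accepted constant \<open>l\<close> satisfies the three-point inequality \<open>merit_step\<close>: up to an error
  \<open>O(\<parallel>x\<^sub>k\<^sub>+\<^sub>1 - x\<^sub>k\<parallel>\<^sup>2 / \<mu>)\<close>, the merit value at \<open>x\<^sub>k\<^sub>+\<^sub>1\<close> exceeds that at any \<open>z \<in> C\<close> by at most
  \<open>l / (2 \<mu>) (\<parallel>z - x\<^sub>k\<parallel>\<^sup>2 - \<parallel>z - x\<^sub>k\<^sub>+\<^sub>1\<parallel>\<^sup>2)\<close>.

  The penalty parameter \<open>\<gamma>\<close> decreases only after a short step to a point at which the smoothed
  constraint is violated. There the distance condition with constant \<open>\<eta>1\<close> yields a feasible direction of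
  fast decrease of the constraint, and optimality of the step forces \<open>\<gamma>\<close> to be bounded below
  (\<open>penalty_lower_bound\<close>). Hence \<open>\<gamma> \<ge> \<eta>\<gamma>\<close> throughout (\<open>penalty_ge\<close>), and since \<open>\<gamma>hat\<close> tends to zero,
  \<open>\<gamma>\<close> is eventually constant. From then on a short step cannot lead to a violation: every step is long or
  ends at a point whose violation is \<open>O(\<mu>)\<close>.

  For constant \<open>\<gamma>\<close> put \<open>F = \<gamma> \<psi> + g\<^sup>+\<close>. The merit values decrease after a correction for the change of
  \<open>\<mu>\<close>, so \<open>\<parallel>x\<^sub>k\<^sub>+\<^sub>1 - x\<^sub>k\<parallel>\<^sup>2 / \<mu>\<^sub>k\<close> is summable. Because \<open>\<mu>\<close> is not, infinitely many steps are short. The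
  three-point inequality makes the distances to a point \<open>z\<close> with a smaller value of \<open>F\<close> shrink by
  multiples of \<open>\<mu>\<^sub>k\<close>, which is impossible for ever; so the merit values tend to the minimum of \<open>F\<close>. A
  cluster point along the short steps is both feasible and a minimiser of \<open>F\<close>
  (\<open>exact_penalty\<close>): the penalty is exact, and this point solves the constrained problem.

  The complexity bound averages with weights \<open>\<mu>\<^sub>k\<close> the sum of the merit gap at this minimiser and
  \<open>\<parallel>x\<^sub>k\<^sub>+\<^sub>1 - x\<^sub>k\<parallel>\<^sup>2 / \<mu>\<^sub>k\<^sup>2\<close> (\<open>weighted_average\<close>). One index then has a small gap, which bounds the
  objective from above, and a short step, which bounds the violation; exactness of the penalty turns the
  latter into the lower bound for the objective. If \<open>\<mu>\<close> is square summable, the errors of the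
  three-point inequality are summable, the distances to the minimiser converge, and the whole
  sequence follows its subsequence (\<open>converges_to_cluster_minimiser\<close>).\<close>

section \<open>Gradients, subgradients and normal directions\<close>

lemma has_derivative_gradient:
  fixes f :: "'a::euclidean_space \<Rightarrow> real"
  assumes "f differentiable (at x)"
  shows "(f has_derivative (\<lambda>v. gradient f x \<bullet> v)) (at x)"
proof -
  from assms obtain D where D: "(f has_derivative D) (at x)"
    by (auto simp: differentiable_def)
  then have lin: "linear D" by (simp add: has_derivative_linear)
  have "D v = v \<bullet> adjoint D 1" for v
    using adjoint_works[OF lin, of v 1] by simp
  then have G: "GDERIV f x :> adjoint D 1"
    using D by (simp add: gderiv_def) (metis (full_types) ext)
  moreover have "w = adjoint D 1" if "GDERIV f x :> w" for w
  proof -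
    have "(\<lambda>v. v \<bullet> w) = (\<lambda>v. v \<bullet> adjoint D 1)"
      using that G unfolding gderiv_def by (rule has_derivative_unique)
    then show ?thesis by (metis inner_commute vector_eq_ldot)
  qed
  ultimately have "GDERIV f x :> gradient f x"
    unfolding gradient_def by (metis (mono_tags, lifting) theI)
  then show ?thesis by (simp add: gderiv_def inner_commute)
qed

lemma gradient_inner_eq:
  fixes f :: "'a::euclidean_space \<Rightarrow> real"
  assumes "(f has_derivative D) (at x)"
  shows "gradient f x \<bullet> v = D v"
proof -
  have "(f has_derivative (\<lambda>v. gradient f x \<bullet> v)) (at x)"
    using assms by (intro has_derivative_gradient) (auto simp: differentiable_def)
  then show ?thesis using assms has_derivative_unique by metis
qed

lemma has_derivative_fderiv:
  assumes "f differentiable (at x)"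
  shows "(f has_derivative blinfun_apply (fderiv f x)) (at x)"
proof -
  have "(f has_derivative frechet_derivative f (at x)) (at x)"
    using assms by (simp add: frechet_derivative_works)
  then show ?thesis
    unfolding fderiv_def by (simp add: bounded_linear_Blinfun_apply has_derivative_bounded_linear)
qed

lemma directional_quotient_tendsto:
  fixes f :: "'a::real_normed_vector \<Rightarrow> 'b::real_normed_vector"
  assumes D: "(f has_derivative D) (at z)"
  shows "((\<lambda>s. (1 / s) *\<^sub>R (f (z + s *\<^sub>R v) - f z)) \<longlongrightarrow> D v) (at_right 0)"
proof -
  have "((\<lambda>s. z + s *\<^sub>R v) has_derivative (\<lambda>s. s *\<^sub>R v)) (at_right 0)"
    by (auto intro!: derivative_eq_intros)
  from has_derivative_compose[OF this, of f D]
  have "((\<lambda>s. f (z + s *\<^sub>R v)) has_vector_derivative D v) (at_right 0)"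
    using D by (simp add: has_vector_derivative_def linear_scale has_derivative_linear)
  then have "((\<lambda>s. (1 / norm (s - 0)) *\<^sub>R (f (z + s *\<^sub>R v) - (f z + s *\<^sub>R D v)) + D v) \<longlongrightarrow> 0 + D v) (at_right 0)"
    unfolding has_vector_derivative_def has_derivative_within
    by (intro tendsto_intros) simp
  moreover have "\<forall>\<^sub>F s in at_right 0. (1 / norm (s - 0)) *\<^sub>R (f (z + s *\<^sub>R v) - (f z + s *\<^sub>R D v)) + D v
      = (1 / s) *\<^sub>R (f (z + s *\<^sub>R v) - f z)"
    by (auto simp: eventually_at_filter algebra_simps)
  ultimately show ?thesis
    using tendsto_cong by fastforce
qed

lemma bdd_above_norm_gradient:
  fixes f :: "'a::euclidean_space \<Rightarrow> real"
  assumes "continuously_differentiable f" "compact C"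
  shows "bdd_above ((\<lambda>x. norm (gradient f x)) ` C)"
proof -
  have "norm (gradient f x) \<le> norm (fderiv f x)" for x
  proof -
    have "norm (gradient f x) ^ 2 = fderiv f x (gradient f x)"
      using gradient_inner_eq[OF has_derivative_fderiv, of f x "gradient f x"] assms(1)
      by (simp add: continuously_differentiable_def power2_norm_eq_inner)
    also have "\<dots> \<le> norm (fderiv f x) * norm (gradient f x)"
      by (metis abs_le_D1 norm_blinfun real_norm_def)
    finally show ?thesis
      by (smt (verit) mult_right_mono mult_le_cancel_right norm_ge_zero power2_eq_square)
  qed
  moreover have "bounded (fderiv f ` C)"
    using assms by (intro compact_imp_bounded compact_continuous_image)
      (auto simp: continuously_differentiable_def intro: continuous_on_subset)
  then obtain B where "\<And>x. x \<in> C \<Longrightarrow> norm (fderiv f x) \<le> B"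
    by (auto simp: bounded_iff)
  ultimately show ?thesis
    by (intro bdd_aboveI[where M = B]) (auto intro: order_trans)
qed

text \<open>The gradient is a regular subgradient, and for a convex function a regular subgradient supports
  the graph globally.\<close>

lemma convex_above_gradient:
  fixes \<phi> :: "'a::euclidean_space \<Rightarrow> real"
  assumes cv: "convex_on UNIV \<phi>" and d: "\<phi> differentiable (at y)"
  shows "\<phi> y + gradient \<phi> y \<bullet> (z - y) \<le> \<phi> z"
proof (rule regular_subdifferential_convex[OF cv])
  have "((\<lambda>w. norm (\<phi> w - \<phi> y - gradient \<phi> y \<bullet> (w - y)) / norm (w - y)) \<longlongrightarrow> 0) (at y)"
    using has_derivative_gradient[OF d] unfolding has_derivative_iff_norm by blast
  then have "((\<lambda>w. (\<phi> w - \<phi> y - gradient \<phi> y \<bullet> (w - y)) / norm (w - y)) \<longlongrightarrow> 0) (at y)"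
    using tendsto_rabs_zero_cancel[of "\<lambda>w. (\<phi> w - \<phi> y - gradient \<phi> y \<bullet> (w - y)) / norm (w - y)"]
    by (simp add: abs_divide)
  then have "Liminf (at y) (\<lambda>w. ereal ((\<phi> w - \<phi> y - gradient \<phi> y \<bullet> (w - y)) / norm (w - y))) = 0"
    by (intro lim_imp_Liminf) (auto simp: zero_ereal_def)
  then show "gradient \<phi> y \<in> regular_subdifferential \<phi> y"
    by (simp add: regular_subdifferential_def)
qed

text \<open>A supporting line of a convex function cannot rise faster than the function grows along the
  whole ray; knowing the growth at integer multiples is enough.\<close>

lemma gradient_le_growth:
  fixes \<phi> :: "'a::euclidean_space \<Rightarrow> real"
  assumes "convex_on UNIV \<phi>" "\<phi> differentiable (at y)"
    and growth: "\<And>n::nat. \<phi> (y + real n *\<^sub>R d) \<le> A + real n * B"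
  shows "gradient \<phi> y \<bullet> d \<le> B"
proof (rule ccontr)
  assume "\<not> ?thesis"
  then have pos: "gradient \<phi> y \<bullet> d - B > 0" by simp
  then obtain n :: nat where n: "real n * (gradient \<phi> y \<bullet> d - B) > A - \<phi> y"
    using reals_Archimedean3 by blast
  have "\<phi> y + gradient \<phi> y \<bullet> (real n *\<^sub>R d) \<le> \<phi> (y + real n *\<^sub>R d)"
    using convex_above_gradient[OF assms(1,2), of "y + real n *\<^sub>R d"] by simp
  then show False using growth[of n] n by (simp add: algebra_simps)
qed

lemma mem_subdifferential_real:
  "\<xi> \<in> subdifferential (\<lambda>z. ereal (\<phi> z)) x \<longleftrightarrow> (\<forall>z. \<phi> x + \<xi> \<bullet> (z - x) \<le> \<phi> z)"
  by (simp add: subdifferential_def eps_subdifferential_def)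

text \<open>Separating the point \<open>(x, \<phi> x)\<close> from the strict epigraph gives a hyperplane; it is not vertical
  because \<open>\<phi>\<close> is finite everywhere, so that it is the graph of a supporting affine function.\<close>

lemma convex_subgradient_exists:
  fixes \<phi> :: "'a::euclidean_space \<Rightarrow> real"
  assumes cv: "convex_on UNIV \<phi>"
  shows "\<exists>\<xi>. \<xi> \<in> subdifferential (\<lambda>z. ereal (\<phi> z)) x"
proof -
  define E where "E = {p. \<phi> (fst p) < snd p}"
  have "convex E"
  proof (rule convexI)
    fix p q :: "'a \<times> real" and u v :: real
    assume *: "p \<in> E" "q \<in> E" "0 \<le> u" "0 \<le> v" "u + v = 1"
    have "\<phi> (u *\<^sub>R fst p + v *\<^sub>R fst q) \<le> u * \<phi> (fst p) + v * \<phi> (fst q)"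
      using cv * by (simp add: convex_on_def)
    also have "\<dots> < u * snd p + v * snd q"
    proof (cases "u = 0")
      case True then show ?thesis using * by (simp add: E_def)
    next
      case False
      then have "u * \<phi> (fst p) < u * snd p" using * by (simp add: E_def)
      moreover have "v * \<phi> (fst q) \<le> v * snd q" using * by (intro mult_left_mono) (auto simp: E_def)
      ultimately show ?thesis by simp
    qed
    finally show "u *\<^sub>R p + v *\<^sub>R q \<in> E" by (simp add: E_def)
  qed
  moreover have "(x, \<phi> x + 1) \<in> E" "{(x, \<phi> x)} \<inter> E = {}" by (auto simp: E_def)
  ultimately have "\<exists>a b. a \<noteq> 0 \<and> (\<forall>p\<in>{(x, \<phi> x)}. a \<bullet> p \<le> b) \<and> (\<forall>p\<in>E. b \<le> a \<bullet> p)"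
    by (intro separating_hyperplane_sets) auto
  then obtain a b where a: "a \<noteq> 0" "a \<bullet> (x, \<phi> x) \<le> b" "\<And>p. p \<in> E \<Longrightarrow> b \<le> a \<bullet> p"
    by (metis singletonI)
  obtain v \<tau> where av: "a = (v, \<tau>)" by fastforce
  have sep: "v \<bullet> x + \<tau> * \<phi> x \<le> v \<bullet> y + \<tau> * s" if "\<phi> y < s" for y s
    using a(2) a(3)[of "(y, s)"] that by (simp add: av E_def)
  have "\<tau> \<ge> 0" using sep[of x "\<phi> x + 1"] by (simp add: algebra_simps)
  moreover have "\<tau> \<noteq> 0"
  proof
    assume 0: "\<tau> = 0"
    have "v \<bullet> x \<le> v \<bullet> (x - v)" using sep[of "x - v" "\<phi> (x - v) + 1"] 0 by simp
    then have "v \<bullet> v \<le> 0" by (simp add: inner_diff_right)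
    then have "v = 0" by (meson inner_gt_zero_iff not_le)
    then show False using a(1) 0 by (simp add: av zero_prod_def)
  qed
  ultimately have \<tau>: "\<tau> > 0" by simp
  have "\<phi> x + (- (1 / \<tau>) *\<^sub>R v) \<bullet> (z - x) \<le> \<phi> z" for z
  proof (rule field_le_epsilon)
    fix e :: real assume "e > 0"
    then have "v \<bullet> x + \<tau> * \<phi> x \<le> v \<bullet> z + \<tau> * (\<phi> z + e)" by (intro sep) simp
    moreover have "\<tau> * (\<phi> x - (v \<bullet> z - v \<bullet> x) / \<tau>) = \<tau> * \<phi> x - (v \<bullet> z - v \<bullet> x)"
      using \<tau> by (simp add: field_simps)
    ultimately have "\<tau> * (\<phi> x - (v \<bullet> z - v \<bullet> x) / \<tau>) \<le> \<tau> * (\<phi> z + e)"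
      by (simp add: distrib_left)
    then show "\<phi> x + (- (1 / \<tau>) *\<^sub>R v) \<bullet> (z - x) \<le> \<phi> z + e"
      using \<tau> by (simp add: inner_diff_right diff_divide_distrib)
  qed
  then show ?thesis unfolding mem_subdifferential_real by blast
qed

lemma continuous_on_convex_UNIV:
  fixes \<phi> :: "'a::euclidean_space \<Rightarrow> real"
  assumes "convex_on UNIV \<phi>"
  shows "continuous_on S \<phi>"
  using convex_on_continuous[OF open_UNIV assms] continuous_on_subset by blast

text \<open>A subgradient of norm \<open>r\<close> forces \<open>\<phi>\<close> to rise by at least \<open>r\<close> on a unit step, and \<open>\<phi>\<close> has bounded
  oscillation near a compact set.\<close>

lemma bdd_above_norm_subgradients:
  fixes \<phi> :: "'a::euclidean_space \<Rightarrow> real"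
  assumes cv: "convex_on UNIV \<phi>" and C: "compact C"
  shows "bdd_above {norm \<xi> |\<xi> x. x \<in> C \<and> \<xi> \<in> subdifferential (\<lambda>z. ereal (\<phi> z)) x}"
proof -
  define E where "E = {a + b |a b. a \<in> C \<and> b \<in> cball (0::'a) 1}"
  have "compact E" unfolding E_def by (intro compact_sums C compact_cball)
  then have "bounded (\<phi> ` E)"
    by (intro compact_imp_bounded compact_continuous_image continuous_on_convex_UNIV cv)
  then obtain B where B: "\<And>z. z \<in> E \<Longrightarrow> \<bar>\<phi> z\<bar> \<le> B" by (auto simp: bounded_iff)
  have "norm \<xi> \<le> 2 * B" if x: "x \<in> C" and \<xi>: "\<forall>z. \<phi> x + \<xi> \<bullet> (z - x) \<le> \<phi> z" for x \<xi>
  proof -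
    have E: "x + b \<in> E" if "norm b \<le> 1" for b
    proof -
      have "b \<in> cball 0 1" using that by simp
      then show ?thesis using x unfolding E_def by blast
    qed
    have 1: "x \<in> E" "x + sgn \<xi> \<in> E"
      using E[of 0] E[of "sgn \<xi>"] by (auto simp: norm_sgn)
    have "\<xi> \<bullet> sgn \<xi> = norm \<xi>"
      by (cases "\<xi> = 0") (auto simp: sgn_div_norm dot_square_norm power2_eq_square)
    then have "\<phi> x + norm \<xi> \<le> \<phi> (x + sgn \<xi>)" using \<xi>[rule_format, of "x + sgn \<xi>"] by simp
    then show ?thesis using B[OF 1(1)] B[OF 1(2)] by simp
  qed
  then show ?thesis
    by (intro bdd_aboveI[where M = "2 * B"]) (auto simp: mem_subdifferential_real)
qed

lemma mem_normal_cone: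
  assumes "x \<in> C"
  shows "n \<in> normal_cone C x \<longleftrightarrow> (\<forall>z\<in>C. n \<bullet> (z - x) \<le> 0)"
  using assms
  by (auto simp: normal_cone_def subdifferential_def eps_subdifferential_def indicator_fun_def
      zero_ereal_def)

text \<open>Project \<open>- v\<close> to the closed tangent cone. The projection \<open>d\<close> satisfies \<open>v \<bullet> d = - \<parallel>d\<parallel>\<^sup>2\<close>, and the
  residual \<open>- v - d\<close> is a normal, so that \<open>\<parallel>d\<parallel> \<ge> \<eta>\<close>. A feasible direction close to \<open>d\<close> then has almost
  the same slope. The direction is feasible, and not merely tangent, because the Lipschitz
  constant of the constraint map on \<open>C\<close> controls only difference quotients between points of \<open>C\<close>.\<close>

lemma feasible_direction_of_normal_gap:
  fixes v :: "'a::euclidean_space"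
  assumes C: "convex C" "x \<in> C" and gap: "\<And>n. n \<in> normal_cone C x \<Longrightarrow> \<eta> \<le> norm (v + n)"
    and \<eta>': "0 \<le> \<eta>'" "\<eta>' < \<eta>"
  shows "\<exists>z\<in>C. v \<bullet> (z - x) < - \<eta>' * norm (z - x)"
proof -
  define T where "T = cone hull ((\<lambda>z. z - x) ` C)"
  have T: "T = {s *\<^sub>R (z - x) |s z. s \<ge> 0 \<and> z \<in> C}"
    unfolding T_def cone_hull_expl by blast
  have cvT: "convex (closure T)"
    unfolding T_def using C(1) by (intro convex_closure convex_cone_hull convex_translation_subtract)
  have 0: "0 \<in> T" using C(2) unfolding T by force
  then have ne: "closure T \<noteq> {}" using closure_subset by blast
  have cone: "cone (closure T)" unfolding T_def by (intro cone_closure cone_cone_hull)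
  define d where "d = closest_point (closure T) (- v)"
  have dT: "d \<in> closure T" unfolding d_def using ne by (intro closest_point_in_set) auto
  define n where "n = - v - d"
  have dot: "n \<bullet> (w - d) \<le> 0" if "w \<in> closure T" for w
    using closest_point_dot[OF cvT closed_closure that, of "- v"] by (simp add: n_def d_def)
  have "2 *\<^sub>R d \<in> closure T" using cone dT by (simp add: cone_def)
  then have "n \<bullet> d \<le> 0" using dot[of "2 *\<^sub>R d"] by (simp add: scaleR_2)
  moreover have "n \<bullet> d \<ge> 0" using dot[of 0] 0 closure_subset by auto
  ultimately have nd: "n \<bullet> d = 0" by simp
  have "n \<in> normal_cone C x"
    unfolding mem_normal_cone[OF C(2)]
  proof
    fix z assume "z \<in> C"
    then have "1 *\<^sub>R (z - x) \<in> T" unfolding T using zero_le_one by blast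
    then have "z - x \<in> closure T" using closure_subset by auto
    then show "n \<bullet> (z - x) \<le> 0" using dot[of "z - x"] nd by (simp add: inner_diff_right)
  qed
  then have d: "\<eta> \<le> norm d" using gap[of n] by (simp add: n_def)
  have vd: "v \<bullet> d = - (norm d)\<^sup>2"
    using nd by (simp add: n_def inner_diff_left power2_norm_eq_inner)
  define W where "W = {w. v \<bullet> w < - \<eta>' * norm w}"
  have "open W" unfolding W_def by (intro open_Collect_less continuous_intros)
  moreover have "d \<in> W"
  proof -
    have "\<eta>' * norm d < norm d * norm d" using d \<eta>' by (intro mult_strict_right_mono) auto
    then show ?thesis by (simp add: W_def vd power2_eq_square)
  qed
  ultimately have "W \<inter> T \<noteq> {}" using dT open_Int_closure_eq_empty by blast
  then obtain s z where s: "s \<ge> 0" "z \<in> C" and w: "v \<bullet> (s *\<^sub>R (z - x)) < - \<eta>' * norm (s *\<^sub>R (z - x))"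
    unfolding W_def T by auto
  then have "s * (v \<bullet> (z - x)) < s * (- \<eta>' * norm (z - x))" by (simp add: mult_ac)
  then have "v \<bullet> (z - x) < - \<eta>' * norm (z - x)" using s(1) by (meson mult_less_cancel_left_disj not_le)
  then show ?thesis using s by blast
qed

text \<open>The descent lemma for a single segment. The composite constraint satisfies the bound on the
  increase of the directional derivative only between points of \<open>C\<close>, hence a form that speaks of one
  direction and of the points of one segment.\<close>

lemma segment_descent:
  fixes F :: "'a::real_normed_vector \<Rightarrow> real"
  assumes D: "\<And>s. 0 \<le> s \<Longrightarrow> s \<le> 1 \<Longrightarrow> (F has_derivative F' s) (at (x + s *\<^sub>R v))"
    and le: "\<And>s. 0 \<le> s \<Longrightarrow> s \<le> 1 \<Longrightarrow> F' s v \<le> d + A * s"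
  shows "F (x + v) \<le> F x + d + A / 2"
proof -
  define \<Phi> where "\<Phi> s = F (x + s *\<^sub>R v) - d * s - A / 2 * s\<^sup>2" for s
  have "\<Phi> 1 \<le> \<Phi> 0"
  proof (rule DERIV_nonpos_imp_nonincreasing[of 0 1 \<Phi>])
    fix s :: real assume s: "0 \<le> s" "s \<le> 1"
    have lin: "linear (F' s)" using D[OF s] has_derivative_linear by blast
    have "((\<lambda>s. x + s *\<^sub>R v) has_derivative (\<lambda>r. r *\<^sub>R v)) (at s)"
      by (auto intro!: derivative_eq_intros)
    from has_derivative_compose[OF this, of F "F' s"]
    have "((\<lambda>s. F (x + s *\<^sub>R v)) has_derivative (\<lambda>r. F' s (r *\<^sub>R v))) (at s)"
      using D[OF s] by simp
    then have "((\<lambda>s. F (x + s *\<^sub>R v)) has_real_derivative F' s v) (at s)"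
      unfolding has_field_derivative_def using lin by (simp add: linear_scale mult.commute[of _ "F' s v"])
    then have "(\<Phi> has_real_derivative F' s v - d - A * s) (at s)"
      unfolding \<Phi>_def by (auto intro!: derivative_eq_intros)
    then show "\<exists>y. DERIV \<Phi> s :> y \<and> y \<le> 0" using le[OF s] by force
  qed simp
  then show ?thesis by (simp add: \<Phi>_def)
qed

section \<open>The smoothed composite constraint\<close>

locale smoothed_composite =
  fixes C :: "'a::euclidean_space set"
    and c :: "'a \<Rightarrow> 'b::euclidean_space"
    and h :: "'b \<Rightarrow> real"
    and hs :: "real \<Rightarrow> 'b \<Rightarrow> real" and \<phi>s :: "real \<Rightarrow> real \<Rightarrow> real"
    and L\<^sub>c M\<^sub>c M\<^sub>h ah1 ah2 ah31 ah32 ah4 ap1 ap2 ap31 ap32 ap4 :: real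
  assumes convex_C: "convex C"
    and C1_c: "continuously_differentiable c"
    and smooth_c: "smooth_const_on L\<^sub>c C c"
    and lip_c: "M\<^sub>c-lipschitz_on C c"
    and M\<^sub>h_pos: "M\<^sub>h > 0"
    and lip_h: "M\<^sub>h-lipschitz_on UNIV h"
    and sa_h: "smoothing_approximation h hs ah1 ah2 ah31 ah32"
    and ah4: "ah4 \<ge> 0" and mono_h: "smoothing_monotone hs ah4"
    and sa_\<phi>: "smoothing_approximation (\<lambda>s. max s 0) \<phi>s ap1 ap2 ap31 ap32"
    and ap4: "ap4 \<ge> 0" and mono_\<phi>: "smoothing_monotone \<phi>s ap4"
    and cone_c: "cone_convex (uminus ` hzn h) c"
begin

abbreviation g :: "'a \<Rightarrow> real" where "g z \<equiv> h (c z)"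

abbreviation gs :: "real \<Rightarrow> 'a \<Rightarrow> real" where "gs \<nu> z \<equiv> \<phi>s \<nu> (hs \<nu> (c z))"

abbreviation Dc :: "'a \<Rightarrow> 'a \<Rightarrow> 'b" where "Dc z \<equiv> blinfun_apply (fderiv c z)"

definition grad_H :: "real \<Rightarrow> 'b \<Rightarrow> 'b" where
  "grad_H \<nu> y = gradient (\<phi>s \<nu>) (hs \<nu> y) *\<^sub>R gradient (hs \<nu>) y"

definition L_H :: "real \<Rightarrow> real" where
  "L_H \<nu> = ah1 + M\<^sub>h\<^sup>2 * ap1 + (ah2 + M\<^sub>h\<^sup>2 * ap2) / \<nu>"

text \<open>Lipschitz constant of the gradient of \<open>gs \<nu>\<close> along feasible directions.\<close>

definition L_g :: "real \<Rightarrow> real" where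
  "L_g \<nu> = M\<^sub>h * L\<^sub>c + L_H \<nu> * M\<^sub>c\<^sup>2"

lemma const_signs: "ah1 \<ge> 0" "ah2 > 0" "ah31 + ah32 > 0" "ap1 \<ge> 0" "ap2 > 0" "ap31 + ap32 > 0"
  "0 \<le> M\<^sub>c" "0 \<le> L\<^sub>c"
  using sa_h sa_\<phi> smooth_c lip_c
  by (auto simp: smoothing_approximation_def smooth_const_on_def lipschitz_on_def)

lemma Dc: "(c has_derivative Dc z) (at z)"
  using C1_c by (intro has_derivative_fderiv) (simp add: continuously_differentiable_def)

context
  fixes \<nu> :: real
  assumes \<nu>: "\<nu> > 0"
begin

lemma hs_props:
  shows convex_hs: "convex_on UNIV (hs \<nu>)"
    and diff_hs: "hs \<nu> differentiable (at y)"
    and lip_grad_hs: "norm (gradient (hs \<nu>) y - gradient (hs \<nu>) y') \<le> (ah1 + ah2 / \<nu>) * norm (y - y')"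
    and hs_lower: "h y - ah31 * \<nu> \<le> hs \<nu> y"
    and hs_upper: "hs \<nu> y \<le> h y + ah32 * \<nu>"
  using sa_h \<nu>
  by (auto simp: smoothing_approximation_def continuously_differentiable_def lipschitz_on_def dist_norm)

lemma \<phi>s_props:
  shows convex_\<phi>s: "convex_on UNIV (\<phi>s \<nu>)"
    and diff_\<phi>s: "\<phi>s \<nu> differentiable (at s)"
    and lip_grad_\<phi>s: "\<bar>gradient (\<phi>s \<nu>) s - gradient (\<phi>s \<nu>) s'\<bar> \<le> (ap1 + ap2 / \<nu>) * \<bar>s - s'\<bar>"
    and \<phi>s_lower: "max s 0 - ap31 * \<nu> \<le> \<phi>s \<nu> s"
    and \<phi>s_upper: "\<phi>s \<nu> s \<le> max s 0 + ap32 * \<nu>"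
  using sa_\<phi> \<nu>
  by (auto simp: smoothing_approximation_def continuously_differentiable_def lipschitz_on_def dist_real_def)

text \<open>A smoothing stays within a bounded distance of the function, so it has the same asymptotic
  slopes; by convexity these bound all its derivatives.\<close>

lemma norm_grad_hs_le: "norm (gradient (hs \<nu>) y) \<le> M\<^sub>h"
proof -
  define d where "d = gradient (hs \<nu>) y"
  have "gradient (hs \<nu>) y \<bullet> d \<le> M\<^sub>h * norm d"
  proof (rule gradient_le_growth[OF convex_hs diff_hs])
    fix n :: nat
    have "\<bar>h (y + real n *\<^sub>R d) - h y\<bar> \<le> M\<^sub>h * norm (real n *\<^sub>R d)"
      using lipschitz_onD[OF lip_h, of "y + real n *\<^sub>R d" y] by (simp add: dist_norm)
    then show "hs \<nu> (y + real n *\<^sub>R d) \<le> (h y + ah32 * \<nu>) + real n * (M\<^sub>h * norm d)"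
      using hs_upper[of "y + real n *\<^sub>R d"] by (simp add: mult_ac)
  qed
  then have "norm d * norm d \<le> M\<^sub>h * norm d"
    by (simp add: d_def flip: power2_norm_eq_inner power2_eq_square)
  then show ?thesis
    using M\<^sub>h_pos mult_right_le_imp_le[of "norm d" "norm d" M\<^sub>h] by (cases "d = 0") (auto simp: d_def)
qed

lemma grad_hs_hzn_nonpos:
  assumes "d \<in> hzn h"
  shows "gradient (hs \<nu>) y \<bullet> d \<le> 0"
proof (rule gradient_le_growth[OF convex_hs diff_hs])
  fix n :: nat
  have "h (y + real n *\<^sub>R d) \<le> h y"
  proof (induction n)
    case (Suc n)
    have "h ((y + real n *\<^sub>R d) + d) \<le> h (y + real n *\<^sub>R d)"
      using assms by (simp add: hzn_def)
    then show ?case using Suc by (simp add: algebra_simps)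
  qed simp
  then show "hs \<nu> (y + real n *\<^sub>R d) \<le> (h y + ah32 * \<nu>) + real n * 0"
    using hs_upper[of "y + real n *\<^sub>R d"] by simp
qed

lemma grad_\<phi>s_bounds: "0 \<le> gradient (\<phi>s \<nu>) s" "gradient (\<phi>s \<nu>) s \<le> 1"
proof -
  have "gradient (\<phi>s \<nu>) s \<bullet> (- 1) \<le> 0"
  proof (rule gradient_le_growth[OF convex_\<phi>s diff_\<phi>s])
    show "\<phi>s \<nu> (s + real n *\<^sub>R (- 1)) \<le> (max s 0 + ap32 * \<nu>) + real n * 0" for n
      using \<phi>s_upper[of "s + real n *\<^sub>R (- 1)"] by (simp add: max_def split: if_splits)
  qed
  then show "0 \<le> gradient (\<phi>s \<nu>) s" by simp
  have "gradient (\<phi>s \<nu>) s \<bullet> 1 \<le> 1"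
  proof (rule gradient_le_growth[OF convex_\<phi>s diff_\<phi>s])
    show "\<phi>s \<nu> (s + real n *\<^sub>R 1) \<le> (max s 0 + ap32 * \<nu>) + real n * 1" for n
      using \<phi>s_upper[of "s + real n *\<^sub>R 1"] by (simp add: max_def split: if_splits)
  qed
  then show "gradient (\<phi>s \<nu>) s \<le> 1" by simp
qed

text \<open>The graph of \<open>\<phi>s \<nu>\<close> rises by at least \<open>s - (ap31 + ap32) * \<nu>\<close> between \<open>0\<close> and \<open>s\<close>, and by
  convexity at most by \<open>s\<close> times the slope at \<open>s\<close>.\<close>

lemma grad_\<phi>s_gt_half:
  assumes "s > 2 * (ap31 + ap32) * \<nu>"
  shows "gradient (\<phi>s \<nu>) s > 1 / 2"
proof -
  have s: "s > 0" using assms const_signs(6) \<nu> by (smt (verit) mult_pos_pos)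
  have "\<phi>s \<nu> s + gradient (\<phi>s \<nu>) s * (0 - s) \<le> \<phi>s \<nu> 0"
    using convex_above_gradient[OF convex_\<phi>s diff_\<phi>s, of s 0] by simp
  then have "s - (ap31 + ap32) * \<nu> \<le> gradient (\<phi>s \<nu>) s * s"
    using \<phi>s_lower[of s] \<phi>s_upper[of 0] s by (simp add: algebra_simps)
  moreover have "1 / 2 * s < s - (ap31 + ap32) * \<nu>" using assms by (simp add: algebra_simps)
  ultimately have "1 / 2 * s < gradient (\<phi>s \<nu>) s * s" by linarith
  then show ?thesis using s by simp
qed

lemma lip_hs: "\<bar>hs \<nu> y - hs \<nu> y'\<bar> \<le> M\<^sub>h * norm (y - y')"
proof -
  have *: "hs \<nu> u - hs \<nu> w \<le> M\<^sub>h * norm (u - w)" for u w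
  proof -
    have "hs \<nu> u - hs \<nu> w \<le> gradient (hs \<nu>) u \<bullet> (u - w)"
      using convex_above_gradient[OF convex_hs diff_hs, of u w] by (simp add: inner_diff_right)
    also have "\<dots> \<le> norm (gradient (hs \<nu>) u) * norm (u - w)" by (rule norm_cauchy_schwarz)
    also have "\<dots> \<le> M\<^sub>h * norm (u - w)" by (intro mult_right_mono norm_grad_hs_le) simp
    finally show ?thesis .
  qed
  show ?thesis using *[of y y'] *[of y' y] by (simp add: norm_minus_commute)
qed

lemma norm_grad_H_le: "norm (grad_H \<nu> y) \<le> M\<^sub>h"
  using grad_\<phi>s_bounds[of "hs \<nu> y"] norm_grad_hs_le[of y]
    mult_mono[of "gradient (\<phi>s \<nu>) (hs \<nu> y)" 1 "norm (gradient (hs \<nu>) y)" "M\<^sub>h"]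
  by (simp add: grad_H_def)

lemma L_H_nonneg: "L_H \<nu> \<ge> 0"
  unfolding L_H_def using const_signs \<nu> M\<^sub>h_pos by (intro add_nonneg_nonneg divide_nonneg_nonneg) auto

lemma lip_grad_H: "norm (grad_H \<nu> y - grad_H \<nu> y') \<le> L_H \<nu> * norm (y - y')"
proof -
  let ?p = "gradient (\<phi>s \<nu>) (hs \<nu> y)" and ?p' = "gradient (\<phi>s \<nu>) (hs \<nu> y')"
  let ?u = "gradient (hs \<nu>) y" and ?u' = "gradient (hs \<nu>) y'"
  have ap: "ap1 + ap2 / \<nu> \<ge> 0" using const_signs \<nu> by simp
  have "grad_H \<nu> y - grad_H \<nu> y' = ?p *\<^sub>R (?u - ?u') + (?p - ?p') *\<^sub>R ?u'"
    by (simp add: grad_H_def algebra_simps)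
  then have "norm (grad_H \<nu> y - grad_H \<nu> y') \<le> \<bar>?p\<bar> * norm (?u - ?u') + \<bar>?p - ?p'\<bar> * norm ?u'"
    using norm_triangle_ineq[of "?p *\<^sub>R (?u - ?u')" "(?p - ?p') *\<^sub>R ?u'"] by simp
  also have "\<bar>?p\<bar> * norm (?u - ?u') \<le> 1 * ((ah1 + ah2 / \<nu>) * norm (y - y'))"
    using grad_\<phi>s_bounds[of "hs \<nu> y"] by (intro mult_mono lip_grad_hs) auto
  also have "\<bar>?p - ?p'\<bar> * norm ?u' \<le> ((ap1 + ap2 / \<nu>) * (M\<^sub>h * norm (y - y'))) * M\<^sub>h"
    using lip_grad_\<phi>s[of "hs \<nu> y" "hs \<nu> y'"] mult_left_mono[OF lip_hs[of y y'] ap] M\<^sub>h_pos ap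
    by (intro mult_mono norm_grad_hs_le) (auto intro!: mult_nonneg_nonneg)
  finally show ?thesis by (simp add: L_H_def power2_eq_square algebra_simps add_divide_distrib)
qed

lemma has_derivative_gs: "(gs \<nu> has_derivative (\<lambda>v. grad_H \<nu> (c z) \<bullet> Dc z v)) (at z)"
proof -
  have "((\<lambda>z. hs \<nu> (c z)) has_derivative (\<lambda>v. gradient (hs \<nu>) (c z) \<bullet> Dc z v)) (at z)"
    using has_derivative_compose[OF Dc has_derivative_gradient[OF diff_hs]] .
  from has_derivative_compose[OF this has_derivative_gradient[OF diff_\<phi>s]]
  show ?thesis by (simp add: grad_H_def mult.commute)
qed

lemma gradient_gs: "gradient (gs \<nu>) z \<bullet> v = grad_H \<nu> (c z) \<bullet> Dc z v"
  by (rule gradient_inner_eq[OF has_derivative_gs])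

end

lemma segment_mem:
  assumes "z \<in> C" "w \<in> C" "0 \<le> s" "s \<le> 1"
  shows "z + s *\<^sub>R (w - z) \<in> C"
proof -
  have "z + s *\<^sub>R (w - z) = (1 - s) *\<^sub>R z + s *\<^sub>R w" by (simp add: algebra_simps)
  then show ?thesis using convexD[OF convex_C assms(1,2), of "1 - s" s] assms by simp
qed

text \<open>On \<open>C\<close> the map \<open>c\<close> is \<open>M\<^sub>c\<close>-Lipschitz, but \<open>C\<close> may have empty interior and the operator norm of
  \<open>Dc z\<close> may exceed \<open>M\<^sub>c\<close>. Only the directions that join \<open>z\<close> to points of \<open>C\<close> are controlled.\<close>

lemma norm_Dc_feasible:
  assumes "z \<in> C" "w \<in> C"
  shows "norm (Dc z (w - z)) \<le> M\<^sub>c * norm (w - z)"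
proof (rule tendsto_upperbound)
  show "((\<lambda>s. norm ((1 / s) *\<^sub>R (c (z + s *\<^sub>R (w - z)) - c z))) \<longlongrightarrow> norm (Dc z (w - z))) (at_right 0)"
    by (intro tendsto_norm directional_quotient_tendsto Dc)
  have "norm ((1 / s) *\<^sub>R (c (z + s *\<^sub>R (w - z)) - c z)) \<le> M\<^sub>c * norm (w - z)" if s: "0 < s" "s < 1" for s
  proof -
    have "z + s *\<^sub>R (w - z) \<in> C" using segment_mem assms s by simp
    then have "norm (c (z + s *\<^sub>R (w - z)) - c z) \<le> M\<^sub>c * (s * norm (w - z))"
      using lipschitz_onD[OF lip_c _ assms(1)] s by (fastforce simp: dist_norm)
    then show ?thesis using s by (simp add: divide_le_eq mult_ac)
  qed
  then show "\<forall>\<^sub>F s in at_right 0. norm ((1 / s) *\<^sub>R (c (z + s *\<^sub>R (w - z)) - c z)) \<le> M\<^sub>c * norm (w - z)"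
    unfolding eventually_at_right_field using zero_less_one by blast
qed simp

text \<open>Split the difference into the change of \<open>Dc\<close> and the change of \<open>grad_H\<close>. Only the latter meets
  \<open>Dc z' v\<close>, which is why \<open>M\<^sub>c\<close> has to control the direction \<open>v\<close> at \<open>z'\<close> alone.\<close>

lemma grad_gs_diff:
  assumes \<nu>: "\<nu> > 0" and "z \<in> C" "z' \<in> C" and v: "norm (Dc z' v) \<le> M\<^sub>c * norm v"
  shows "\<bar>gradient (gs \<nu>) z \<bullet> v - gradient (gs \<nu>) z' \<bullet> v\<bar> \<le> L_g \<nu> * norm (z - z') * norm v"
proof -
  let ?G = "grad_H \<nu> (c z)" and ?G' = "grad_H \<nu> (c z')"
  have "norm (fderiv c z - fderiv c z') \<le> L\<^sub>c * norm (z - z')"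
    using smooth_c assms by (auto simp: smooth_const_on_def lipschitz_on_def dist_norm)
  then have "norm ((fderiv c z - fderiv c z') v) \<le> (L\<^sub>c * norm (z - z')) * norm v"
    by (meson norm_blinfun order_trans mult_right_mono norm_ge_zero)
  then have 1: "\<bar>?G \<bullet> (Dc z v - Dc z' v)\<bar> \<le> M\<^sub>h * (L\<^sub>c * norm (z - z') * norm v)"
    using Cauchy_Schwarz_ineq2[of ?G "Dc z v - Dc z' v"]
      mult_mono[OF norm_grad_H_le[OF \<nu>, of "c z"], of "norm (Dc z v - Dc z' v)" "L\<^sub>c * norm (z - z') * norm v"]
      M\<^sub>h_pos by (simp add: blinfun.diff_left)
  have "norm (c z - c z') \<le> M\<^sub>c * norm (z - z')"
    using lipschitz_onD[OF lip_c assms(2,3)] by (simp add: dist_norm)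
  then have "norm (?G - ?G') \<le> L_H \<nu> * (M\<^sub>c * norm (z - z'))"
    using lip_grad_H[OF \<nu>, of "c z" "c z'"] L_H_nonneg[OF \<nu>] by (meson mult_left_mono order_trans)
  then have 2: "\<bar>(?G - ?G') \<bullet> Dc z' v\<bar> \<le> (L_H \<nu> * (M\<^sub>c * norm (z - z'))) * (M\<^sub>c * norm v)"
    using Cauchy_Schwarz_ineq2[of "?G - ?G'" "Dc z' v"] v const_signs L_H_nonneg[OF \<nu>]
      mult_mono[of "norm (?G - ?G')" "L_H \<nu> * (M\<^sub>c * norm (z - z'))" "norm (Dc z' v)" "M\<^sub>c * norm v"]
    by (meson mult_nonneg_nonneg norm_ge_zero order_trans)
  have "gradient (gs \<nu>) z \<bullet> v - gradient (gs \<nu>) z' \<bullet> v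
      = ?G \<bullet> (Dc z v - Dc z' v) + (?G - ?G') \<bullet> Dc z' v"
    by (simp add: gradient_gs[OF \<nu>] inner_diff_left inner_diff_right)
  then show ?thesis using 1 2
    by (simp add: L_g_def power2_eq_square algebra_simps)
qed

lemma gs_descent:
  assumes \<nu>: "\<nu> > 0" and zw: "z \<in> C" "w \<in> C"
  shows "gs \<nu> w \<le> gs \<nu> z + gradient (gs \<nu>) z \<bullet> (w - z) + L_g \<nu> / 2 * (norm (w - z))\<^sup>2"
proof -
  let ?p = "\<lambda>s. z + s *\<^sub>R (w - z)"
  have "gs \<nu> (z + (w - z)) \<le> gs \<nu> z + gradient (gs \<nu>) z \<bullet> (w - z) + L_g \<nu> * (norm (w - z))\<^sup>2 / 2"
  proof (rule segment_descent[where F' = "\<lambda>s v. grad_H \<nu> (c (?p s)) \<bullet> Dc (?p s) v"])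
    fix s :: real assume s: "0 \<le> s" "s \<le> 1"
    show "(gs \<nu> has_derivative (\<lambda>v. grad_H \<nu> (c (?p s)) \<bullet> Dc (?p s) v)) (at (?p s))"
      by (rule has_derivative_gs[OF \<nu>])
    have p: "?p s \<in> C" using segment_mem zw s by blast
    have "w - z = (w - ?p s) - (z - ?p s)" by simp
    then have "norm (Dc (?p s) (w - z)) \<le> norm (Dc (?p s) (w - ?p s)) + norm (Dc (?p s) (z - ?p s))"
      by (metis blinfun.diff_right norm_triangle_ineq4)
    also have "\<dots> \<le> M\<^sub>c * norm (w - ?p s) + M\<^sub>c * norm (z - ?p s)"
      using norm_Dc_feasible[OF p zw(1)] norm_Dc_feasible[OF p zw(2)] by simp
    also have "w - ?p s = (1 - s) *\<^sub>R (w - z)" by (simp add: algebra_simps)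
    also have "z - ?p s = (- s) *\<^sub>R (w - z)" by (simp add: algebra_simps)
    also have "M\<^sub>c * norm ((1 - s) *\<^sub>R (w - z)) + M\<^sub>c * norm ((- s) *\<^sub>R (w - z)) = M\<^sub>c * norm (w - z)"
      unfolding norm_scaleR using s by (simp add: algebra_simps)
    finally have "norm (Dc (?p s) (w - z)) \<le> M\<^sub>c * norm (w - z)" .
    from grad_gs_diff[OF \<nu> zw(1) p this]
    have "gradient (gs \<nu>) (?p s) \<bullet> (w - z) \<le> gradient (gs \<nu>) z \<bullet> (w - z) + L_g \<nu> * (s * norm (w - z)) * norm (w - z)"
      using s by simp
    then show "grad_H \<nu> (c (?p s)) \<bullet> Dc (?p s) (w - z)
        \<le> gradient (gs \<nu>) z \<bullet> (w - z) + L_g \<nu> * (norm (w - z))\<^sup>2 * s"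
      by (simp add: gradient_gs[OF \<nu>] power2_eq_square mult_ac)
  qed
  then show ?thesis by simp
qed

text \<open>By convexity of \<open>c\<close> with respect to \<open>- hzn h\<close>, the linearisation error of \<open>c\<close> is a limit of
  positive multiples of elements of \<open>- hzn h\<close>, and every gradient of a smoothing of \<open>h\<close> is nonpositive
  on \<open>hzn h\<close>. The chain rule therefore gives a global minorant, as for a composition of convex functions.\<close>

lemma gs_above_gradient:
  assumes \<nu>: "\<nu> > 0"
  shows "gs \<nu> z + gradient (gs \<nu>) z \<bullet> (w - z) \<le> gs \<nu> w"
proof -
  let ?u = "gradient (hs \<nu>) (c z)" and ?p = "gradient (\<phi>s \<nu>) (hs \<nu> (c z))"
  have "?u \<bullet> Dc z (w - z) \<le> ?u \<bullet> (c w - c z)"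
  proof (rule tendsto_upperbound)
    show "((\<lambda>s. ?u \<bullet> ((1 / s) *\<^sub>R (c (z + s *\<^sub>R (w - z)) - c z))) \<longlongrightarrow> ?u \<bullet> Dc z (w - z)) (at_right 0)"
      by (intro tendsto_inner tendsto_const directional_quotient_tendsto Dc)
    have "?u \<bullet> ((1 / s) *\<^sub>R (c (z + s *\<^sub>R (w - z)) - c z)) \<le> ?u \<bullet> (c w - c z)" if s: "0 < s" "s < 1" for s
    proof -
      have "s *\<^sub>R c w + (1 - s) *\<^sub>R c z - c (s *\<^sub>R w + (1 - s) *\<^sub>R z) \<in> uminus ` hzn h"
        using cone_c s by (simp add: cone_convex_def)
      then obtain d where d: "d \<in> hzn h" and
        "s *\<^sub>R c w + (1 - s) *\<^sub>R c z - c (s *\<^sub>R w + (1 - s) *\<^sub>R z) = - d" by blast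
      moreover have "s *\<^sub>R w + (1 - s) *\<^sub>R z = z + s *\<^sub>R (w - z)" by (simp add: algebra_simps)
      ultimately have "c (z + s *\<^sub>R (w - z)) - c z = s *\<^sub>R (c w - c z) + d"
        by (simp add: algebra_simps)
      then have "?u \<bullet> ((1 / s) *\<^sub>R (c (z + s *\<^sub>R (w - z)) - c z)) = ?u \<bullet> (c w - c z) + (?u \<bullet> d) / s"
        using s by (simp add: inner_add_right scaleR_add_right divide_inverse mult.commute)
      then show ?thesis using grad_hs_hzn_nonpos[OF \<nu> d, of "c z"] s by (simp add: divide_nonpos_pos)
    qed
    then show "\<forall>\<^sub>F s in at_right 0. ?u \<bullet> ((1 / s) *\<^sub>R (c (z + s *\<^sub>R (w - z)) - c z)) \<le> ?u \<bullet> (c w - c z)"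
      unfolding eventually_at_right_field using zero_less_one by blast
  qed simp
  also have "\<dots> \<le> hs \<nu> (c w) - hs \<nu> (c z)"
    using convex_above_gradient[OF convex_hs diff_hs, OF \<nu> \<nu>, of "c z" "c w"] by simp
  finally have "?p * (?u \<bullet> Dc z (w - z)) \<le> ?p * (hs \<nu> (c w) - hs \<nu> (c z))"
    using grad_\<phi>s_bounds(1)[OF \<nu>] by (rule mult_left_mono)
  also have "\<dots> \<le> gs \<nu> w - gs \<nu> z"
    using convex_above_gradient[OF convex_\<phi>s diff_\<phi>s, OF \<nu> \<nu>, of "hs \<nu> (c z)" "hs \<nu> (c w)"] by simp
  finally show ?thesis by (simp add: gradient_gs[OF \<nu>] grad_H_def)
qed

lemma gs_upper:
  assumes \<nu>: "\<nu> > 0"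
  shows "gs \<nu> z \<le> max (g z) 0 + (max ah32 0 + ap32) * \<nu>"
proof -
  have "ah32 * \<nu> \<le> max ah32 0 * \<nu>" using \<nu> by (intro mult_right_mono) auto
  moreover have "0 \<le> max ah32 0 * \<nu>" using \<nu> by simp
  ultimately have "max (hs \<nu> (c z)) 0 \<le> max (g z) 0 + max ah32 0 * \<nu>"
    using hs_upper[OF \<nu>, of "c z"] by linarith
  then show ?thesis using \<phi>s_upper[OF \<nu>, of "hs \<nu> (c z)"] unfolding distrib_right by linarith
qed

lemma gs_mono:
  assumes "0 < \<nu>1" "\<nu>1 \<le> \<nu>0"
  shows "gs \<nu>1 z \<le> gs \<nu>0 z + (ah4 + ap4) * (\<nu>0 - \<nu>1)"
proof -
  have \<nu>0: "\<nu>0 > 0" using assms by simp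
  let ?a = "hs \<nu>1 (c z)" and ?b = "hs \<nu>0 (c z)"
  have "\<phi>s \<nu>1 ?a \<le> \<phi>s \<nu>0 ?a + ap4 * (\<nu>0 - \<nu>1)"
    using mono_\<phi> assms by (simp add: smoothing_monotone_def)
  moreover have "\<phi>s \<nu>0 ?a - \<phi>s \<nu>0 ?b \<le> gradient (\<phi>s \<nu>0) ?a * (?a - ?b)"
    using convex_above_gradient[OF convex_\<phi>s diff_\<phi>s, OF \<nu>0 \<nu>0, of ?a ?b] by (simp add: algebra_simps)
  moreover have "gradient (\<phi>s \<nu>0) ?a * (?a - ?b) \<le> ah4 * (\<nu>0 - \<nu>1)"
  proof -
    have "?a - ?b \<le> ah4 * (\<nu>0 - \<nu>1)"
      using mono_h assms by (simp add: smoothing_monotone_def algebra_simps)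
    then have "gradient (\<phi>s \<nu>0) ?a * (?a - ?b) \<le> gradient (\<phi>s \<nu>0) ?a * (ah4 * (\<nu>0 - \<nu>1))"
      using grad_\<phi>s_bounds(1)[OF \<nu>0] by (rule mult_left_mono)
    also have "\<dots> \<le> 1 * (ah4 * (\<nu>0 - \<nu>1))"
      using assms ah4 by (intro mult_right_mono grad_\<phi>s_bounds(2)[OF \<nu>0]) auto
    finally show ?thesis by simp
  qed
  ultimately show ?thesis by (simp add: distrib_right)
qed

text \<open>Let the smaller parameter in the monotonicity estimate tend to zero. In contrast to the lower
  bound with \<open>ah31\<close> and \<open>ap31\<close>, the resulting constant is the one that also bounds the change of the
  merit function between iterations, and one correction term serves both purposes.\<close>

lemma gs_lower:
  assumes \<nu>: "\<nu> > 0"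
  shows "max (g z) 0 \<le> gs \<nu> z + (ah4 + ap4) * \<nu>"
proof (rule field_le_epsilon)
  fix e :: real assume e: "e > 0"
  define b where "b = max ah31 0 + \<bar>ap31\<bar> + 1"
  have b: "b > 0" by (simp add: b_def)
  define \<nu>1 where "\<nu>1 = min \<nu> (e / b)"
  have \<nu>1: "\<nu>1 > 0" "\<nu>1 \<le> \<nu>" "b * \<nu>1 \<le> e"
    using \<nu> e b by (auto simp: \<nu>1_def field_simps min_def)
  have "ah31 * \<nu>1 \<le> max ah31 0 * \<nu>1" "0 \<le> max ah31 0 * \<nu>1" "ap31 * \<nu>1 \<le> \<bar>ap31\<bar> * \<nu>1"
    using \<nu>1 by (auto intro!: mult_right_mono)
  then have "max (g z) 0 \<le> gs \<nu>1 z + max ah31 0 * \<nu>1 + \<bar>ap31\<bar> * \<nu>1"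
    using hs_lower[OF \<nu>1(1), of "c z"] \<phi>s_lower[OF \<nu>1(1), of "hs \<nu>1 (c z)"] by linarith
  also have "\<dots> \<le> gs \<nu>1 z + e" using \<nu>1 by (simp add: b_def algebra_simps)
  also have "gs \<nu>1 z \<le> gs \<nu> z + (ah4 + ap4) * (\<nu> - \<nu>1)" using gs_mono \<nu>1 by blast
  also have "(ah4 + ap4) * (\<nu> - \<nu>1) \<le> (ah4 + ap4) * \<nu>"
    using ah4 ap4 \<nu>1 by (intro mult_left_mono) auto
  finally show "max (g z) 0 \<le> gs \<nu> z + (ah4 + ap4) * \<nu> + e" by simp
qed

lemma grad_hs_eps_subgradient:
  assumes \<nu>: "\<nu> > 0" and e: "(ah31 + ah32) * \<nu> \<le> e"
  shows "gradient (hs \<nu>) y \<in> eps_subdifferential e (\<lambda>y. ereal (h y)) y"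
proof -
  have "h y + gradient (hs \<nu>) y \<bullet> (z - y) - e \<le> h z" for z
    using convex_above_gradient[OF convex_hs diff_hs, OF \<nu> \<nu>, of y z] hs_lower[OF \<nu>, of y]
      hs_upper[OF \<nu>, of z] e by (simp add: distrib_right)
  then show ?thesis by (simp add: eps_subdifferential_def)
qed

lemma L_g_nonneg: "\<nu> > 0 \<Longrightarrow> L_g \<nu> \<ge> 0"
  unfolding L_g_def using const_signs M\<^sub>h_pos L_H_nonneg by simp

lemma scaled_L_g_mono:
  assumes "0 < \<nu>" "\<nu> \<le> \<nu>0"
  shows "\<nu> * L_g \<nu> \<le> \<nu>0 * L_g \<nu>0"
proof -
  have eq: "r * L_g r = r * (M\<^sub>h * L\<^sub>c + (ah1 + M\<^sub>h\<^sup>2 * ap1) * M\<^sub>c\<^sup>2) + (ah2 + M\<^sub>h\<^sup>2 * ap2) * M\<^sub>c\<^sup>2" if "r > 0" for r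
    using that by (simp add: L_g_def L_H_def field_simps)
  have "\<nu> * (M\<^sub>h * L\<^sub>c + (ah1 + M\<^sub>h\<^sup>2 * ap1) * M\<^sub>c\<^sup>2) \<le> \<nu>0 * (M\<^sub>h * L\<^sub>c + (ah1 + M\<^sub>h\<^sup>2 * ap1) * M\<^sub>c\<^sup>2)"
    using assms const_signs M\<^sub>h_pos by (intro mult_right_mono add_nonneg_nonneg) auto
  then show ?thesis using assms eq[of \<nu>] eq[of \<nu>0] by simp
qed

end

section \<open>One proximal step on the penalised problem\<close>

locale penalised_problem = smoothed_composite +
  fixes f P1 :: "'a \<Rightarrow> real" and L\<^sub>f :: real
  assumes compact_C: "compact C"
    and C1_f: "continuously_differentiable f" and smooth_f: "smooth_const_on L\<^sub>f C f"
    and convex_f: "convex_on UNIV f" and convex_P1: "convex_on UNIV P1"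
begin

abbreviation obj :: "'a \<Rightarrow> real" where "obj z \<equiv> f z + P1 z"

definition merit :: "real \<Rightarrow> real \<Rightarrow> 'a \<Rightarrow> real" where
  "merit \<gamma> \<nu> z = \<gamma> * obj z + gs \<nu> z"

abbreviation obj_ext :: "'a \<Rightarrow> ereal" where
  "obj_ext \<equiv> (\<lambda>z. ereal (obj z) + indicator_fun C z)"

abbreviation model :: "real \<Rightarrow> real \<Rightarrow> 'a \<Rightarrow> real \<Rightarrow> 'a \<Rightarrow> ereal" where
  "model \<gamma> \<nu> xk l \<equiv> sESQM_model f P1 C (gs \<nu>) \<gamma> \<nu> xk 0 l"

lemma diff_f: "f differentiable (at z)"
  using C1_f by (simp add: continuously_differentiable_def)

lemma f_descent:
  assumes zw: "z \<in> C" "w \<in> C"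
  shows "f w \<le> f z + gradient f z \<bullet> (w - z) + L\<^sub>f / 2 * (norm (w - z))\<^sup>2"
proof -
  let ?p = "\<lambda>s. z + s *\<^sub>R (w - z)"
  have "f (z + (w - z)) \<le> f z + gradient f z \<bullet> (w - z) + L\<^sub>f * (norm (w - z))\<^sup>2 / 2"
  proof (rule segment_descent[where F' = "\<lambda>s. blinfun_apply (fderiv f (?p s))"])
    fix s :: real assume s: "0 \<le> s" "s \<le> 1"
    show "(f has_derivative fderiv f (?p s)) (at (?p s))"
      by (rule has_derivative_fderiv[OF diff_f])
    have "norm (fderiv f (?p s) - fderiv f z) \<le> L\<^sub>f * norm (?p s - z)"
      using lipschitz_onD[OF smooth_f[unfolded smooth_const_on_def] segment_mem[OF zw s] zw(1)]
      unfolding dist_norm .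
    then have "norm ((fderiv f (?p s) - fderiv f z) (w - z)) \<le> L\<^sub>f * norm (?p s - z) * norm (w - z)"
      by (meson norm_blinfun order_trans mult_right_mono norm_ge_zero)
    then have "fderiv f (?p s) (w - z) \<le> fderiv f z (w - z) + L\<^sub>f * norm (?p s - z) * norm (w - z)"
      by (simp add: blinfun.diff_left)
    then show "fderiv f (?p s) (w - z) \<le> gradient f z \<bullet> (w - z) + L\<^sub>f * (norm (w - z))\<^sup>2 * s"
      using s gradient_inner_eq[OF has_derivative_fderiv[OF diff_f], of z "w - z"]
      by (simp add: power2_eq_square mult_ac)
  qed
  then show ?thesis by simp
qed

definition linear_part :: "real \<Rightarrow> real \<Rightarrow> 'a \<Rightarrow> 'a \<Rightarrow> real" where
  "linear_part \<gamma> \<nu> xk z = \<gamma> * (gradient f xk \<bullet> z + P1 z) + gradient (gs \<nu>) xk \<bullet> z"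

lemma convex_linear_part:
  assumes \<gamma>: "\<gamma> \<ge> 0" and s: "0 \<le> s" "s \<le> 1"
  shows "linear_part \<gamma> \<nu> xk (y + s *\<^sub>R (z - y))
    \<le> linear_part \<gamma> \<nu> xk y + s * (linear_part \<gamma> \<nu> xk z - linear_part \<gamma> \<nu> xk y)"
proof -
  have "y + s *\<^sub>R (z - y) = (1 - s) *\<^sub>R y + s *\<^sub>R z" by (simp add: algebra_simps)
  then have "P1 (y + s *\<^sub>R (z - y)) \<le> P1 y + s * (P1 z - P1 y)"
    using convex_onD[OF convex_P1, of s y z] s by (simp add: algebra_simps)
  then have "\<gamma> * P1 (y + s *\<^sub>R (z - y)) \<le> \<gamma> * (P1 y + s * (P1 z - P1 y))"
    using \<gamma> by (rule mult_left_mono)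
  then show ?thesis
    by (simp add: linear_part_def algebra_simps inner_simps)
qed

lemma model_on_C:
  assumes "z \<in> C"
  shows "model \<gamma> \<nu> xk l z = ereal (linear_part \<gamma> \<nu> xk z + l / (2 * \<nu>) * (norm (z - xk))\<^sup>2
    + (gs \<nu> xk - gradient (gs \<nu>) xk \<bullet> xk))"
  using assms by (simp add: sESQM_model_def indicator_fun_def linear_part_def inner_diff_right)

text \<open>Optimality of the subproblem solution \<open>y\<close> as a variational inequality in which the nonsmooth
  term \<open>P1\<close> is kept: compare \<open>y\<close> with points \<open>y + s (z - y)\<close> and let \<open>s\<close> tend to \<open>0\<close>.\<close>

lemma model_argmin:
  assumes am: "is_arg_min (model \<gamma> \<nu> xk l) (\<lambda>_. True) y" and xk: "xk \<in> C" and \<gamma>: "\<gamma> \<ge> 0"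
  shows model_argmin_mem: "y \<in> C"
    and model_argmin_vi: "z \<in> C \<Longrightarrow>
      linear_part \<gamma> \<nu> xk y \<le> linear_part \<gamma> \<nu> xk z + l / \<nu> * ((y - xk) \<bullet> (z - y))"
proof -
  have le: "model \<gamma> \<nu> xk l y \<le> model \<gamma> \<nu> xk l z" for z
    using am by (auto simp: is_arg_min_def not_less)
  show y: "y \<in> C"
  proof (rule ccontr)
    assume "y \<notin> C"
    then show False using le[of xk] model_on_C[OF xk, of \<gamma> \<nu> xk l]
      by (simp add: sESQM_model_def indicator_fun_def)
  qed
  assume z: "z \<in> C"
  let ?d = "linear_part \<gamma> \<nu> xk z - linear_part \<gamma> \<nu> xk y"
  have quot: "0 \<le> ?d + l / \<nu> * ((y - xk) \<bullet> (z - y)) + s * (l / (2 * \<nu>) * (norm (z - y))\<^sup>2)"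
    if s: "0 < s" "s < 1" for s
  proof -
    have w: "y + s *\<^sub>R (z - y) \<in> C" using segment_mem y z s by simp
    have sq: "(norm (y + s *\<^sub>R (z - y) - xk))\<^sup>2
        = (norm (y - xk))\<^sup>2 + s * (2 * ((y - xk) \<bullet> (z - y)) + s * (norm (z - y))\<^sup>2)"
      unfolding power2_norm_eq_inner by (simp add: inner_simps inner_commute algebra_simps)
    have "linear_part \<gamma> \<nu> xk y + l / (2 * \<nu>) * (norm (y - xk))\<^sup>2
        \<le> linear_part \<gamma> \<nu> xk (y + s *\<^sub>R (z - y)) + l / (2 * \<nu>) * (norm (y + s *\<^sub>R (z - y) - xk))\<^sup>2"
      using le[of "y + s *\<^sub>R (z - y)"] by (simp add: model_on_C[OF w] model_on_C[OF y])
    also have "\<dots> \<le> linear_part \<gamma> \<nu> xk y + s * ?d + l / (2 * \<nu>) * (norm (y + s *\<^sub>R (z - y) - xk))\<^sup>2"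
      using convex_linear_part[OF \<gamma>, of s] s by simp
    finally have "0 \<le> s * (?d + 2 * (l / (2 * \<nu>)) * ((y - xk) \<bullet> (z - y)) + s * (l / (2 * \<nu>) * (norm (z - y))\<^sup>2))"
      unfolding sq by (simp only: distrib_left mult_ac)
    then show ?thesis using s by (simp add: zero_le_mult_iff)
  qed
  have "0 \<le> ?d + l / \<nu> * ((y - xk) \<bullet> (z - y)) + 0 * (l / (2 * \<nu>) * (norm (z - y))\<^sup>2)"
  proof (rule tendsto_lowerbound)
    show "((\<lambda>s. ?d + l / \<nu> * ((y - xk) \<bullet> (z - y)) + s * (l / (2 * \<nu>) * (norm (z - y))\<^sup>2))
        \<longlongrightarrow> ?d + l / \<nu> * ((y - xk) \<bullet> (z - y)) + 0 * (l / (2 * \<nu>) * (norm (z - y))\<^sup>2)) (at_right 0)"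
      by (intro tendsto_intros)
    show "\<forall>\<^sub>F s in at_right 0. 0 \<le> ?d + l / \<nu> * ((y - xk) \<bullet> (z - y)) + s * (l / (2 * \<nu>) * (norm (z - y))\<^sup>2)"
      unfolding eventually_at_right_field using quot zero_less_one by blast
  qed simp
  then show "linear_part \<gamma> \<nu> xk y \<le> linear_part \<gamma> \<nu> xk z + l / \<nu> * ((y - xk) \<bullet> (z - y))"
    by simp
qed

text \<open>The three-point inequality. At \<open>y\<close> the linearised terms are replaced with the descent lemmas, at
  \<open>z\<close> with convexity.\<close>

lemma merit_step:
  assumes am: "is_arg_min (model \<gamma> \<nu> xk l) (\<lambda>_. True) y" and xk: "xk \<in> C" and \<gamma>: "\<gamma> \<ge> 0"
    and \<nu>: "\<nu> > 0" and z: "z \<in> C"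
  shows "merit \<gamma> \<nu> y - merit \<gamma> \<nu> z
    \<le> l / (2 * \<nu>) * ((norm (z - xk))\<^sup>2 - (norm (z - y))\<^sup>2)
      + (\<nu> * (\<gamma> * L\<^sub>f + L_g \<nu>) - l) / (2 * \<nu>) * (norm (y - xk))\<^sup>2"
proof -
  have y: "y \<in> C" by (rule model_argmin_mem[OF am xk \<gamma>])
  have vi: "linear_part \<gamma> \<nu> xk y \<le> linear_part \<gamma> \<nu> xk z + l / \<nu> * ((y - xk) \<bullet> (z - y))"
    by (rule model_argmin_vi[OF am xk \<gamma> z])
  have fy: "\<gamma> * f y \<le> \<gamma> * (f xk + gradient f xk \<bullet> (y - xk) + L\<^sub>f / 2 * (norm (y - xk))\<^sup>2)"
    by (rule mult_left_mono[OF f_descent[OF xk y] \<gamma>])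
  have fz: "\<gamma> * (f xk + gradient f xk \<bullet> (z - xk)) \<le> \<gamma> * f z"
    by (rule mult_left_mono[OF convex_above_gradient[OF convex_f diff_f] \<gamma>])
  have gy: "gs \<nu> y \<le> gs \<nu> xk + gradient (gs \<nu>) xk \<bullet> (y - xk) + L_g \<nu> / 2 * (norm (y - xk))\<^sup>2"
    by (rule gs_descent[OF \<nu> xk y])
  have gz: "gs \<nu> xk + gradient (gs \<nu>) xk \<bullet> (z - xk) \<le> gs \<nu> z"
    by (rule gs_above_gradient[OF \<nu>])
  have "merit \<gamma> \<nu> y - merit \<gamma> \<nu> z \<le> l / \<nu> * ((y - xk) \<bullet> (z - y))
      + (\<gamma> * (L\<^sub>f / 2 * (norm (y - xk))\<^sup>2) + L_g \<nu> / 2 * (norm (y - xk))\<^sup>2)"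
    using fy fz gy gz vi
    by (simp add: merit_def linear_part_def inner_diff_right distrib_left right_diff_distrib)
  also have "(y - xk) \<bullet> (z - y) = ((norm (z - xk))\<^sup>2 - (norm (z - y))\<^sup>2 - (norm (y - xk))\<^sup>2) / 2"
    unfolding power2_norm_eq_inner by (simp add: inner_simps inner_commute)
  also have "l / \<nu> * (((norm (z - xk))\<^sup>2 - (norm (z - y))\<^sup>2 - (norm (y - xk))\<^sup>2) / 2)
      + (\<gamma> * (L\<^sub>f / 2 * (norm (y - xk))\<^sup>2) + L_g \<nu> / 2 * (norm (y - xk))\<^sup>2)
    = l / (2 * \<nu>) * ((norm (z - xk))\<^sup>2 - (norm (z - y))\<^sup>2)
      + (\<nu> * (\<gamma> * L\<^sub>f + L_g \<nu>) - l) / (2 * \<nu>) * (norm (y - xk))\<^sup>2"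
    using \<nu> by (simp add: field_simps)
  finally show ?thesis .
qed

lemma descent_iff:
  assumes "xk \<in> C" "y \<in> C"
  shows "sESQM_descent obj_ext (gs \<nu>) \<gamma> \<nu> c1 xk y
    \<longleftrightarrow> merit \<gamma> \<nu> y \<le> merit \<gamma> \<nu> xk - c1 / (2 * \<nu>) * (norm (y - xk))\<^sup>2"
  using assms by (simp add: sESQM_descent_def indicator_fun_def merit_def)

text \<open>With \<open>z = xk\<close> the three-point inequality accepts every trial constant \<open>l\<close> with
  \<open>2 * l \<ge> c1 + \<nu> * (\<gamma> * L\<^sub>f + L_g \<nu>)\<close>. A rejected constant is therefore less than half of this
  threshold, and its double does not exceed it.\<close>

lemma accepted_constant:
  assumes step: "sESQM_step f P1 (\<lambda>_. 0) C obj_ext (gs \<nu>) \<gamma> \<nu> Llo Lup c1 xk xk'"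
    and xk: "xk \<in> C" and \<gamma>: "\<gamma> \<ge> 0" and \<nu>: "\<nu> > 0" and Llo: "0 < Llo"
  obtains l where "Llo \<le> l" "l \<le> max Lup (c1 + \<nu> * (\<gamma> * L\<^sub>f + L_g \<nu>))"
    "is_arg_min (model \<gamma> \<nu> xk l) (\<lambda>_. True) xk'" "xk' \<in> C"
    "merit \<gamma> \<nu> xk' \<le> merit \<gamma> \<nu> xk - c1 / (2 * \<nu>) * (norm (xk' - xk))\<^sup>2"
proof -
  obtain \<xi> L0 y j where \<xi>: "\<xi> \<in> subdifferential (\<lambda>z. ereal 0) xk" and L0: "Llo \<le> L0" "L0 \<le> Lup"
    and am: "\<And>i. i \<le> j \<Longrightarrow> is_arg_min (sESQM_model f P1 C (gs \<nu>) \<gamma> \<nu> xk \<xi> (2 ^ i * L0)) (\<lambda>_. True) (y i)"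
    and rej: "\<And>i. i < j \<Longrightarrow> \<not> sESQM_descent obj_ext (gs \<nu>) \<gamma> \<nu> c1 xk (y i)"
    and acc: "sESQM_descent obj_ext (gs \<nu>) \<gamma> \<nu> c1 xk (y j)" and xk': "xk' = y j"
    using step unfolding sESQM_step_def by blast
  have "\<xi> \<bullet> (xk + \<xi> - xk) \<le> 0"
    using \<xi> unfolding mem_subdifferential_real by (metis add_0)
  then have "\<xi> = 0" by (simp add: inner_gt_zero_iff flip: not_less)
  with am have am: "is_arg_min (model \<gamma> \<nu> xk (2 ^ i * L0)) (\<lambda>_. True) (y i)" if "i \<le> j" for i
    using that by simp
  have yC: "y i \<in> C" if "i \<le> j" for i using model_argmin_mem[OF am[OF that] xk \<gamma>] .
  show thesis
  proof (rule that[of "2 ^ j * L0"])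
    have "1 * L0 \<le> 2 ^ j * L0" using L0 Llo by (intro mult_right_mono) auto
    then show "Llo \<le> 2 ^ j * L0" using L0 by simp
    show "2 ^ j * L0 \<le> max Lup (c1 + \<nu> * (\<gamma> * L\<^sub>f + L_g \<nu>))"
    proof (cases j)
      case 0 then show ?thesis using L0 by simp
    next
      case (Suc i)
      let ?l = "2 ^ i * L0" and ?n = "(norm (y i - xk))\<^sup>2"
      have i: "i \<le> j" "i < j" using Suc by auto
      have "merit \<gamma> \<nu> (y i) > merit \<gamma> \<nu> xk - c1 / (2 * \<nu>) * ?n"
        using rej[OF i(2)] descent_iff[OF xk yC[OF i(1)]] by simp
      moreover have "merit \<gamma> \<nu> (y i) - merit \<gamma> \<nu> xk
          \<le> ?l / (2 * \<nu>) * (- ?n) + (\<nu> * (\<gamma> * L\<^sub>f + L_g \<nu>) - ?l) / (2 * \<nu>) * ?n"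
        using merit_step[OF am[OF i(1)] xk \<gamma> \<nu> xk] by (simp add: norm_minus_commute)
      ultimately have "0 < (c1 + \<nu> * (\<gamma> * L\<^sub>f + L_g \<nu>) - 2 * ?l) / (2 * \<nu>) * ?n"
        by (simp add: add_divide_distrib diff_divide_distrib algebra_simps)
      then have "0 < (c1 + \<nu> * (\<gamma> * L\<^sub>f + L_g \<nu>) - 2 * ?l) / (2 * \<nu>)"
        by (metis zero_less_mult_pos2 mult_zero_right less_irrefl not_less zero_le_power2 order_less_le)
      then have "0 < c1 + \<nu> * (\<gamma> * L\<^sub>f + L_g \<nu>) - 2 * ?l"
        using \<nu> by (simp add: zero_less_divide_iff)
      then show ?thesis using Suc by simp
    qed
  qed (use am acc yC descent_iff[OF xk yC] xk' in auto)
qed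

text \<open>How an increase of \<open>t\<close> bounds \<open>\<gamma>\<close> from below. Along a feasible direction that decreases the
  linearised constraint at rate almost \<open>\<eta>\<close>, optimality of the step says that the objective, the
  proximal term and the change of the gradient of \<open>gs \<nu>\<close> compensate this decrease. The smoothed
  positive part has slope above one half, and a short step makes all compensating terms \<open>O(\<gamma>)\<close>.\<close>

lemma penalty_lower_bound:
  assumes am: "is_arg_min (model \<gamma> \<nu> xk l) (\<lambda>_. True) y" and xk: "xk \<in> C" and \<gamma>: "\<gamma> > 0"
    and \<nu>: "\<nu> > 0" and l: "l \<ge> 0"
    and short: "norm (y - xk) \<le> c2 * \<nu> * \<gamma>"
    and active: "hs \<nu> (c y) > 2 * (ap31 + ap32) * \<nu>"
    and \<eta>: "\<eta> > 0" and gap: "\<And>n. n \<in> normal_cone C y \<Longrightarrow>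
      \<eta> \<le> norm (adjoint (Dc y) (gradient (hs \<nu>) (c y)) + n)"
    and Mf: "\<And>z. z \<in> C \<Longrightarrow> norm (gradient f z) \<le> Mf"
    and MP: "\<And>z \<xi>. z \<in> C \<Longrightarrow> \<xi> \<in> subdifferential (\<lambda>z. ereal (P1 z)) z \<Longrightarrow> norm \<xi> \<le> MP"
  shows "\<eta> / 2 < \<gamma> * (Mf + MP + c2 * (l + \<nu> * L_g \<nu>))"
proof -
  have y: "y \<in> C" using model_argmin_mem[OF am xk] \<gamma> by simp
  let ?p = "gradient (\<phi>s \<nu>) (hs \<nu> (c y))" and ?u = "gradient (hs \<nu>) (c y)"
  let ?v = "adjoint (Dc y) ?u"
  have p: "?p > 1 / 2" by (rule grad_\<phi>s_gt_half[OF \<nu> active])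
  \<comment> \<open>Since \<open>?p > 1 / 2\<close>, this rate is below \<open>\<eta>\<close>, and multiplied with the slope \<open>?p\<close> it is \<open>\<eta> / 2\<close>.\<close>
  define \<eta>' where "\<eta>' = \<eta> / (2 * ?p)"
  have \<eta>': "0 \<le> \<eta>'" "\<eta>' < \<eta>" "?p * \<eta>' = \<eta> / 2"
    using p \<eta> by (auto simp: \<eta>'_def divide_less_eq)
  obtain z where z: "z \<in> C" and vz: "?v \<bullet> (z - y) < - \<eta>' * norm (z - y)"
    using feasible_direction_of_normal_gap[OF convex_C y gap \<eta>'(1,2)] by blast
  let ?r = "norm (z - y)"
  have r: "?r > 0" using vz by (cases "z = y") auto
  have "?v \<bullet> (z - y) = ?u \<bullet> Dc y (z - y)"
    using adjoint_works[of "Dc y" "z - y" ?u] by (simp add: blinfun.bounded_linear_right bounded_linear.linear inner_commute)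
  then have "gradient (gs \<nu>) y \<bullet> (z - y) = ?p * (?v \<bullet> (z - y))"
    by (simp add: gradient_gs[OF \<nu>] grad_H_def)
  also have "\<dots> < ?p * (- \<eta>' * ?r)" using vz p by (intro mult_strict_left_mono) auto
  also have "\<dots> = - (\<eta> / 2) * ?r" by (simp add: \<eta>'(3)[symmetric])
  finally have gy: "gradient (gs \<nu>) y \<bullet> (z - y) < - (\<eta> / 2) * ?r" .
  have "gradient (gs \<nu>) xk \<bullet> (z - y) \<le> gradient (gs \<nu>) y \<bullet> (z - y) + L_g \<nu> * norm (xk - y) * ?r"
    using grad_gs_diff[OF \<nu> xk y norm_Dc_feasible[OF y z]] by simp
  with gy have gx: "gradient (gs \<nu>) xk \<bullet> (z - y) < (L_g \<nu> * norm (y - xk) - \<eta> / 2) * ?r"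
    by (simp add: norm_minus_commute algebra_simps)
  obtain \<xi> where \<xi>: "\<xi> \<in> subdifferential (\<lambda>z. ereal (P1 z)) z"
    using convex_subgradient_exists[OF convex_P1] by blast
  have "P1 z + \<xi> \<bullet> (y - z) \<le> P1 y" using \<xi> by (simp add: mem_subdifferential_real)
  then have "P1 z - P1 y \<le> \<xi> \<bullet> (z - y)" by (simp add: inner_diff_right)
  also have "\<dots> \<le> norm \<xi> * ?r" by (rule norm_cauchy_schwarz)
  also have "\<dots> \<le> MP * ?r" by (intro mult_right_mono MP[OF z \<xi>]) simp
  finally have P: "P1 z - P1 y \<le> MP * ?r" .
  have "gradient f xk \<bullet> (z - y) \<le> norm (gradient f xk) * ?r" by (rule norm_cauchy_schwarz)
  also have "\<dots> \<le> Mf * ?r" by (intro mult_right_mono Mf[OF xk]) simp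
  finally have F: "gradient f xk \<bullet> (z - y) \<le> Mf * ?r" .
  have "(y - xk) \<bullet> (z - y) \<le> norm (y - xk) * ?r" by (rule norm_cauchy_schwarz)
  then have prox: "l / \<nu> * ((y - xk) \<bullet> (z - y)) \<le> l / \<nu> * (norm (y - xk) * ?r)"
    using l \<nu> by (intro mult_left_mono) auto
  have "0 \<le> linear_part \<gamma> \<nu> xk z - linear_part \<gamma> \<nu> xk y + l / \<nu> * ((y - xk) \<bullet> (z - y))"
    using model_argmin_vi[OF am xk _ z] \<gamma> by simp
  also have "linear_part \<gamma> \<nu> xk z - linear_part \<gamma> \<nu> xk y
      = \<gamma> * (gradient f xk \<bullet> (z - y) + (P1 z - P1 y)) + gradient (gs \<nu>) xk \<bullet> (z - y)"
    by (simp add: linear_part_def inner_diff_right algebra_simps)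
  also have "\<gamma> * (gradient f xk \<bullet> (z - y) + (P1 z - P1 y)) \<le> \<gamma> * (Mf * ?r + MP * ?r)"
    using F P \<gamma> by (intro mult_left_mono) auto
  finally have "0 < \<gamma> * (Mf * ?r + MP * ?r) + (L_g \<nu> * norm (y - xk) - \<eta> / 2) * ?r + l / \<nu> * (norm (y - xk) * ?r)"
    using gx prox by linarith
  also have "\<dots> = (\<gamma> * (Mf + MP) + (L_g \<nu> + l / \<nu>) * norm (y - xk) - \<eta> / 2) * ?r"
    by (simp add: algebra_simps)
  finally have "\<eta> / 2 < \<gamma> * (Mf + MP) + (L_g \<nu> + l / \<nu>) * norm (y - xk)"
    using r by (simp add: zero_less_mult_iff)
  also have "(L_g \<nu> + l / \<nu>) * norm (y - xk) \<le> (L_g \<nu> + l / \<nu>) * (c2 * \<nu> * \<gamma>)"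
    using short L_g_nonneg[OF \<nu>] l \<nu> by (intro mult_left_mono) auto
  also have "(L_g \<nu> + l / \<nu>) * (c2 * \<nu> * \<gamma>) = \<gamma> * (c2 * (l + \<nu> * L_g \<nu>))"
    using \<nu> by (simp add: field_simps)
  finally show ?thesis by (simp add: distrib_left)
qed

end

section \<open>Merit decrease and quasi-Fejer monotonicity\<close>

text \<open>What the analysis with a constant penalty parameter needs to know about the iteration from index
  \<open>N\<close> on. Here \<open>p\<close> is the objective, \<open>gp\<close> the constraint violation, \<open>gs\<close> its smoothing, and \<open>l k\<close> the
  accepted proximal constant. Feasibility enters only through \<open>short_step\<close>.\<close>

locale penalised_descent =
  fixes C :: "'a::euclidean_space set"
    and p gp :: "'a \<Rightarrow> real" and gs :: "real \<Rightarrow> 'a \<Rightarrow> real"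
    and x :: "nat \<Rightarrow> 'a" and \<mu> l :: "nat \<Rightarrow> real"
    and \<gamma> b a4 Llo M\<^sub>L A c1 c2 r :: real and N :: nat
  assumes compact_C: "compact C"
    and cont_p: "continuous_on C p" and cont_gp: "continuous_on C gp"
    and gp_nonneg: "\<And>z. gp z \<ge> 0"
    and x_mem: "\<And>k. x k \<in> C"
    and \<mu>_pos: "\<And>k. \<mu> k > 0" and \<mu>_dec: "decseq \<mu>" and \<mu>_lim: "\<mu> \<longlonglongrightarrow> 0" and \<mu>_div: "\<not> summable \<mu>"
    and signs: "\<gamma> > 0" "b \<ge> 0" "a4 \<ge> 0" "Llo > 0" "A \<ge> 0" "c1 > 0" "c2 > 0"
    and gs_le: "\<And>\<nu> z. 0 < \<nu> \<Longrightarrow> gs \<nu> z \<le> gp z + b * \<nu>"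
    and gs_ge: "\<And>\<nu> z. 0 < \<nu> \<Longrightarrow> gp z \<le> gs \<nu> z + a4 * \<nu>"
    and gs_mono: "\<And>\<nu>1 \<nu>0 z. 0 < \<nu>1 \<Longrightarrow> \<nu>1 \<le> \<nu>0 \<Longrightarrow> gs \<nu>1 z \<le> gs \<nu>0 z + a4 * (\<nu>0 - \<nu>1)"
    and l_bounds: "\<And>k. N \<le> k \<Longrightarrow> Llo \<le> l k" "\<And>k. N \<le> k \<Longrightarrow> l k \<le> M\<^sub>L"
    and descent: "\<And>k. N \<le> k \<Longrightarrow>
      \<gamma> * p (x (Suc k)) + gs (\<mu> k) (x (Suc k))
        \<le> \<gamma> * p (x k) + gs (\<mu> k) (x k) - c1 / (2 * \<mu> k) * (norm (x (Suc k) - x k))\<^sup>2"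
    and three_point: "\<And>k z. N \<le> k \<Longrightarrow> z \<in> C \<Longrightarrow>
      (\<gamma> * p (x (Suc k)) + gs (\<mu> k) (x (Suc k))) - (\<gamma> * p z + gs (\<mu> k) z)
        \<le> l k / (2 * \<mu> k) * ((norm (z - x k))\<^sup>2 - (norm (z - x (Suc k)))\<^sup>2)
          + A / (2 * \<mu> k) * (norm (x (Suc k) - x k))\<^sup>2"
    and short_step: "\<And>k. N \<le> k \<Longrightarrow> norm (x (Suc k) - x k) \<le> c2 * \<mu> k * \<gamma> \<Longrightarrow> gp (x (Suc k)) \<le> r * \<mu> k"
begin

definition F :: "'a \<Rightarrow> real" where "F z = \<gamma> * p z + gp z"

definition M :: "nat \<Rightarrow> 'a \<Rightarrow> real" where "M k z = \<gamma> * p z + gs (\<mu> k) z"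

text \<open>The shift by \<open>a4 * \<mu> k\<close> compensates the change of the smoothing parameter, so that \<open>V\<close> decreases.\<close>

definition V :: "nat \<Rightarrow> real" where "V k = M k (x k) + a4 * \<mu> k"

abbreviation sqstep :: "nat \<Rightarrow> real" where "sqstep k \<equiv> (norm (x (Suc k) - x k))\<^sup>2"

lemma M_le_F: "M k z \<le> F z + b * \<mu> k"
  using gs_le[OF \<mu>_pos] by (simp add: M_def F_def)

lemma F_le_M: "F z \<le> M k z + a4 * \<mu> k"
  using gs_ge[OF \<mu>_pos] by (simp add: M_def F_def)

lemma V_Suc_le: "V (Suc k) \<le> M k (x (Suc k)) + a4 * \<mu> k"
  using gs_mono[OF \<mu>_pos, of "Suc k" "\<mu> k"] decseqD[OF \<mu>_dec, of k "Suc k"]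
  by (simp add: V_def M_def algebra_simps)

lemma V_decrease:
  assumes "N \<le> k"
  shows "M k (x (Suc k)) + a4 * \<mu> k \<le> V k - c1 / 2 * (sqstep k / \<mu> k)"
  using descent[OF assms] by (simp add: V_def M_def)

lemma sqstep_le_V_diff:
  assumes "N \<le> k"
  shows "sqstep k / \<mu> k \<le> 2 / c1 * (V k - V (Suc k))"
  using V_decrease[OF assms] V_Suc_le[of k] signs by (simp add: field_simps)

lemma M\<^sub>L_pos: "M\<^sub>L > 0"
  using l_bounds[of N] signs by simp

lemma cont_F: "continuous_on C F"
  unfolding F_def by (intro continuous_intros cont_p cont_gp)

lemma V_convergent:
  obtains Vinf where "V \<longlonglongrightarrow> Vinf" "\<And>k. N \<le> k \<Longrightarrow> Vinf \<le> V k"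
proof -
  have "bounded (F ` C)"
    by (intro compact_imp_bounded compact_continuous_image cont_F compact_C)
  then obtain B where B: "\<And>z. z \<in> C \<Longrightarrow> \<bar>F z\<bar> \<le> B" by (auto simp: bounded_iff)
  have low: "- B \<le> V k" for k using B[OF x_mem[of k]] F_le_M[of "x k" k] by (simp add: V_def)
  have "V (Suc k) \<le> V k" if "N \<le> k" for k
    using sqstep_le_V_diff[OF that] \<mu>_pos[of k] signs
    by (smt (verit) divide_nonneg_pos zero_le_power2 zero_le_mult_iff divide_pos_pos)
  then have dec: "decseq (\<lambda>n. V (n + N))" by (intro decseq_SucI) simp
  obtain Vinf where lim: "(\<lambda>n. V (n + N)) \<longlonglongrightarrow> Vinf" and ge: "\<And>n. Vinf \<le> V (n + N)"
    using decseq_convergent[OF dec, of "- B"] low by blast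
  show thesis
  proof (rule that)
    show "V \<longlonglongrightarrow> Vinf" using lim LIMSEQ_offset by blast
    show "Vinf \<le> V k" if "N \<le> k" for k using ge[of "k - N"] that by simp
  qed
qed

lemma summable_sqstep_over_\<mu>: "summable (\<lambda>k. sqstep (k + N) / \<mu> (k + N))"
proof -
  obtain Vinf where V: "\<And>k. N \<le> k \<Longrightarrow> Vinf \<le> V k" using V_convergent by blast
  have "(\<Sum>k<n. sqstep (k + N) / \<mu> (k + N)) \<le> 2 / c1 * (V N - V (n + N))" for n
  proof (induction n)
    case (Suc n)
    then show ?case using sqstep_le_V_diff[of "n + N"] by (simp add: algebra_simps)
  qed simp
  also have "2 / c1 * (V N - V (n + N)) \<le> 2 / c1 * (V N - Vinf)" for n
    using V[of "n + N"] signs by (intro mult_left_mono) auto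
  finally show ?thesis
    using \<mu>_pos by (intro summableI_nonneg_bounded[of _ "2 / c1 * (V N - Vinf)"]) (auto intro: divide_nonneg_pos)
qed

lemma \<mu>_antimono: "m \<le> k \<Longrightarrow> \<mu> k \<le> \<mu> m"
  using \<mu>_dec by (simp add: decseq_def)

lemma sqstep_le: "m \<le> k \<Longrightarrow> sqstep k \<le> \<mu> m * (sqstep k / \<mu> k)"
  using mult_right_mono[OF \<mu>_antimono[of m k], of "sqstep k / \<mu> k"] \<mu>_pos[of k] by simp

lemma summable_sqstep: "summable (\<lambda>k. sqstep (k + N))"
proof (rule summable_comparison_test')
  show "summable (\<lambda>k. \<mu> N * (sqstep (k + N) / \<mu> (k + N)))"
    by (intro summable_mult summable_sqstep_over_\<mu>)
  show "norm (sqstep (k + N)) \<le> \<mu> N * (sqstep (k + N) / \<mu> (k + N))" for k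
    using sqstep_le[of N "k + N"] by simp
qed

text \<open>Dividing the three-point inequality by the varying constant \<open>l k\<close> makes the squared distances
  telescope without weights.\<close>

lemma fejer:
  assumes k: "N \<le> k" and z: "z \<in> C"
  shows "2 * \<mu> k / l k * (M k (x (Suc k)) + a4 * \<mu> k - F z)
    \<le> (norm (z - x k))\<^sup>2 - (norm (z - x (Suc k)))\<^sup>2 + A / Llo * sqstep k
      + 2 * (b + a4) / Llo * (\<mu> k)\<^sup>2"
proof -
  have \<mu>: "\<mu> k > 0" by (rule \<mu>_pos)
  have l: "l k > 0" "Llo \<le> l k" using l_bounds[OF k] signs by auto
  have "M k (x (Suc k)) + a4 * \<mu> k - F z \<le>
      l k / (2 * \<mu> k) * ((norm (z - x k))\<^sup>2 - (norm (z - x (Suc k)))\<^sup>2) + A / (2 * \<mu> k) * sqstep k + (b + a4) * \<mu> k"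
    using three_point[OF k z] M_le_F[of k z] by (simp add: M_def algebra_simps)
  then have "2 * \<mu> k / l k * (M k (x (Suc k)) + a4 * \<mu> k - F z) \<le> 2 * \<mu> k / l k *
      (l k / (2 * \<mu> k) * ((norm (z - x k))\<^sup>2 - (norm (z - x (Suc k)))\<^sup>2) + A / (2 * \<mu> k) * sqstep k + (b + a4) * \<mu> k)"
    using \<mu> l by (intro mult_left_mono) auto
  also have "\<dots> = (norm (z - x k))\<^sup>2 - (norm (z - x (Suc k)))\<^sup>2 + A / l k * sqstep k
      + 2 * (b + a4) / l k * (\<mu> k)\<^sup>2"
    using \<mu> l by (simp add: field_simps power2_eq_square)
  also have "A / l k * sqstep k \<le> A / Llo * sqstep k"
    using l signs by (intro mult_right_mono divide_left_mono) auto
  also have "2 * (b + a4) / l k * (\<mu> k)\<^sup>2 \<le> 2 * (b + a4) / Llo * (\<mu> k)\<^sup>2"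
    using l signs by (intro mult_right_mono divide_left_mono) auto
  finally show ?thesis by simp
qed

text \<open>If the limit of \<open>V\<close> exceeded \<open>F z\<close>, every late step would bring the iterates closer to \<open>z\<close> by a
  multiple of \<open>\<mu> k\<close>, up to a summable error, although \<open>\<mu>\<close> is not summable.\<close>

lemma limit_merit_le:
  assumes V: "V \<longlonglongrightarrow> Vinf" "\<And>k. N \<le> k \<Longrightarrow> Vinf \<le> V k" and z: "z \<in> C"
  shows "Vinf \<le> F z"
proof (rule ccontr)
  assume gt: "\<not> ?thesis"
  define \<delta> where "\<delta> = Vinf - F z"
  have \<delta>: "\<delta> > 0" using gt by (simp add: \<delta>_def)
  have "(\<lambda>k. 2 * (b + a4) / Llo * \<mu> k) \<longlonglongrightarrow> 2 * (b + a4) / Llo * 0"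
    by (intro tendsto_intros \<mu>_lim)
  then have "\<forall>\<^sub>F k in sequentially. 2 * (b + a4) / Llo * \<mu> k < \<delta> / M\<^sub>L"
    using \<delta> M\<^sub>L_pos by (intro order_tendstoD(2)) auto
  then obtain m0 where m0: "\<And>k. m0 \<le> k \<Longrightarrow> 2 * (b + a4) / Llo * \<mu> k < \<delta> / M\<^sub>L"
    by (auto simp: eventually_sequentially)
  define m where "m = max m0 N"
  let ?T = "\<lambda>k. (norm (z - x k))\<^sup>2"
  \<comment> \<open>Beyond \<open>m\<close> the error term in \<open>(\<mu> k)\<^sup>2\<close> takes at most half of the gain \<open>2 * \<mu> k * \<delta> / M\<^sub>L\<close>.\<close>
  have step: "\<mu> k * (\<delta> / M\<^sub>L) \<le> ?T k - ?T (Suc k) + A / Llo * sqstep k" if k: "m \<le> k" for k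
  proof -
    have kN: "N \<le> k" "m0 \<le> k" using k by (auto simp: m_def)
    have \<mu>: "\<mu> k > 0" by (rule \<mu>_pos)
    have l: "l k > 0" "l k \<le> M\<^sub>L" using l_bounds[OF kN(1)] signs by auto
    have "\<delta> \<le> M k (x (Suc k)) + a4 * \<mu> k - F z"
      using V(2)[of "Suc k"] V_Suc_le[of k] kN by (simp add: \<delta>_def)
    then have "2 * \<mu> k / M\<^sub>L * \<delta> \<le> 2 * \<mu> k / l k * (M k (x (Suc k)) + a4 * \<mu> k - F z)"
      using \<mu> l \<delta> M\<^sub>L_pos by (intro mult_mono divide_left_mono) auto
    moreover have "2 * \<mu> k / M\<^sub>L * \<delta> = 2 * (\<mu> k * (\<delta> / M\<^sub>L))" by simp
    moreover have "2 * (b + a4) / Llo * (\<mu> k)\<^sup>2 \<le> \<mu> k * (\<delta> / M\<^sub>L)"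
      using mult_left_mono[OF less_imp_le[OF m0[OF kN(2)]], of "\<mu> k"] \<mu> by (simp add: power2_eq_square mult_ac)
    ultimately show ?thesis using fejer[OF kN(1) z] by linarith
  qed
  have sm: "summable (\<lambda>k. sqstep (k + m))"
    using summable_sqstep summable_iff_shift[of sqstep m] summable_iff_shift[of sqstep N] by simp
  have tele: "(\<Sum>i<n. \<mu> (i + m) * (\<delta> / M\<^sub>L)) + ?T (n + m) \<le> ?T m + A / Llo * (\<Sum>i<n. sqstep (i + m))" for n
  proof (induction n)
    case (Suc n)
    then show ?case using step[of "n + m"] by (simp add: algebra_simps)
  qed simp
  have tail: "A / Llo * (\<Sum>i<n. sqstep (i + m)) \<le> A / Llo * (\<Sum>i. sqstep (i + m))" for n
    using signs by (intro mult_left_mono sum_le_suminf sm) auto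
  have bound: "(\<Sum>i<n. \<mu> (i + m) * (\<delta> / M\<^sub>L)) \<le> ?T m + A / Llo * (\<Sum>i. sqstep (i + m))" for n
    using tele[of n] tail[of n] zero_le_power2[of "norm (z - x (n + m))"] by linarith
  have "summable (\<lambda>i. \<mu> (i + m) * (\<delta> / M\<^sub>L))"
    by (rule summableI_nonneg_bounded[OF _ bound])
      (use \<mu>_pos \<delta> M\<^sub>L_pos in \<open>auto intro!: mult_nonneg_nonneg less_imp_le\<close>)
  from summable_mult2[OF this, of "M\<^sub>L / \<delta>"] have "summable (\<lambda>i. \<mu> (i + m))"
    using \<delta> M\<^sub>L_pos by simp
  then show False using \<mu>_div summable_iff_shift[of \<mu> m] by simp
qed

text \<open>Long steps at all late iterations would make \<open>\<mu>\<close> summable.\<close>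

lemma infinitely_many_short_steps:
  "infinite {k. N \<le> k \<and> norm (x (Suc k) - x k) \<le> c2 * \<mu> k * \<gamma>}"
proof
  assume "finite {k. N \<le> k \<and> norm (x (Suc k) - x k) \<le> c2 * \<mu> k * \<gamma>}"
  then obtain m0 where "\<And>k. N \<le> k \<Longrightarrow> norm (x (Suc k) - x k) \<le> c2 * \<mu> k * \<gamma> \<Longrightarrow> k \<le> m0"
    unfolding finite_nat_set_iff_bounded_le by auto
  then have long: "c2 * \<mu> k * \<gamma> < norm (x (Suc k) - x k)" if "N \<le> k" "m0 < k" for k
    using that by (metis not_le)
  have "summable (\<lambda>k. (c2 * \<gamma>)\<^sup>2 * \<mu> (k + N))"
  proof (rule summable_comparison_test'[OF summable_sqstep_over_\<mu>, of "Suc m0"])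
    fix n assume n: "n \<ge> Suc m0"
    let ?k = "n + N"
    have "(c2 * \<mu> ?k * \<gamma>)\<^sup>2 \<le> sqstep ?k"
      using long[of ?k] n signs \<mu>_pos[of ?k] by (intro power_mono) (auto intro!: mult_nonneg_nonneg less_imp_le)
    then have "(c2 * \<gamma>)\<^sup>2 * \<mu> ?k \<le> sqstep ?k / \<mu> ?k"
      using \<mu>_pos[of ?k] by (simp add: pos_le_divide_eq power2_eq_square mult_ac)
    then show "norm ((c2 * \<gamma>)\<^sup>2 * \<mu> ?k) \<le> sqstep ?k / \<mu> ?k"
      using \<mu>_pos[of ?k] by (simp add: abs_mult)
  qed
  then have "summable (\<lambda>k. \<mu> (k + N))" using signs by (simp add: summable_cmult_iff)
  then show False using \<mu>_div summable_iff_shift[of \<mu> N] by simp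
qed

text \<open>Exactness of the penalty: a cluster point of the iterates that follow short steps is feasible,
  and its value of \<open>F\<close> is at most the limit of \<open>V\<close>.\<close>

lemma exact_penalty:
  obtains xs q where "xs \<in> C" "gp xs = 0" "\<And>z. z \<in> C \<Longrightarrow> F xs \<le> F z"
    "strict_mono q" "(x \<circ> q) \<longlonglongrightarrow> xs"
proof -
  obtain Vinf where V: "V \<longlonglongrightarrow> Vinf" "\<And>k. N \<le> k \<Longrightarrow> Vinf \<le> V k" using V_convergent by blast
  obtain s :: "nat \<Rightarrow> nat" where s: "strict_mono s"
    and "\<forall>n. s n \<in> {k. N \<le> k \<and> norm (x (Suc k) - x k) \<le> c2 * \<mu> k * \<gamma>}"
    using infinite_enumerate[OF infinitely_many_short_steps] by blast
  then have short: "N \<le> s n" "norm (x (Suc (s n)) - x (s n)) \<le> c2 * \<mu> (s n) * \<gamma>" for n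
    by auto
  have "\<forall>n. x (Suc (s n)) \<in> C" using x_mem by blast
  then obtain xs u where xs: "xs \<in> C" and u: "strict_mono u" and lim: "((\<lambda>n. x (Suc (s n))) \<circ> u) \<longlonglongrightarrow> xs"
    using compact_C unfolding compact_def by meson
  define q where "q = s \<circ> u"
  have q: "strict_mono q" unfolding q_def using s u by (rule strict_mono_o)
  have lim: "(\<lambda>n. x (Suc (q n))) \<longlonglongrightarrow> xs" using lim by (simp add: q_def o_def)
  have at_q: "f \<longlonglongrightarrow> a \<Longrightarrow> (\<lambda>n. f (q n)) \<longlonglongrightarrow> a" for f :: "nat \<Rightarrow> real" and a
    using LIMSEQ_subseq_LIMSEQ[OF _ q] by (simp add: o_def)
  have qN: "N \<le> q n" and qs: "norm (x (Suc (q n)) - x (q n)) \<le> c2 * \<mu> (q n) * \<gamma>" for n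
    using short by (auto simp: q_def)
  have "gp xs \<le> r * 0"
  proof (rule LIMSEQ_le)
    show "(\<lambda>n. gp (x (Suc (q n)))) \<longlonglongrightarrow> gp xs"
      using continuous_on_tendsto_compose[OF cont_gp lim xs] x_mem by simp
    show "(\<lambda>n. r * \<mu> (q n)) \<longlonglongrightarrow> r * 0" by (intro tendsto_intros at_q \<mu>_lim)
    show "\<exists>n0. \<forall>n\<ge>n0. gp (x (Suc (q n))) \<le> r * \<mu> (q n)" using short_step[OF qN qs] by blast
  qed
  then have gp0: "gp xs = 0" using gp_nonneg[of xs] by simp
  have "F xs \<le> Vinf"
  proof (rule LIMSEQ_le)
    show "(\<lambda>n. F (x (Suc (q n)))) \<longlonglongrightarrow> F xs"
      using continuous_on_tendsto_compose[OF cont_F lim xs] x_mem by simp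
    show "(\<lambda>n. V (q n)) \<longlonglongrightarrow> Vinf" by (intro at_q V)
    have "F (x (Suc k)) \<le> V k" if "N \<le> k" for k
    proof -
      have "0 \<le> c1 / 2 * (sqstep k / \<mu> k)" using signs \<mu>_pos[of k] by simp
      then show ?thesis using V_decrease[OF that] F_le_M[of "x (Suc k)" k] by simp
    qed
    then show "\<exists>n0. \<forall>n\<ge>n0. F (x (Suc (q n))) \<le> V (q n)" using qN by blast
  qed
  then have "F xs \<le> F z" if "z \<in> C" for z using limit_merit_le[OF V that] by simp
  moreover have "strict_mono (Suc \<circ> q)" using q by (simp add: strict_mono_def)
  ultimately show thesis using that[of xs "Suc \<circ> q"] xs gp0 lim by (simp add: o_def)
qed

text \<open>Add the quasi-Fejer inequality at a minimiser of \<open>F\<close>, multiplied by \<open>M\<^sub>L\<close>, and twice the bound of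
  \<open>sqstep k / \<mu> k\<close> by the decrease of \<open>V\<close>. Both right-hand sides telescope, and the left-hand side is a
  sum with weights \<open>\<mu> k\<close>, so that some term is at most the weighted mean. At a minimiser the merit gap is
  nonnegative, which allows the division by \<open>l k\<close> to be undone with \<open>M\<^sub>L\<close>.\<close>

lemma weighted_average:
  assumes m: "N \<le> m" "m \<le> K" and xs: "xs \<in> C" "\<And>z. z \<in> C \<Longrightarrow> F xs \<le> F z"
    and diam: "\<And>y z. y \<in> C \<Longrightarrow> z \<in> C \<Longrightarrow> norm (y - z) \<le> d"
    and W: "V m - F xs \<le> W"
  obtains k where "k \<in> {m..K}"
    "2 * (M k (x (Suc k)) + a4 * \<mu> k - F xs) + 2 * (sqstep k / (\<mu> k)\<^sup>2)
      \<le> (M\<^sub>L * d\<^sup>2 + 2 * ((2 * Llo + \<mu> m * A * M\<^sub>L) / (c1 * Llo)) * W) / (\<Sum>k=m..K. \<mu> k)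
        + 2 * ((b + a4) * M\<^sub>L / Llo) * \<mu> m"
proof -
  let ?T = "\<lambda>k. (norm (xs - x k))\<^sup>2" and ?S = "\<Sum>k=m..K. \<mu> k"
  let ?t = "\<lambda>k. 2 * (M k (x (Suc k)) + a4 * \<mu> k - F xs) + 2 * (sqstep k / (\<mu> k)\<^sup>2)"
  let ?B = "A * M\<^sub>L * \<mu> m / Llo + 2" and ?D = "2 * ((b + a4) * M\<^sub>L / Llo) * \<mu> m"
  let ?R = "M\<^sub>L * d\<^sup>2 + 2 * ((2 * Llo + \<mu> m * A * M\<^sub>L) / (c1 * Llo)) * W"
  have B: "?B \<ge> 0" using signs M\<^sub>L_pos \<mu>_pos[of m] by simp
  have summand: "\<mu> k * ?t k \<le> M\<^sub>L * (?T k - ?T (Suc k)) + ?B * (2 / c1) * (V k - V (Suc k)) + ?D * \<mu> k"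
    if k: "k \<in> {m..K}" for k
  proof -
    have kN: "N \<le> k" "m \<le> k" using k m by auto
    have \<mu>: "\<mu> k > 0" by (rule \<mu>_pos)
    have l: "l k > 0" "l k \<le> M\<^sub>L" using l_bounds[OF kN(1)] signs by auto
    let ?d = "M k (x (Suc k)) + a4 * \<mu> k - F xs"
    have d: "?d \<ge> 0" using xs(2)[OF x_mem[of "Suc k"]] F_le_M[of "x (Suc k)" k] by simp
    have "2 * \<mu> k / M\<^sub>L * ?d \<le> 2 * \<mu> k / l k * ?d"
      using \<mu> l d M\<^sub>L_pos by (intro mult_right_mono divide_left_mono) auto
    then have "2 * \<mu> k / M\<^sub>L * ?d \<le> ?T k - ?T (Suc k) + A / Llo * sqstep k + 2 * (b + a4) / Llo * (\<mu> k)\<^sup>2"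
      using fejer[OF kN(1) xs(1)] by simp
    then have "M\<^sub>L * (2 * \<mu> k / M\<^sub>L * ?d)
        \<le> M\<^sub>L * (?T k - ?T (Suc k) + A / Llo * sqstep k + 2 * (b + a4) / Llo * (\<mu> k)\<^sup>2)"
      using M\<^sub>L_pos by (intro mult_left_mono) auto
    then have "2 * \<mu> k * ?d \<le> M\<^sub>L * (?T k - ?T (Suc k)) + A * M\<^sub>L / Llo * sqstep k
        + 2 * ((b + a4) * M\<^sub>L / Llo) * (\<mu> k)\<^sup>2"
      using M\<^sub>L_pos by (simp add: algebra_simps)
    also have "A * M\<^sub>L / Llo * sqstep k \<le> A * M\<^sub>L / Llo * (\<mu> m * (sqstep k / \<mu> k))"
      using sqstep_le[OF kN(2)] signs M\<^sub>L_pos by (intro mult_left_mono) auto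
    also have "2 * ((b + a4) * M\<^sub>L / Llo) * (\<mu> k)\<^sup>2 \<le> 2 * ((b + a4) * M\<^sub>L / Llo) * (\<mu> m * \<mu> k)"
      using \<mu>_antimono[OF kN(2)] \<mu> signs M\<^sub>L_pos
      by (intro mult_left_mono) (auto simp: power2_eq_square)
    also have "A * M\<^sub>L / Llo * (\<mu> m * (sqstep k / \<mu> k)) = (?B - 2) * (sqstep k / \<mu> k)" by simp
    also have "2 * ((b + a4) * M\<^sub>L / Llo) * (\<mu> m * \<mu> k) = ?D * \<mu> k" by simp
    finally have "2 * \<mu> k * ?d + 2 * (sqstep k / \<mu> k)
        \<le> M\<^sub>L * (?T k - ?T (Suc k)) + ?B * (sqstep k / \<mu> k) + ?D * \<mu> k"
      unfolding left_diff_distrib by linarith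
    also have "?B * (sqstep k / \<mu> k) \<le> ?B * (2 / c1 * (V k - V (Suc k)))"
      by (intro mult_left_mono sqstep_le_V_diff kN B)
    also have "2 * \<mu> k * ?d + 2 * (sqstep k / \<mu> k) = \<mu> k * ?t k"
      using \<mu> by (simp add: distrib_left power2_eq_square)
    finally show ?thesis by (simp only: mult.assoc)
  qed
  have tele: "(\<Sum>k=m..K. f k - f (Suc k)) = f m - f (Suc K)" for f :: "nat \<Rightarrow> real"
    using sum_Suc_diff[of m K "\<lambda>k. - f k"] m by simp
  have "(\<Sum>k=m..K. \<mu> k * ?t k)
      \<le> (\<Sum>k=m..K. M\<^sub>L * (?T k - ?T (Suc k)) + ?B * (2 / c1) * (V k - V (Suc k)) + ?D * \<mu> k)"
    using summand by (rule sum_mono)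
  also have "\<dots> = M\<^sub>L * (?T m - ?T (Suc K)) + ?B * (2 / c1) * (V m - V (Suc K)) + ?D * ?S"
    by (simp only: sum.distrib sum_distrib_left[symmetric] tele[of ?T] tele[of V])
  also have "M\<^sub>L * (?T m - ?T (Suc K)) \<le> M\<^sub>L * d\<^sup>2"
  proof (intro mult_left_mono)
    have "?T m \<le> d\<^sup>2" using diam[OF xs(1) x_mem] by (intro power_mono) auto
    then show "?T m - ?T (Suc K) \<le> d\<^sup>2" by (smt (verit) zero_le_power2)
  qed (use M\<^sub>L_pos in simp)
  also have "?B * (2 / c1) * (V m - V (Suc K)) \<le> ?B * (2 / c1) * W"
  proof (intro mult_left_mono)
    show "V m - V (Suc K) \<le> W"
      using W xs(2)[OF x_mem[of "Suc K"]] F_le_M[of "x (Suc K)" "Suc K"] by (simp add: V_def)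
  qed (rule mult_nonneg_nonneg[OF B], use signs in simp)
  also have "M\<^sub>L * d\<^sup>2 + ?B * (2 / c1) * W + ?D * ?S = ?R + ?D * ?S"
    using signs by (simp add: field_simps)
  finally have sum_le: "(\<Sum>k=m..K. \<mu> k * ?t k) \<le> ?R + ?D * ?S" by simp
  have S: "?S > 0" using \<mu>_pos m by (intro sum_pos) auto
  have "\<exists>k\<in>{m..K}. ?t k \<le> ?R / ?S + ?D"
  proof (rule ccontr)
    assume "\<not> ?thesis"
    then have "?R / ?S + ?D < ?t k" if "k \<in> {m..K}" for k
      using that by (meson not_le)
    then have "\<mu> k * (?R / ?S + ?D) < \<mu> k * ?t k" if "k \<in> {m..K}" for k
      using that \<mu>_pos[of k] by (intro mult_strict_left_mono)
    then have "(\<Sum>k=m..K. \<mu> k * (?R / ?S + ?D)) < (\<Sum>k=m..K. \<mu> k * ?t k)"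
      using m by (intro sum_strict_mono) auto
    moreover have "(\<Sum>k=m..K. \<mu> k * (?R / ?S + ?D)) = ?S * (?R / ?S + ?D)"
      by (rule sum_distrib_right[symmetric])
    moreover have "?S * (?R / ?S + ?D) = ?R + ?D * ?S"
      unfolding distrib_left using S by simp
    ultimately show False using sum_le by simp
  qed
  then show thesis using that by blast
qed

text \<open>With square summable \<open>\<mu>\<close> the errors in the quasi-Fejer inequality are summable, so the distance to
  a minimiser of \<open>F\<close> that is a cluster point tends to zero along the whole sequence.\<close>

lemma converges_to_cluster_minimiser:
  assumes sm: "summable (\<lambda>k. (\<mu> k)\<^sup>2)" and xs: "xs \<in> C" "\<And>z. z \<in> C \<Longrightarrow> F xs \<le> F z"
    and q: "strict_mono q" "(x \<circ> q) \<longlonglongrightarrow> xs"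
  shows "x \<longlonglongrightarrow> xs"
proof -
  define T where "T k = (norm (xs - x k))\<^sup>2" for k
  define e where "e k = A / Llo * sqstep k + 2 * (b + a4) / Llo * (\<mu> k)\<^sup>2" for k
  have e0: "e k \<ge> 0" for k using signs by (simp add: e_def)
  have step: "T (Suc k) \<le> T k + e k" if k: "N \<le> k" for k
  proof -
    have "0 \<le> M k (x (Suc k)) + a4 * \<mu> k - F xs"
      using xs(2)[OF x_mem[of "Suc k"]] F_le_M[of "x (Suc k)" k] by simp
    then have "0 \<le> 2 * \<mu> k / l k * (M k (x (Suc k)) + a4 * \<mu> k - F xs)"
      using \<mu>_pos[of k] l_bounds(1)[OF k] signs by (intro mult_nonneg_nonneg divide_nonneg_nonneg) auto
    then show ?thesis using fejer[OF k xs(1)] by (simp add: T_def e_def)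
  qed
  have "summable sqstep" using summable_sqstep summable_iff_shift[of sqstep N] by simp
  then have sme: "summable e" unfolding e_def by (intro summable_add summable_mult sm)
  have "(\<lambda>n. (norm (xs - (x \<circ> q) n))\<^sup>2) \<longlonglongrightarrow> (norm (xs - xs))\<^sup>2"
    by (intro tendsto_intros q)
  then have Tq: "(\<lambda>n. T (q n)) \<longlonglongrightarrow> 0" by (simp add: T_def)
  have "T \<longlonglongrightarrow> 0"
  proof (rule LIMSEQ_I)
    fix \<epsilon> :: real assume \<epsilon>: "\<epsilon> > 0"
    obtain n1 where n1: "\<And>n. n1 \<le> n \<Longrightarrow> norm (\<Sum>i. e (i + n)) < \<epsilon> / 2"
      using suminf_exist_split[of "\<epsilon> / 2", OF _ sme] \<epsilon> by auto
    obtain n2 where n2: "\<And>n. n2 \<le> n \<Longrightarrow> T (q n) < \<epsilon> / 2"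
      using order_tendstoD(2)[OF Tq, of "\<epsilon> / 2"] \<epsilon> by (auto simp: eventually_sequentially)
    define n0 where "n0 = q (max n2 (max n1 N))"
    have n0: "n1 \<le> n0" "N \<le> n0" "T n0 < \<epsilon> / 2"
      using strict_mono_imp_increasing[OF q(1), of "max n2 (max n1 N)"] n2 by (auto simp: n0_def)
    have partial: "T (j + n0) \<le> T n0 + (\<Sum>i<j. e (i + n0))" for j
    proof (induction j)
      case (Suc j)
      then show ?case using step[of "j + n0"] n0 by simp
    qed simp
    have tail: "(\<Sum>i<j. e (i + n0)) \<le> (\<Sum>i. e (i + n0))" for j
      using sme e0 by (intro sum_le_suminf) (auto simp: summable_iff_shift)
    have "(\<Sum>i. e (i + n0)) < \<epsilon> / 2" using n1[OF n0(1)] by simp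
    then have "T (j + n0) < \<epsilon>" for j
      using partial[of j] tail[of j] n0(3) by linarith
    then have "norm (T k - 0) < \<epsilon>" if "n0 \<le> k" for k
      using that by (metis le_add_diff_inverse2 T_def diff_zero real_norm_def abs_of_nonneg zero_le_power2)
    then show "\<exists>no. \<forall>k\<ge>no. norm (T k - 0) < \<epsilon>" by blast
  qed
  then have "(\<lambda>k. sqrt (T k)) \<longlonglongrightarrow> sqrt 0" by (rule tendsto_real_sqrt)
  then have "(\<lambda>k. norm (x k - xs)) \<longlonglongrightarrow> 0" by (simp add: T_def norm_minus_commute)
  then show ?thesis by (simp only: tendsto_norm_zero_iff LIM_zero_iff)
qed

end

section \<open>The penalty parameter stabilises\<close>

text \<open>\<open>Mf\<close> and \<open>MP\<close> bound the gradients of \<open>f\<close> and the subgradients of \<open>P1\<close> on \<open>C\<close>; \<open>gap\<close> is the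
  quantitative constraint qualification, elementwise; from \<open>k0\<close> on the smoothing error of \<open>h\<close> is at
  most \<open>\<eta>1\<close>.\<close>

locale sESQM_iteration = penalised_problem +
  fixes Llo Lup c1 c2 M\<gamma> Mf MP \<eta>1 :: real
    and \<gamma>hat \<mu> :: "nat \<Rightarrow> real" and x :: "nat \<Rightarrow> 'a" and t :: "nat \<Rightarrow> nat" and k0 :: nat
  assumes pos: "0 < Llo" "0 < c1" "0 < c2" "0 < M\<gamma>" "0 < \<eta>1"
    and run: "sESQM_run f P1 (\<lambda>_. 0) C obj_ext (\<lambda>\<nu> z. hs \<nu> (c z)) gs (ap31 + ap32) Llo Lup c1 c2 \<gamma>hat \<mu> x t"
    and \<gamma>hat: "\<And>k. 0 < \<gamma>hat (Suc k)" "\<And>k. \<gamma>hat (Suc k) < \<gamma>hat k" "\<And>k. \<gamma>hat k \<le> M\<gamma> * \<gamma>hat (Suc k)"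
    and \<gamma>hat_lim: "\<gamma>hat \<longlonglongrightarrow> 0"
    and Mf: "\<And>z. z \<in> C \<Longrightarrow> norm (gradient f z) \<le> Mf"
    and MP: "\<And>z \<xi>. z \<in> C \<Longrightarrow> \<xi> \<in> subdifferential (\<lambda>z. ereal (P1 z)) z \<Longrightarrow> norm \<xi> \<le> MP"
    and gap: "\<And>z u n. z \<in> C \<Longrightarrow> - \<eta>1 \<le> g z \<Longrightarrow>
      u \<in> eps_subdifferential \<eta>1 (\<lambda>y. ereal (h y)) (c z) \<Longrightarrow> n \<in> normal_cone C z \<Longrightarrow>
      \<eta>1 \<le> norm (adjoint (Dc z) u + n)"
    and k0: "\<mu> k0 \<le> \<eta>1 / max (ah31 + ah32) (max ah32 0)"
begin

text \<open>Upper bound for the accepted proximal constants.\<close>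

definition M_L :: real where
  "M_L = max Lup (c1 + \<gamma>hat 0 * \<mu> 0 * L\<^sub>f + \<mu> 0 * L_g (\<mu> 0))"

text \<open>Bound for \<open>\<mu>\<close> times the curvature of the merit function in excess of the proximal constant.\<close>

definition A1 :: real where
  "A1 = max (\<mu> 0 * \<gamma>hat 0 * L\<^sub>f + \<mu> 0 * L_g (\<mu> 0) - Llo) 0"

text \<open>Lower bound for the penalty parameter along the whole run.\<close>

definition \<eta>\<gamma> :: real where
  "\<eta>\<gamma> = min (\<eta>1 / (2 * M\<gamma> * (Mf + MP + c2 * (M_L + \<mu> 0 * L_g (\<mu> 0))))) (\<gamma>hat (k0 + 1))"

lemma x0_mem: "x 0 \<in> C" and t_0: "t 0 = 0"
  using run by (simp_all add: sESQM_run_def)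

lemma run_step: "sESQM_step f P1 (\<lambda>_. 0) C obj_ext (gs (\<mu> k)) (\<gamma>hat (t k)) (\<mu> k) Llo Lup c1 (x k) (x (Suc k))"
  using run by (simp add: sESQM_run_def)

lemma t_Suc: "t (Suc k) = (if hs (\<mu> k) (c (x (Suc k))) > 2 * (ap31 + ap32) * \<mu> k \<and>
    norm (x (Suc k) - x k) \<le> c2 * \<mu> k * \<gamma>hat (t k) then t k + 1 else t k)"
  using run by (simp add: sESQM_run_def)

lemma \<mu>_pos: "0 < \<mu> k"
  using run by (cases k) (simp_all add: sESQM_run_def)

lemma \<mu>_decseq: "decseq \<mu>"
  using run by (intro decseq_SucI) (simp add: sESQM_run_def)

lemma \<mu>_antimono: "m \<le> k \<Longrightarrow> \<mu> k \<le> \<mu> m"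
  using \<mu>_decseq by (simp add: decseq_def)

lemma \<gamma>hat_pos: "0 < \<gamma>hat k"
  using \<gamma>hat(1)[of k] \<gamma>hat(2)[of k] by linarith

lemma \<gamma>hat_antimono: "m \<le> k \<Longrightarrow> \<gamma>hat k \<le> \<gamma>hat m"
  by (rule lift_Suc_antimono_le[of \<gamma>hat]) (rule less_imp_le[OF \<gamma>hat(2)])

lemma L\<^sub>f_nonneg: "0 \<le> L\<^sub>f"
  using smooth_f by (simp add: smooth_const_on_def lipschitz_on_def)

lemma curvature_le: "\<mu> k * (\<gamma>hat (t k) * L\<^sub>f + L_g (\<mu> k)) \<le> \<gamma>hat 0 * \<mu> 0 * L\<^sub>f + \<mu> 0 * L_g (\<mu> 0)"
proof -
  have "\<mu> k * \<gamma>hat (t k) \<le> \<mu> 0 * \<gamma>hat 0"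
    using \<mu>_antimono \<gamma>hat_antimono \<gamma>hat_pos[of "t k"] \<mu>_pos[of 0] by (intro mult_mono) simp_all
  then have "\<mu> k * \<gamma>hat (t k) * L\<^sub>f \<le> \<mu> 0 * \<gamma>hat 0 * L\<^sub>f" using L\<^sub>f_nonneg by (rule mult_right_mono)
  moreover have "\<mu> k * L_g (\<mu> k) \<le> \<mu> 0 * L_g (\<mu> 0)" by (intro scaled_L_g_mono \<mu>_pos \<mu>_antimono) simp
  ultimately show ?thesis by (simp add: algebra_simps)
qed

lemma x_mem: "x k \<in> C"
proof (induction k)
  case (Suc k)
  then show ?case
    using accepted_constant[OF run_step Suc less_imp_le[OF \<gamma>hat_pos] \<mu>_pos pos(1)] by blast
qed (rule x0_mem)

definition accepts :: "nat \<Rightarrow> real \<Rightarrow> bool" where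
  "accepts k l \<longleftrightarrow> Llo \<le> l \<and> l \<le> M_L \<and> is_arg_min (model (\<gamma>hat (t k)) (\<mu> k) (x k) l) (\<lambda>_. True) (x (Suc k))
     \<and> merit (\<gamma>hat (t k)) (\<mu> k) (x (Suc k)) \<le> merit (\<gamma>hat (t k)) (\<mu> k) (x k) - c1 / (2 * \<mu> k) * (norm (x (Suc k) - x k))\<^sup>2"

lemma accepts_exists: "\<exists>l. accepts k l"
proof -
  obtain l where l: "Llo \<le> l" "l \<le> max Lup (c1 + \<mu> k * (\<gamma>hat (t k) * L\<^sub>f + L_g (\<mu> k)))"
    "is_arg_min (model (\<gamma>hat (t k)) (\<mu> k) (x k) l) (\<lambda>_. True) (x (Suc k))"
    "merit (\<gamma>hat (t k)) (\<mu> k) (x (Suc k)) \<le> merit (\<gamma>hat (t k)) (\<mu> k) (x k) - c1 / (2 * \<mu> k) * (norm (x (Suc k) - x k))\<^sup>2"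
    using accepted_constant[OF run_step x_mem less_imp_le[OF \<gamma>hat_pos] \<mu>_pos pos(1), of k] by blast
  then have "l \<le> M_L" using curvature_le[of k] by (simp add: M_L_def)
  then show ?thesis using l by (auto simp: accepts_def)
qed

lemma penalty_denominator_pos: "0 < Mf + MP + c2 * (M_L + \<mu> 0 * L_g (\<mu> 0))"
proof -
  have Mf0: "0 \<le> Mf" by (rule order_trans[OF norm_ge_zero Mf[OF x0_mem]])
  obtain \<xi> where \<xi>: "\<xi> \<in> subdifferential (\<lambda>z. ereal (P1 z)) (x 0)"
    using convex_subgradient_exists[OF convex_P1] by blast
  have MP0: "0 \<le> MP" by (rule order_trans[OF norm_ge_zero MP[OF x0_mem \<xi>]])
  have "0 < M_L" using accepts_exists[of 0] pos by (auto simp: accepts_def)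
  moreover have "0 \<le> \<mu> 0 * L_g (\<mu> 0)" using L_g_nonneg[OF \<mu>_pos] \<mu>_pos[of 0] by simp
  ultimately have "0 < c2 * (M_L + \<mu> 0 * L_g (\<mu> 0))" using pos by (intro mult_pos_pos add_pos_nonneg)
  then show ?thesis using Mf0 MP0 by linarith
qed

lemma \<eta>\<gamma>_pos: "0 < \<eta>\<gamma>"
  using penalty_denominator_pos pos \<gamma>hat_pos by (simp add: \<eta>\<gamma>_def)

lemma t_le: "t k \<le> k"
  by (induction k) (auto simp: t_0 t_Suc)

text \<open>An increase of \<open>t\<close> happens where the smoothed constraint is positive. The smoothing error is at most
  \<open>\<eta>1\<close> by now, so the true constraint is at least \<open>- \<eta>1\<close> there and the gradient of the smoothing is an
  \<open>\<eta>1\<close>-subgradient of \<open>h\<close>; the constraint qualification applies.\<close>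

lemma increment_bound:
  assumes k: "k0 \<le> k" and inc: "t (Suc k) \<noteq> t k"
  shows "\<eta>1 / 2 < \<gamma>hat (t k) * (Mf + MP + c2 * (M_L + \<mu> 0 * L_g (\<mu> 0)))"
proof -
  let ?y = "x (Suc k)" and ?u = "gradient (hs (\<mu> k)) (c (x (Suc k)))"
  have active: "2 * (ap31 + ap32) * \<mu> k < hs (\<mu> k) (c ?y)"
    and short: "norm (?y - x k) \<le> c2 * \<mu> k * \<gamma>hat (t k)"
    using inc t_Suc[of k] by (auto split: if_splits)
  have "\<mu> k \<le> \<eta>1 / max (ah31 + ah32) (max ah32 0)" by (rule order_trans[OF \<mu>_antimono[OF k] k0])
  then have small: "max (ah31 + ah32) (max ah32 0) * \<mu> k \<le> \<eta>1"
    using const_signs(3) by (simp add: pos_le_divide_eq mult.commute less_max_iff_disj)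
  have "(ah31 + ah32) * \<mu> k \<le> max (ah31 + ah32) (max ah32 0) * \<mu> k"
    "ah32 * \<mu> k \<le> max (ah31 + ah32) (max ah32 0) * \<mu> k"
    using \<mu>_pos[of k] by (auto intro!: mult_right_mono)
  then have s: "(ah31 + ah32) * \<mu> k \<le> \<eta>1" "ah32 * \<mu> k \<le> \<eta>1" using small by auto
  have "0 \<le> 2 * (ap31 + ap32) * \<mu> k" using const_signs(6) \<mu>_pos[of k] by simp
  then have "- \<eta>1 \<le> g ?y" using active hs_upper[OF \<mu>_pos, of k "c ?y"] s(2) by linarith
  moreover have "?u \<in> eps_subdifferential \<eta>1 (\<lambda>y. ereal (h y)) (c ?y)"
    by (rule grad_hs_eps_subgradient[OF \<mu>_pos s(1)])
  ultimately have gap': "\<eta>1 \<le> norm (adjoint (Dc ?y) ?u + n)" if "n \<in> normal_cone C ?y" for n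
    using gap[OF x_mem] that by blast
  obtain l where l: "accepts k l" using accepts_exists by blast
  then have "0 \<le> l" using pos by (auto simp: accepts_def)
  then have "\<eta>1 / 2 < \<gamma>hat (t k) * (Mf + MP + c2 * (l + \<mu> k * L_g (\<mu> k)))"
    using l by (intro penalty_lower_bound[OF _ x_mem \<gamma>hat_pos \<mu>_pos _ short active pos(5) gap' Mf MP])
      (auto simp: accepts_def)
  also have "\<dots> \<le> \<gamma>hat (t k) * (Mf + MP + c2 * (M_L + \<mu> 0 * L_g (\<mu> 0)))"
    using l pos \<gamma>hat_pos[of "t k"] scaled_L_g_mono[OF \<mu>_pos \<mu>_antimono, of 0 k]
    by (intro mult_left_mono add_left_mono add_mono) (auto simp: accepts_def)
  finally show ?thesis .
qed

text \<open>After iteration \<open>k0\<close> each increase of \<open>t\<close> certifies a lower bound for \<open>\<gamma>\<close> before the increase,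
  and one increase reduces \<open>\<gamma>\<close> at most by the factor \<open>M\<gamma>\<close>. Before, \<open>t\<close> has increased at most
  once per iteration.\<close>

lemma penalty_ge: "\<eta>\<gamma> \<le> \<gamma>hat (t k)"
proof (induction k)
  case 0
  show ?case using \<gamma>hat_antimono[of "t 0" "k0 + 1"] by (simp add: \<eta>\<gamma>_def t_0)
next
  case (Suc k)
  show ?case
  proof (cases "t (Suc k) = t k")
    case False
    then have t: "t (Suc k) = Suc (t k)" using t_Suc[of k] by (auto split: if_splits)
    show ?thesis
    proof (cases "k0 \<le> k")
      case True
      define D where "D = Mf + MP + c2 * (M_L + \<mu> 0 * L_g (\<mu> 0))"
      have D: "D > 0" unfolding D_def by (rule penalty_denominator_pos)
      have "\<eta>1 / 2 < \<gamma>hat (t k) * D" unfolding D_def by (rule increment_bound[OF True False])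
      also have "\<dots> \<le> (M\<gamma> * \<gamma>hat (Suc (t k))) * D"
        using \<gamma>hat(3) D by (intro mult_right_mono) auto
      finally have "\<eta>1 / (2 * M\<gamma> * D) \<le> \<gamma>hat (t (Suc k))"
        using D pos by (simp add: t pos_divide_le_eq mult_ac)
      then show ?thesis unfolding \<eta>\<gamma>_def D_def by (rule min.coboundedI1)
    next
      case False
      then have "t (Suc k) \<le> k0 + 1" using t_le[of "Suc k"] by simp
      then show ?thesis using \<gamma>hat_antimono[of "t (Suc k)" "k0 + 1"] by (simp add: \<eta>\<gamma>_def)
    qed
  qed (use Suc in simp)
qed

text \<open>Along \<open>t\<close> the values of \<open>\<gamma>hat\<close> stay above \<open>\<eta>\<gamma>\<close>, although \<open>\<gamma>hat\<close> tends to zero; so \<open>t\<close> is bounded.\<close>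

lemma t_stabilises: "\<exists>N. \<forall>j\<ge>N. t j = t N"
proof -
  obtain m where m: "\<gamma>hat m < \<eta>\<gamma>"
    using order_tendstoD(2)[OF \<gamma>hat_lim \<eta>\<gamma>_pos] by (auto simp: eventually_sequentially)
  have "t k \<le> m" for k
    using penalty_ge[of k] \<gamma>hat_antimono[of m "t k"] m by (meson le_less_trans linear not_le order_trans)
  then obtain N where N: "\<And>k. t k \<le> t N"
    using ex_has_greatest_nat[of "\<lambda>_. True" 0 t "Suc m"] by (auto simp: less_Suc_eq_le)
  have "t N \<le> t j" if "N \<le> j" for j
    by (rule lift_Suc_mono_le[of t, OF _ that]) (simp add: t_Suc)
  then show ?thesis using N by (meson le_antisym)
qed

lemma cont_g: "continuous_on C (\<lambda>z. max (g z) 0)"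
proof -
  have "continuous_on UNIV h" using lip_h by (rule lipschitz_on_continuous_on)
  moreover have "continuous_on C c" using lip_c by (rule lipschitz_on_continuous_on)
  ultimately have "continuous_on C (h \<circ> c)"
    using continuous_on_compose continuous_on_subset by blast
  then show ?thesis by (intro continuous_intros) (simp add: o_def)
qed

lemma cont_obj: "continuous_on C obj"
proof (rule continuous_on_add)
  show "continuous_on C f"
    by (intro continuous_at_imp_continuous_on ballI differentiable_imp_continuous_within diff_f)
qed (rule continuous_on_convex_UNIV[OF convex_P1])

text \<open>A short step that leaves \<open>t\<close> unchanged must have failed the violation test. The first bound goes
  through \<open>h\<close> and serves the final feasibility estimate; the second goes through \<open>gs\<close> and is the one to be
  divided by \<open>\<gamma>\<close> for the lower bound of the objective.\<close>

lemma short_step_feasible: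
  assumes "t (Suc k) = t k" "norm (x (Suc k) - x k) \<le> c2 * \<mu> k * \<gamma>hat (t k)"
  shows "max (g (x (Suc k))) 0 \<le> (2 * (ap31 + ap32) + max ah31 0) * \<mu> k"
    and "max (g (x (Suc k))) 0 \<le> (ah4 + ap4 + 2 * (ap31 + ap32) + max ap32 0) * \<mu> k"
proof -
  let ?y = "x (Suc k)"
  have hs: "hs (\<mu> k) (c ?y) \<le> 2 * (ap31 + ap32) * \<mu> k"
    using assms t_Suc[of k] by (auto split: if_splits)
  have p: "0 \<le> 2 * (ap31 + ap32) * \<mu> k" using const_signs(6) \<mu>_pos[of k] by simp
  have m: "ah31 * \<mu> k \<le> max ah31 0 * \<mu> k" "0 \<le> max ah31 0 * \<mu> k" "ap32 * \<mu> k \<le> max ap32 0 * \<mu> k"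
    using \<mu>_pos[of k] by (auto intro!: mult_right_mono)
  show "max (g ?y) 0 \<le> (2 * (ap31 + ap32) + max ah31 0) * \<mu> k"
    using hs p m hs_lower[OF \<mu>_pos, of "c ?y" k] unfolding distrib_right by linarith
  show "max (g ?y) 0 \<le> (ah4 + ap4 + 2 * (ap31 + ap32) + max ap32 0) * \<mu> k"
    using hs p m gs_lower[OF \<mu>_pos, of ?y k] \<phi>s_upper[OF \<mu>_pos, of k "hs (\<mu> k) (c ?y)"]
    unfolding distrib_right by linarith
qed

text \<open>Any accepted constant will do; a choice turns the line search results into a sequence.\<close>

definition l\<^sub>k :: "nat \<Rightarrow> real" where "l\<^sub>k k = (SOME l. accepts k l)"

lemma accepts_l\<^sub>k: "accepts k (l\<^sub>k k)"
  unfolding l\<^sub>k_def by (rule someI_ex[OF accepts_exists])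

lemma penalised_descent_from:
  assumes "\<mu> \<longlonglongrightarrow> 0" "\<not> summable \<mu>" and N: "\<And>j. N \<le> j \<Longrightarrow> t j = t N"
  shows "penalised_descent C obj (\<lambda>z. max (g z) 0) gs x \<mu> l\<^sub>k (\<gamma>hat (t N))
    (max (max ah32 0 + ap32) 0) (ah4 + ap4) Llo M_L A1 c1 c2 (2 * (ap31 + ap32) + max ah31 0) N"
proof
  show "gs \<nu> z \<le> max (g z) 0 + max (max ah32 0 + ap32) 0 * \<nu>" if "0 < \<nu>" for \<nu> z
  proof -
    have "(max ah32 0 + ap32) * \<nu> \<le> max (max ah32 0 + ap32) 0 * \<nu>"
      using that by (intro mult_right_mono) auto
    then show ?thesis using gs_upper[OF that, of z] by linarith
  qed
  fix k assume k: "N \<le> k"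
  have l: "accepts k (l\<^sub>k k)" by (rule accepts_l\<^sub>k)
  show "Llo \<le> l\<^sub>k k" "l\<^sub>k k \<le> M_L" using l by (auto simp: accepts_def)
  have tk: "t k = t N" "t (Suc k) = t k" using N[of k] N[of "Suc k"] k by auto
  show "\<gamma>hat (t N) * obj (x (Suc k)) + gs (\<mu> k) (x (Suc k))
      \<le> \<gamma>hat (t N) * obj (x k) + gs (\<mu> k) (x k) - c1 / (2 * \<mu> k) * (norm (x (Suc k) - x k))\<^sup>2"
    using l tk by (simp add: accepts_def merit_def)
  show "norm (x (Suc k) - x k) \<le> c2 * \<mu> k * \<gamma>hat (t N) \<Longrightarrow>
      max (g (x (Suc k))) 0 \<le> (2 * (ap31 + ap32) + max ah31 0) * \<mu> k"
    using short_step_feasible(1)[OF tk(2)] tk by simp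
  fix z assume z: "z \<in> C"
  have "merit (\<gamma>hat (t k)) (\<mu> k) (x (Suc k)) - merit (\<gamma>hat (t k)) (\<mu> k) z
    \<le> l\<^sub>k k / (2 * \<mu> k) * ((norm (z - x k))\<^sup>2 - (norm (z - x (Suc k)))\<^sup>2)
      + (\<mu> k * (\<gamma>hat (t k) * L\<^sub>f + L_g (\<mu> k)) - l\<^sub>k k) / (2 * \<mu> k) * (norm (x (Suc k) - x k))\<^sup>2"
    using l by (intro merit_step x_mem \<mu>_pos z less_imp_le[OF \<gamma>hat_pos]) (simp add: accepts_def)
  also have "(\<mu> k * (\<gamma>hat (t k) * L\<^sub>f + L_g (\<mu> k)) - l\<^sub>k k) / (2 * \<mu> k) * (norm (x (Suc k) - x k))\<^sup>2
      \<le> A1 / (2 * \<mu> k) * (norm (x (Suc k) - x k))\<^sup>2"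
    using curvature_le[of k] l \<mu>_pos[of k]
    by (intro mult_right_mono divide_right_mono) (auto simp: A1_def accepts_def mult_ac)
  finally show "(\<gamma>hat (t N) * obj (x (Suc k)) + gs (\<mu> k) (x (Suc k))) - (\<gamma>hat (t N) * obj z + gs (\<mu> k) z)
      \<le> l\<^sub>k k / (2 * \<mu> k) * ((norm (z - x k))\<^sup>2 - (norm (z - x (Suc k)))\<^sup>2)
        + A1 / (2 * \<mu> k) * (norm (x (Suc k) - x k))\<^sup>2"
    using tk by (simp add: merit_def)
next
  show "0 < \<gamma>hat (t N)" "0 \<le> max (max ah32 0 + ap32) 0" "0 \<le> ah4 + ap4" "0 < Llo" "0 \<le> A1" "0 < c1" "0 < c2"
    using \<gamma>hat_pos pos ah4 ap4 by (auto simp: A1_def)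
next
  show "gs \<nu>1 z \<le> gs \<nu>0 z + (ah4 + ap4) * (\<nu>0 - \<nu>1)" if "0 < \<nu>1" "\<nu>1 \<le> \<nu>0" for \<nu>1 \<nu>0 z
    using that by (rule gs_mono)
next
  show "max (g z) 0 \<le> gs \<nu> z + (ah4 + ap4) * \<nu>" if "0 < \<nu>" for \<nu> z
    using that by (rule gs_lower)
next
  show "continuous_on C obj" by (rule cont_obj)
next
  show "continuous_on C (\<lambda>z. max (g z) 0)" by (rule cont_g)
qed (simp_all add: compact_C x_mem \<mu>_pos \<mu>_decseq assms(1,2))

end

section \<open>Complexity of the iteration with fixed penalty parameter\<close>

context sESQM_iteration
begin

definition C3 :: real where
  "C3 = (max (max ah32 0 + ap32) 0 + (ah4 + ap4)) * M_L / (\<eta>\<gamma> * Llo)"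

definition C4 :: real where
  "C4 = (2 * Llo + \<mu> 0 * A1 * M_L) / (c1 * Llo)"

lemma M_L_pos: "0 < M_L"
  using accepts_exists[of 0] pos by (auto simp: accepts_def)

lemma C_nonneg: "0 \<le> C3" "0 \<le> C4"
proof -
  have "0 \<le> A1" by (simp add: A1_def)
  then show "0 \<le> C3" "0 \<le> C4"
    using M_L_pos pos \<eta>\<gamma>_pos \<mu>_pos[of 0] ah4 ap4 by (auto simp: C3_def C4_def)
qed

text \<open>Let \<open>R = min (\<eta>\<gamma> * c2\<^sup>2) (\<epsilon> / 2)\<close>. Since \<open>\<gamma> \<ge> \<eta>\<gamma>\<close>, the conditions on the sum and on \<open>\<mu> m\<close> each
  bring one of the two terms in the weighted average below \<open>\<gamma> * R\<close>. The first entry of the minimum makes the step short, hence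
  its end nearly feasible; the second bounds the objective from above. The lower bound for the
  objective is exactness of the penalty applied to the small violation.\<close>

lemma good_iterate:
  assumes lim: "\<mu> \<longlonglongrightarrow> 0" "\<not> summable \<mu>" and N: "\<And>j. N \<le> j \<Longrightarrow> t j = t N"
    and xs: "xs \<in> C" "g xs \<le> 0"
      "\<And>z. z \<in> C \<Longrightarrow> \<gamma>hat (t N) * obj xs \<le> \<gamma>hat (t N) * obj z + max (g z) 0"
    and m: "N \<le> m" "m \<le> K"
    and diam: "\<And>y z. y \<in> C \<Longrightarrow> z \<in> C \<Longrightarrow> norm (y - z) \<le> d"
    and m\<psi>: "\<And>z. z \<in> C \<Longrightarrow> obj z \<le> m\<psi>" and m\<^sub>g: "\<And>z. z \<in> C \<Longrightarrow> max (g z) 0 \<le> m\<^sub>g"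
    and B: "B = m\<psi> + inverse \<eta>\<gamma> * (m\<^sub>g + (max (max ah32 0 + ap32) 0 + (ah4 + ap4)) * \<mu> 0) - obj xs"
    and sum_large: "(2 * C4 * \<eta>\<gamma> * B + M_L * d\<^sup>2) * inverse (\<Sum>k=m..K. \<mu> k) \<le> min (\<eta>\<gamma>\<^sup>2 * c2\<^sup>2) (\<eta>\<gamma> * \<epsilon> / 2)"
    and \<mu>_small: "2 * C3 * \<mu> m \<le> \<eta>\<gamma> * c2\<^sup>2" "4 * C3 * \<mu> m \<le> \<epsilon>"
      "(3 * (ap31 + ap32) + max ah31 0) * \<mu> m \<le> \<epsilon>"
      "(ah4 + ap4 + 2 * (ap31 + ap32) + max ap32 0) * \<mu> m \<le> \<eta>\<gamma> * \<epsilon>"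
  shows "\<exists>k\<in>{m..K}. \<bar>obj (x (Suc k)) - obj xs\<bar> \<le> \<epsilon> \<and> g (x (Suc k)) \<le> \<epsilon>"
proof -
  define \<gamma> where "\<gamma> = \<gamma>hat (t N)"
  define b where "b = max (max ah32 0 + ap32) 0"
  interpret D: penalised_descent C obj "\<lambda>z. max (g z) 0" gs x \<mu> l\<^sub>k \<gamma> b "ah4 + ap4" Llo M_L A1 c1 c2
    "2 * (ap31 + ap32) + max ah31 0" N
    unfolding \<gamma>_def b_def by (rule penalised_descent_from[OF lim N])
  have \<eta>: "0 < \<eta>\<gamma>" "\<eta>\<gamma> \<le> \<gamma>" "0 < \<gamma>" using \<eta>\<gamma>_pos penalty_ge[of N] by (auto simp: \<gamma>_def)
  have Fxs: "D.F xs = \<gamma> * obj xs" using xs(2) by (simp add: D.F_def)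
  have xs_min: "D.F xs \<le> D.F z" if "z \<in> C" for z
    using xs(3)[OF that] unfolding \<gamma>_def[symmetric] Fxs by (simp add: D.F_def)
  let ?a4 = "ah4 + ap4" and ?S = "\<Sum>k=m..K. \<mu> k"
  have b0: "0 \<le> b" "0 \<le> ?a4" using ah4 ap4 by (auto simp: b_def)
  have mg0: "0 \<le> m\<^sub>g + (b + ?a4) * \<mu> 0"
    using m\<^sub>g[OF xs(1)] b0 ah4 ap4 \<mu>_pos[of 0] by (intro add_nonneg_nonneg mult_nonneg_nonneg) auto
  have W: "D.V m - D.F xs \<le> \<gamma> * B"
  proof -
    define Q where "Q = m\<^sub>g + (b + ?a4) * \<mu> 0"
    define s where "s = obj (x m)"
    have "gs (\<mu> m) (x m) \<le> m\<^sub>g + b * \<mu> m"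
      using D.gs_le[OF \<mu>_pos, of m "x m"] m\<^sub>g[OF x_mem[of m]] by linarith
    moreover have "(b + ?a4) * \<mu> m \<le> (b + ?a4) * \<mu> 0"
      using b0 \<mu>_antimono[of 0 m] by (intro mult_left_mono) auto
    ultimately have "gs (\<mu> m) (x m) + ?a4 * \<mu> m \<le> Q"
      by (simp add: Q_def distrib_right)
    moreover have "\<gamma> * s \<le> \<gamma> * m\<psi>" using m\<psi>[OF x_mem] \<eta> by (simp add: s_def)
    moreover have "Q \<le> \<gamma> * inverse \<eta>\<gamma> * Q"
    proof -
      have "1 * Q \<le> (\<gamma> * inverse \<eta>\<gamma>) * Q"
        using \<eta> mg0 by (intro mult_right_mono) (auto simp: field_simps Q_def)
      then show ?thesis by simp
    qed
    moreover have "\<gamma> * B = \<gamma> * m\<psi> + \<gamma> * inverse \<eta>\<gamma> * Q - \<gamma> * obj xs"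
      by (simp add: B b_def Q_def algebra_simps)
    ultimately show ?thesis unfolding Fxs D.V_def D.M_def s_def[symmetric] by linarith
  qed
  have "D.F xs \<le> D.V m" using xs_min[OF x_mem[of m]] D.F_le_M[of "x m" m] by (simp add: D.V_def)
  then have \<gamma>B: "0 \<le> \<gamma> * B" using W by linarith
  obtain k where k: "k \<in> {m..K}" and avg:
    "2 * (D.M k (x (Suc k)) + ?a4 * \<mu> k - D.F xs) + 2 * ((norm (x (Suc k) - x k))\<^sup>2 / (\<mu> k)\<^sup>2)
      \<le> (M_L * d\<^sup>2 + 2 * ((2 * Llo + \<mu> m * A1 * M_L) / (c1 * Llo)) * (\<gamma> * B)) / ?S
        + 2 * ((b + ?a4) * M_L / Llo) * \<mu> m"
    using D.weighted_average[OF m xs(1) xs_min diam W] by blast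
  define \<delta> where "\<delta> = D.M k (x (Suc k)) + ?a4 * \<mu> k - D.F xs"
  define \<sigma> where "\<sigma> = (norm (x (Suc k) - x k))\<^sup>2 / (\<mu> k)\<^sup>2"
  define R where "R = min (\<eta>\<gamma> * c2\<^sup>2) (\<epsilon> / 2)"
  have S: "0 < ?S" using m \<mu>_pos by (intro sum_pos) auto
  have "(2 * Llo + \<mu> m * A1 * M_L) / (c1 * Llo) \<le> C4"
    unfolding C4_def using pos \<mu>_antimono[of 0 m] M_L_pos
    by (intro divide_right_mono add_left_mono mult_right_mono) (auto simp: A1_def)
  then have "2 * ((2 * Llo + \<mu> m * A1 * M_L) / (c1 * Llo)) * (\<gamma> * B) \<le> 2 * C4 * (\<gamma> * B)"
    using \<gamma>B by (intro mult_right_mono mult_left_mono) auto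
  moreover have "1 * (M_L * d\<^sup>2) \<le> (\<gamma> / \<eta>\<gamma>) * (M_L * d\<^sup>2)"
    using \<eta> M_L_pos by (intro mult_right_mono) auto
  moreover have "2 * C4 * (\<gamma> * B) = (\<gamma> / \<eta>\<gamma>) * (2 * C4 * \<eta>\<gamma> * B)" using \<eta> by simp
  ultimately have "M_L * d\<^sup>2 + 2 * ((2 * Llo + \<mu> m * A1 * M_L) / (c1 * Llo)) * (\<gamma> * B)
      \<le> (\<gamma> / \<eta>\<gamma>) * (2 * C4 * \<eta>\<gamma> * B + M_L * d\<^sup>2)"
    unfolding distrib_left by linarith
  then have "(M_L * d\<^sup>2 + 2 * ((2 * Llo + \<mu> m * A1 * M_L) / (c1 * Llo)) * (\<gamma> * B)) / ?S
      \<le> (\<gamma> / \<eta>\<gamma>) * (2 * C4 * \<eta>\<gamma> * B + M_L * d\<^sup>2) / ?S"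
    using S by (intro divide_right_mono) auto
  also have "\<dots> = (\<gamma> / \<eta>\<gamma>) * ((2 * C4 * \<eta>\<gamma> * B + M_L * d\<^sup>2) * inverse ?S)"
    by (simp add: divide_inverse)
  also have "\<dots> \<le> (\<gamma> / \<eta>\<gamma>) * min (\<eta>\<gamma>\<^sup>2 * c2\<^sup>2) (\<eta>\<gamma> * \<epsilon> / 2)"
    using sum_large \<eta> by (intro mult_left_mono) auto
  also have "min (\<eta>\<gamma>\<^sup>2 * c2\<^sup>2) (\<eta>\<gamma> * \<epsilon> / 2) = \<eta>\<gamma> * R"
    using \<eta> by (simp add: R_def min_mult_distrib_left power2_eq_square)
  also have "(\<gamma> / \<eta>\<gamma>) * (\<eta>\<gamma> * R) = \<gamma> * R" using \<eta> by simp
  finally have 1: "(M_L * d\<^sup>2 + 2 * ((2 * Llo + \<mu> m * A1 * M_L) / (c1 * Llo)) * (\<gamma> * B)) / ?S \<le> \<gamma> * R" .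
  have "2 * ((b + ?a4) * M_L / Llo) * \<mu> m = \<eta>\<gamma> * (2 * C3 * \<mu> m)"
    using \<eta> by (simp add: C3_def b_def)
  also have "\<dots> \<le> \<gamma> * (2 * C3 * \<mu> m)"
    using \<eta> C_nonneg \<mu>_pos[of m] by (intro mult_right_mono) auto
  also have "\<dots> \<le> \<gamma> * R"
    using \<mu>_small(1,2) \<eta> by (intro mult_left_mono) (auto simp: R_def)
  finally have "2 * \<delta> + 2 * \<sigma> \<le> \<gamma> * R + \<gamma> * R"
    using avg 1 unfolding \<delta>_def \<sigma>_def by linarith
  then have \<delta>\<sigma>: "\<delta> + \<sigma> \<le> \<gamma> * R" by linarith
  let ?y = "x (Suc k)"
  have \<delta>: "\<gamma> * obj ?y + max (g ?y) 0 - \<gamma> * obj xs \<le> \<delta>"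
    using D.F_le_M[of ?y k] unfolding \<delta>_def Fxs unfolding D.F_def by linarith
  have \<delta>0: "0 \<le> \<delta>" using xs_min[OF x_mem[of "Suc k"]] D.F_le_M[of ?y k] by (simp add: \<delta>_def)
  have \<sigma>0: "0 \<le> \<sigma>" by (simp add: \<sigma>_def)
  have \<mu>k: "0 < \<mu> k" "\<mu> k \<le> \<mu> m" using \<mu>_pos \<mu>_antimono[of m k] k by auto
  have short: "norm (?y - x k) \<le> c2 * \<mu> k * \<gamma>"
  proof (rule power2_le_imp_le)
    have "\<sigma> \<le> \<gamma> * R" using \<delta>\<sigma> \<delta>0 by simp
    also have "\<dots> \<le> \<gamma> * (\<eta>\<gamma> * c2\<^sup>2)" using \<eta> by (intro mult_left_mono) (auto simp: R_def)
    also have "\<dots> \<le> \<gamma> * (\<gamma> * c2\<^sup>2)" using \<eta> by (intro mult_left_mono mult_right_mono) auto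
    finally show "(norm (?y - x k))\<^sup>2 \<le> (c2 * \<mu> k * \<gamma>)\<^sup>2"
      using \<mu>k by (simp add: \<sigma>_def pos_divide_le_eq power2_eq_square mult_ac)
    show "0 \<le> c2 * \<mu> k * \<gamma>" using pos \<mu>k \<eta> by simp
  qed
  have tk: "t k = t N" "t (Suc k) = t k" using N[of k] N[of "Suc k"] k m by auto
  note feas = short_step_feasible[OF tk(2) short[unfolded \<gamma>_def tk(1)[symmetric]]]
  have "max (g ?y) 0 \<le> (3 * (ap31 + ap32) + max ah31 0) * \<mu> m"
    using const_signs(6) \<mu>k by (intro order_trans[OF feas(1)] mult_mono) auto
  then have gy: "g ?y \<le> \<epsilon>" using \<mu>_small(3) by linarith
  have "max (g ?y) 0 \<le> (ah4 + ap4 + 2 * (ap31 + ap32) + max ap32 0) * \<mu> m"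
    using const_signs(6) \<mu>k b0(2) by (intro order_trans[OF feas(2)] mult_left_mono) auto
  also have "\<dots> \<le> \<eta>\<gamma> * \<epsilon>" by (rule \<mu>_small(4))
  finally have gy': "max (g ?y) 0 \<le> \<eta>\<gamma> * \<epsilon>" .
  then have "0 \<le> \<eta>\<gamma> * \<epsilon>" by linarith
  then have \<epsilon>: "0 \<le> \<epsilon>" using \<eta> by (simp add: zero_le_mult_iff)
  have "max (g ?y) 0 \<le> \<gamma> * \<epsilon>" using gy' mult_right_mono[OF \<eta>(2) \<epsilon>] by linarith
  then have "\<gamma> * obj xs \<le> \<gamma> * (obj ?y + \<epsilon>)"
    using xs(3)[OF x_mem[of "Suc k"]] unfolding \<gamma>_def[symmetric] distrib_left by linarith
  then have lower: "obj xs \<le> obj ?y + \<epsilon>" using \<eta> by (simp add: mult_le_cancel_left)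
  have "\<gamma> * R \<le> \<gamma> * \<epsilon>" using \<eta> \<epsilon> by (intro mult_left_mono) (auto simp: R_def)
  then have "\<gamma> * obj ?y \<le> \<gamma> * (obj xs + \<epsilon>)"
    using \<delta> \<delta>\<sigma> \<sigma>0 unfolding distrib_left by linarith
  then have upper: "obj ?y \<le> obj xs + \<epsilon>" using \<eta> by (simp add: mult_le_cancel_left)
  show ?thesis using k gy lower upper by (intro bexI[of _ k]) auto
qed

end

section \<open>Convergence and complexity for the original problem\<close>

text \<open>For \<open>d = 0\<close> the quotient is infinite or zero, and the conclusion is \<open>0 \<le> a\<close>.\<close>

lemma ereal_le_divide_imp:
  assumes "ereal s \<le> ereal a / ereal d" "0 \<le> d" "0 \<le> a"
  shows "d * s \<le> a"
  using assms by (cases "d = 0") (auto simp: pos_le_divide_eq mult.commute)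

theorem theorem4p1:
  fixes C :: "'a::euclidean_space set"
    and f P1 P2 g :: "'a \<Rightarrow> real"
    and c :: "'a \<Rightarrow> 'b::euclidean_space"
    and h :: "'b \<Rightarrow> real"
    and \<psi> :: "'a \<Rightarrow> ereal"
    and hs :: "real \<Rightarrow> 'b \<Rightarrow> real" and \<phi>s :: "real \<Rightarrow> real \<Rightarrow> real"
    and H :: "real \<Rightarrow> 'b \<Rightarrow> real" and gs :: "real \<Rightarrow> 'a \<Rightarrow> real"
    and L\<^sub>f L\<^sub>c M\<^sub>c M\<^sub>h :: real
    and ah1 ah2 ah31 ah32 ah3 ah4 ap1 ap2 ap31 ap32 ap3 ap4 :: real
    and a1 a2 a31 a32 a4 :: real and L :: "real \<Rightarrow> real"
    and Llo Lup c1 c2 :: real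
    and \<gamma>hat \<gamma> \<mu> S :: "nat \<Rightarrow> real" and x :: "nat \<Rightarrow> 'a" and t :: "nat \<Rightarrow> nat"
    and M\<gamma> \<eta>1 M\<^sub>L M\<^sub>f M\<^sub>P\<^sub>1 M\<^sub>P\<^sub>2 \<eta>\<gamma> \<gamma>bar A1 C3 C4 :: real
    and k0 :: nat and kbar :: int
    and \<psi>opt B1 m\<^sub>C m\<psi> m\<^sub>g :: real
  (* problem (P) and standing assumptions *)
  assumes g_eq: "g = h \<circ> c"
    and \<psi>_eq: "\<psi> = (\<lambda>x. ereal (f x + P1 x - P2 x) + indicator_fun C x)"
    and "compact C" "convex C" "{x \<in> C. g x \<le> 0} \<noteq> {}"
    and "continuously_differentiable f" "continuously_differentiable c"
    and "L\<^sub>f > 0" "L\<^sub>c \<ge> 0" "smooth_const_on L\<^sub>f C f" "smooth_const_on L\<^sub>c C c"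
    and "M\<^sub>c > 0" "M\<^sub>c-lipschitz_on C c"
    and "convex_on UNIV P1" "convex_on UNIV P2"
    and "convex_on UNIV h" "M\<^sub>h > 0" "M\<^sub>h-lipschitz_on UNIV h"
  (* smoothing *)
    and "smoothing_approximation h hs ah1 ah2 ah31 ah32"
    and "ah4 \<ge> 0" "smoothing_monotone hs ah4"
    and "smoothing_approximation (\<lambda>s. max s 0) \<phi>s ap1 ap2 ap31 ap32"
    and "ap4 \<ge> 0" "smoothing_monotone \<phi>s ap4"
    and "ah3 = ah31 + ah32" "ap3 = ap31 + ap32"
    and "H = (\<lambda>\<nu>. \<phi>s \<nu> \<circ> hs \<nu>)" "gs = (\<lambda>\<nu>. H \<nu> \<circ> c)"
    and "a1 = ah1 + M\<^sub>h\<^sup>2 * ap1" "a2 = ah2 + M\<^sub>h\<^sup>2 * ap2"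
    and "a31 = max ah31 0 + ap31" "a32 = max ah32 0 + ap32" "a4 = ah4 + ap4"
    and "L = (\<lambda>\<nu>. M\<^sub>h * L\<^sub>c + a1 * M\<^sub>c\<^sup>2 + a2 * M\<^sub>c\<^sup>2 / \<nu>)"
  (* algorithm sESQM *)
    and "0 < Llo" "Llo \<le> Lup" "c1 > 0" "c2 > 0"
    and "sESQM_run f P1 P2 C \<psi> (\<lambda>\<nu> z. hs \<nu> (c z)) gs ap3 Llo Lup c1 c2 \<gamma>hat \<mu> x t"
    and "\<gamma> = (\<lambda>k. \<gamma>hat (t k))"
  (* (CQ) *)
    and CQ: "\<forall>x\<in>C. g x \<ge> 0 \<longrightarrow> 0 \<notin> limiting_subdifferential g x + normal_cone C x"
  (* (Parameters) *)
    and "\<forall>k. \<mu> k > 0" "decseq \<mu>" "\<mu> \<longlonglongrightarrow> 0"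
    and "S = (\<lambda>K. \<Sum>k = nat \<lceil>real K / 2\<rceil>..K. \<mu> k)" "filterlim S at_top sequentially"
    and "\<gamma>hat \<longlonglongrightarrow> 0" "M\<gamma> > 1"
    and "\<forall>k. 0 < \<gamma>hat (k + 1) \<and> \<gamma>hat (k + 1) < \<gamma>hat k \<and> \<gamma>hat k \<le> M\<gamma> * \<gamma>hat (k + 1)"
  (* (Convexity) *)
    and "convex_on UNIV f" "P2 = (\<lambda>_. 0)" "cone_convex (uminus ` hzn h) c"
  (* constants *)
    and "\<psi>opt = real_of_ereal (INF x\<in>{x. g x \<le> 0}. \<psi> x)"
    and "M\<^sub>L = max Lup (c1 + \<gamma> 0 * \<mu> 0 * L\<^sub>f + \<mu> 0 * L (\<mu> 0))"
    and "M\<^sub>f = (SUP x\<in>C. norm (gradient f x))"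
    and "M\<^sub>P\<^sub>1 = Sup {norm \<xi> |\<xi> x. x \<in> C \<and> \<xi> \<in> subdifferential (\<lambda>z. ereal (P1 z)) x}"
    and "M\<^sub>P\<^sub>2 = Sup {norm \<xi> |\<xi> x. x \<in> C \<and> \<xi> \<in> subdifferential (\<lambda>z. ereal (P2 z)) x}"
    and "\<eta>1 > 0"
    and \<eta>1: "\<forall>x\<in>C. g x \<ge> - \<eta>1 \<longrightarrow>
      (\<forall>u\<in>eps_subdifferential \<eta>1 (\<lambda>y. ereal (h y)) (c x).
         infdist 0 (adjoint (blinfun_apply (fderiv c x)) u +o normal_cone C x) \<ge> \<eta>1)"
    and "k0 = (LEAST k. \<mu> k \<le> \<eta>1 / max ah3 (max ah32 0))"
    and "\<eta>\<gamma> = min (\<eta>1 / (2 * M\<gamma> * (M\<^sub>f + M\<^sub>P\<^sub>1 + M\<^sub>P\<^sub>2 + c2 * (M\<^sub>L + \<mu> 0 * L (\<mu> 0))))) (\<gamma>hat (k0 + 1))"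
    and "kbar = int (LEAST k. \<forall>j\<ge>k. t j = t k) - 1"
    and "\<gamma>bar = \<gamma> (nat (kbar + 1))"
    and "A1 = max (\<mu> 0 * \<gamma>hat 0 * L\<^sub>f + \<mu> 0 * L (\<mu> 0) - Llo) 0"
    and "C3 = (max a32 0 + a4) * M\<^sub>L / (\<eta>\<gamma> * Llo)"
    and "C4 = (2 * Llo + \<mu> 0 * A1 * M\<^sub>L) / (c1 * Llo)"
    and "m\<^sub>C = diameter C"
    and "m\<psi> = real_of_ereal (SUP x\<in>C. \<psi> x)"
    and "m\<^sub>g = (SUP x\<in>C. max (g x) 0)"
    and "B1 = m\<psi> + inverse \<eta>\<gamma> * (m\<^sub>g + (max a32 0 + a4) * \<mu> 0) - \<psi>opt"
  (* The two threshold conditions are stated in ereal because C3 and the first denominator may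
     vanish; in ereal a positive number divided by 0 is infinity. *)
  shows "(\<forall>\<epsilon>>0. \<forall>K::nat.
            int K \<ge> 2 * (kbar + 1) \<and>
            ereal (inverse (S K)) \<le>
              ereal (min (\<eta>\<gamma>\<^sup>2 * c2\<^sup>2) (\<eta>\<gamma> * \<epsilon> / 2)) / ereal (2 * C4 * \<eta>\<gamma> * B1 + M\<^sub>L * m\<^sub>C\<^sup>2) \<and>
            ereal (\<mu> (nat \<lceil>real K / 2\<rceil>)) \<le>
              Min {ereal (\<eta>\<gamma> * c2\<^sup>2) / ereal (2 * C3),
                   ereal (\<eta>\<gamma> * \<epsilon>) / ereal (2 + 2 * max a31 0),
                   ereal \<epsilon> / ereal (4 * C3),
                   ereal \<epsilon> / ereal (3 * ap3 + max ah31 0),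
                   ereal (\<eta>\<gamma> * \<epsilon>) / ereal (a4 + 2 * ap3 + max ap32 0)}
            \<longrightarrow> (\<exists>khat\<in>{nat \<lceil>real K / 2\<rceil>..K}.
                   \<bar>\<psi> (x (khat + 1)) - ereal \<psi>opt\<bar> \<le> ereal \<epsilon> \<and> g (x (khat + 1)) \<le> \<epsilon>))
       \<and> (summable (\<lambda>k. (\<mu> k)\<^sup>2) \<longrightarrow>
            (\<exists>xlim. x \<longlonglongrightarrow> xlim \<and>
               is_arg_min \<psi> (\<lambda>z. g z \<le> 0) xlim \<and>
               is_arg_min (\<lambda>z. \<psi> z + ereal (inverse \<gamma>bar * max (g z) 0)) (\<lambda>_. True) xlim))"
proof -
  have gs_eq: "gs = (\<lambda>\<nu> z. \<phi>s \<nu> (hs \<nu> (c z)))"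
    using \<open>H = _\<close> \<open>gs = _\<close> by (simp add: fun_eq_iff)
  have \<psi>_eq': "\<psi> = (\<lambda>z. ereal (f z + P1 z) + indicator_fun C z)"
    using \<psi>_eq \<open>P2 = _\<close> by simp
  have \<psi>_C: "\<psi> z = ereal (f z + P1 z)" if "z \<in> C" for z
    using that by (simp add: \<psi>_eq' indicator_fun_def)
  have \<psi>_notC: "\<psi> z = \<infinity>" if "z \<notin> C" for z
    using that by (simp add: \<psi>_eq' indicator_fun_def)
  have g_c: "g z = h (c z)" for z by (simp add: g_eq)
  interpret P: penalised_problem C c h hs \<phi>s L\<^sub>c M\<^sub>c M\<^sub>h ah1 ah2 ah31 ah32 ah4 ap1 ap2 ap31 ap32 ap4 f P1 L\<^sub>f
    by unfold_locales fact+
  have L_eq: "L = P.L_g"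
    by (simp add: fun_eq_iff \<open>L = _\<close> \<open>a1 = _\<close> \<open>a2 = _\<close> P.L_g_def P.L_H_def distrib_right)
  have bdd_f: "bdd_above ((\<lambda>z. norm (gradient f z)) ` C)"
    by (rule bdd_above_norm_gradient) fact+
  have Mf: "norm (gradient f z) \<le> M\<^sub>f" if "z \<in> C" for z
    unfolding \<open>M\<^sub>f = _\<close> by (rule cSUP_upper[OF that bdd_f])
  have MP1: "norm \<xi> \<le> M\<^sub>P\<^sub>1" if "z \<in> C" "\<xi> \<in> subdifferential (\<lambda>z. ereal (P1 z)) z" for z \<xi>
    unfolding \<open>M\<^sub>P\<^sub>1 = _\<close> using that
    by (intro cSup_upper bdd_above_norm_subgradients P.convex_P1 P.compact_C) blast
  obtain z0 where z0: "z0 \<in> C" using \<open>{x \<in> C. g x \<le> 0} \<noteq> {}\<close> by blast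
  have "\<xi> = 0" if "\<xi> \<in> subdifferential (\<lambda>z. ereal (P2 z)) z" for \<xi> z
  proof -
    have "\<xi> \<bullet> (z + \<xi> - z) \<le> 0"
      using that unfolding mem_subdifferential_real \<open>P2 = _\<close> by (metis add_0)
    then show ?thesis by (simp add: inner_gt_zero_iff flip: not_less)
  qed
  moreover have "0 \<in> subdifferential (\<lambda>z. ereal (P2 z)) z0"
    by (simp add: mem_subdifferential_real \<open>P2 = _\<close>)
  ultimately have "{norm \<xi> |\<xi> x. x \<in> C \<and> \<xi> \<in> subdifferential (\<lambda>z. ereal (P2 z)) x} = {0}"
    using z0 by force
  then have MP2: "M\<^sub>P\<^sub>2 = 0" by (simp add: \<open>M\<^sub>P\<^sub>2 = _\<close>)
  have gap: "\<eta>1 \<le> norm (adjoint (blinfun_apply (fderiv c z)) u + n)"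
    if "z \<in> C" "- \<eta>1 \<le> h (c z)" "u \<in> eps_subdifferential \<eta>1 (\<lambda>y. ereal (h y)) (c z)" "n \<in> normal_cone C z"
    for z u n
  proof -
    let ?v = "adjoint (blinfun_apply (fderiv c z)) u"
    have "\<eta>1 \<le> infdist 0 (?v +o normal_cone C z)" using \<eta>1 that by (simp add: g_c)
    also have "\<dots> \<le> dist 0 (?v + n)"
      using that(4) by (intro infdist_le) (auto simp: elt_set_plus_def)
    finally show ?thesis by simp
  qed
  have k0: "\<mu> k0 \<le> \<eta>1 / max (ah31 + ah32) (max ah32 0)"
  proof -
    have "0 < \<eta>1 / max ah3 (max ah32 0)"
      using P.const_signs(3) \<open>ah3 = _\<close> \<open>\<eta>1 > 0\<close> by (intro divide_pos_pos) (auto simp: less_max_iff_disj)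
    then obtain k where "\<mu> k < \<eta>1 / max ah3 (max ah32 0)"
      using order_tendstoD(2)[OF \<open>\<mu> \<longlonglongrightarrow> 0\<close>] by (auto simp: eventually_sequentially)
    then have "\<mu> k0 \<le> \<eta>1 / max ah3 (max ah32 0)"
      unfolding \<open>k0 = _\<close> by (rule LeastI[of "\<lambda>k. \<mu> k \<le> \<eta>1 / max ah3 (max ah32 0)", OF less_imp_le])
    then show ?thesis by (simp add: \<open>ah3 = _\<close>)
  qed
  interpret R: sESQM_iteration C c h hs \<phi>s L\<^sub>c M\<^sub>c M\<^sub>h ah1 ah2 ah31 ah32 ah4 ap1 ap2 ap31 ap32 ap4 f P1 L\<^sub>f
    Llo Lup c1 c2 M\<gamma> M\<^sub>f M\<^sub>P\<^sub>1 \<eta>1 \<gamma>hat \<mu> x t k0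
  proof unfold_locales
    show "sESQM_run f P1 (\<lambda>_. 0) C (\<lambda>z. ereal (f z + P1 z) + indicator_fun C z) (\<lambda>\<nu> z. hs \<nu> (c z))
        (\<lambda>\<nu> z. \<phi>s \<nu> (hs \<nu> (c z))) (ap31 + ap32) Llo Lup c1 c2 \<gamma>hat \<mu> x t"
      using \<open>sESQM_run _ _ _ _ _ _ _ _ _ _ _ _ _ _ _ _\<close>
      unfolding \<open>P2 = _\<close> \<psi>_eq' gs_eq \<open>ap3 = _\<close> .
    show "0 < M\<gamma>" using \<open>M\<gamma> > 1\<close> by simp
    show "0 < \<gamma>hat (Suc k)" "\<gamma>hat (Suc k) < \<gamma>hat k" "\<gamma>hat k \<le> M\<gamma> * \<gamma>hat (Suc k)" for k
      using \<open>\<forall>k. 0 < \<gamma>hat (k + 1) \<and> _\<close> by auto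
  qed (fact | rule Mf MP1 gap k0; assumption)+

  have "t 0 = 0" by (rule R.t_0)
  then have M_L: "M\<^sub>L = R.M_L"
    by (simp add: \<open>M\<^sub>L = _\<close> \<open>\<gamma> = _\<close> L_eq R.M_L_def)
  have A1: "A1 = R.A1" by (simp add: \<open>A1 = _\<close> L_eq R.A1_def)
  have \<eta>\<gamma>: "\<eta>\<gamma> = R.\<eta>\<gamma>"
    by (simp only: \<open>\<eta>\<gamma> = _\<close> MP2 M_L L_eq R.\<eta>\<gamma>_def add_0_right)
  have b: "max a32 0 = max (max ah32 0 + ap32) 0" by (simp add: \<open>a32 = _\<close>)
  have C3: "C3 = R.C3" by (simp add: \<open>C3 = _\<close> R.C3_def M_L \<eta>\<gamma> b \<open>a4 = _\<close>)
  have C4: "C4 = R.C4" by (simp add: \<open>C4 = _\<close> R.C4_def M_L A1)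

  \<comment> \<open>\<open>kbar\<close> is the last index before \<open>t\<close> becomes constant, so \<open>N = kbar + 1\<close> is the first one after.\<close>
  define N where "N = (LEAST k. \<forall>j\<ge>k. t j = t k)"
  have "\<forall>j\<ge>N. t j = t N" unfolding N_def by (rule LeastI_ex[OF R.t_stabilises])
  then have N: "\<And>j. N \<le> j \<Longrightarrow> t j = t N" by blast
  have kbar: "kbar + 1 = int N" by (simp add: \<open>kbar = _\<close> N_def)
  have \<gamma>bar: "\<gamma>bar = \<gamma>hat (t N)" unfolding \<open>\<gamma>bar = _\<close> kbar \<open>\<gamma> = _\<close> by simp
  have \<gamma>bar_pos: "0 < \<gamma>bar" unfolding \<gamma>bar by (rule R.\<gamma>hat_pos)
  have \<mu>_div: "\<not> summable \<mu>"
  proof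
    assume sm: "summable \<mu>"
    have "S K \<le> suminf \<mu>" for K
      unfolding \<open>S = _\<close> using R.\<mu>_pos by (intro sum_le_suminf sm) (auto intro: less_imp_le)
    moreover have "\<forall>\<^sub>F K in sequentially. suminf \<mu> < S K"
      using \<open>filterlim S at_top sequentially\<close> by (simp add: filterlim_at_top_dense)
    ultimately show False by (simp add: not_less[symmetric])
  qed

  interpret D: penalised_descent C "\<lambda>z. f z + P1 z" "\<lambda>z. max (h (c z)) 0" "\<lambda>\<nu> z. \<phi>s \<nu> (hs \<nu> (c z))" x \<mu> R.l\<^sub>k
    "\<gamma>hat (t N)" "max (max ah32 0 + ap32) 0" "ah4 + ap4" Llo R.M_L R.A1 c1 c2 "2 * (ap31 + ap32) + max ah31 0" N
    by (rule R.penalised_descent_from[OF \<open>\<mu> \<longlonglongrightarrow> 0\<close> \<mu>_div N])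
  obtain xs q where xs: "xs \<in> C" and "max (h (c xs)) 0 = 0" and F_min: "\<And>z. z \<in> C \<Longrightarrow> D.F xs \<le> D.F z"
    and q: "strict_mono q" "(x \<circ> q) \<longlonglongrightarrow> xs"
    using D.exact_penalty by blast
  then have g_xs: "h (c xs) \<le> 0" and g_xs0: "max (h (c xs)) 0 = 0" by auto
  have pen: "\<gamma>hat (t N) * (f xs + P1 xs) \<le> \<gamma>hat (t N) * (f z + P1 z) + max (h (c z)) 0" if "z \<in> C" for z
    using F_min[OF that] g_xs0 unfolding D.F_def by linarith
  have opt: "f xs + P1 xs \<le> f z + P1 z" if "z \<in> C" "h (c z) \<le> 0" for z
    using pen[OF that(1)] that(2) \<gamma>bar_pos by (simp add: \<gamma>bar)
  have "(INF x\<in>{x. g x \<le> 0}. \<psi> x) = ereal (f xs + P1 xs)"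
  proof (rule INF_eqI)
    show "ereal (f xs + P1 xs) \<le> \<psi> z" if "z \<in> {x. g x \<le> 0}" for z
      using that opt[of z] \<psi>_notC[of z] by (cases "z \<in> C") (auto simp: \<psi>_C g_c)
    show "y \<le> ereal (f xs + P1 xs)" if "\<And>z. z \<in> {x. g x \<le> 0} \<Longrightarrow> y \<le> \<psi> z" for y
      using that[of xs] g_xs xs by (simp add: g_c \<psi>_C)
  qed
  then have \<psi>opt: "\<psi>opt = f xs + P1 xs" by (simp add: \<open>\<psi>opt = _\<close>)
  have m\<psi>: "f z + P1 z \<le> m\<psi>" if "z \<in> C" for z
  proof -
    obtain zm where zm: "zm \<in> C" "\<And>z. z \<in> C \<Longrightarrow> f z + P1 z \<le> f zm + P1 zm"
      using continuous_attains_sup[OF P.compact_C _ R.cont_obj] z0 by blast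
    have "(SUP x\<in>C. \<psi> x) = ereal (f zm + P1 zm)"
      using zm by (intro SUP_eqI) (auto simp: \<psi>_C)
    then show ?thesis using zm(2)[OF that] by (simp add: \<open>m\<psi> = _\<close>)
  qed
  have "bdd_above ((\<lambda>z. max (g z) 0) ` C)"
    using compact_continuous_image[OF R.cont_g P.compact_C]
    by (simp add: g_c bounded_imp_bdd_above compact_imp_bounded)
  from cSUP_upper[OF _ this] have m\<^sub>g: "max (h (c z)) 0 \<le> m\<^sub>g" if "z \<in> C" for z
    using that by (simp add: \<open>m\<^sub>g = _\<close> g_c)
  have diam: "norm (y - z) \<le> m\<^sub>C" if "y \<in> C" "z \<in> C" for y z
    using diameter_bounded_bound[OF compact_imp_bounded[OF P.compact_C] that]
    by (simp add: \<open>m\<^sub>C = _\<close> dist_norm)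
  have B1: "B1 = m\<psi> + inverse R.\<eta>\<gamma> * (m\<^sub>g + (max (max ah32 0 + ap32) 0 + (ah4 + ap4)) * \<mu> 0) - (f xs + P1 xs)"
    by (simp add: \<open>B1 = _\<close> \<eta>\<gamma> b \<open>a4 = _\<close> \<psi>opt)
  have "0 \<le> m\<^sub>g" using m\<^sub>g[OF xs] by linarith
  then have B1_nonneg: "0 \<le> B1"
    unfolding B1 using m\<psi>[OF xs] R.\<eta>\<gamma>_pos R.\<mu>_pos[of 0] P.ah4 P.ap4
    by (smt (verit) mult_nonneg_nonneg inverse_nonnegative_iff_nonnegative)

  have complexity: "\<exists>khat\<in>{nat \<lceil>real K / 2\<rceil>..K}.
      \<bar>\<psi> (x (khat + 1)) - ereal \<psi>opt\<bar> \<le> ereal \<epsilon> \<and> g (x (khat + 1)) \<le> \<epsilon>"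
    if \<epsilon>: "\<epsilon> > 0" and K: "int K \<ge> 2 * (kbar + 1)"
      and S_large: "ereal (inverse (S K)) \<le>
        ereal (min (\<eta>\<gamma>\<^sup>2 * c2\<^sup>2) (\<eta>\<gamma> * \<epsilon> / 2)) / ereal (2 * C4 * \<eta>\<gamma> * B1 + M\<^sub>L * m\<^sub>C\<^sup>2)"
      and \<mu>_small: "ereal (\<mu> (nat \<lceil>real K / 2\<rceil>)) \<le>
        Min {ereal (\<eta>\<gamma> * c2\<^sup>2) / ereal (2 * C3),
             ereal (\<eta>\<gamma> * \<epsilon>) / ereal (2 + 2 * max a31 0),
             ereal \<epsilon> / ereal (4 * C3),
             ereal \<epsilon> / ereal (3 * ap3 + max ah31 0),
             ereal (\<eta>\<gamma> * \<epsilon>) / ereal (a4 + 2 * ap3 + max ap32 0)}"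
    for \<epsilon> :: real and K :: nat
  proof -
    define m where "m = nat \<lceil>real K / 2\<rceil>"
    have "real N \<le> real K / 2" using K unfolding kbar by simp
    then have m: "N \<le> m" "m \<le> K" unfolding m_def by linarith+
    note le = order_trans[OF \<mu>_small[folded m_def] Min_le]
    have \<eta>: "0 < \<eta>\<gamma>" unfolding \<eta>\<gamma> by (rule R.\<eta>\<gamma>_pos)
    have signs: "0 \<le> C3" "0 \<le> C4" "0 < M\<^sub>L" "0 < ap3" "0 \<le> a4"
      using R.C_nonneg R.M_L_pos P.const_signs(6) P.ah4 P.ap4
      by (simp_all add: C3 C4 M_L \<open>ap3 = _\<close> \<open>a4 = _\<close>)
    have s1: "2 * C3 * \<mu> m \<le> \<eta>\<gamma> * c2\<^sup>2"
      by (rule ereal_le_divide_imp[OF le]) (intro finite.intros insertI1 insertI2 | use signs \<eta> in simp)+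
    have s2: "4 * C3 * \<mu> m \<le> \<epsilon>"
      by (rule ereal_le_divide_imp[OF le]) (intro finite.intros insertI1 insertI2 | use signs \<epsilon> in simp)+
    have s3: "(3 * ap3 + max ah31 0) * \<mu> m \<le> \<epsilon>"
      by (rule ereal_le_divide_imp[OF le]) (intro finite.intros insertI1 insertI2 | use signs \<epsilon> in simp)+
    have s4: "(a4 + 2 * ap3 + max ap32 0) * \<mu> m \<le> \<eta>\<gamma> * \<epsilon>"
      by (rule ereal_le_divide_imp[OF le]) (intro finite.intros insertI1 insertI2 | use signs \<epsilon> \<eta> in simp)+
    have s0: "(2 * C4 * \<eta>\<gamma> * B1 + M\<^sub>L * m\<^sub>C\<^sup>2) * inverse (S K) \<le> min (\<eta>\<gamma>\<^sup>2 * c2\<^sup>2) (\<eta>\<gamma> * \<epsilon> / 2)"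
      by (rule ereal_le_divide_imp[OF S_large]) (use signs \<epsilon> \<eta> B1_nonneg in auto)
    have SK: "S K = (\<Sum>k=m..K. \<mu> k)" by (simp add: \<open>S = _\<close> m_def)
    have "\<exists>k\<in>{m..K}. \<bar>(f (x (Suc k)) + P1 (x (Suc k))) - (f xs + P1 xs)\<bar> \<le> \<epsilon> \<and> h (c (x (Suc k))) \<le> \<epsilon>"
      by (rule R.good_iterate[OF \<open>\<mu> \<longlonglongrightarrow> 0\<close> \<mu>_div N xs g_xs pen m diam m\<psi> m\<^sub>g B1
          s0[unfolded SK C4 M_L \<eta>\<gamma>] s1[unfolded C3 \<eta>\<gamma>] s2[unfolded C3] s3[unfolded \<open>ap3 = _\<close>]
          s4[unfolded \<open>a4 = _\<close> \<open>ap3 = _\<close> \<eta>\<gamma>]])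
    then show ?thesis
      by (simp add: m_def \<psi>_C[OF R.x_mem] \<psi>opt g_c)
  qed

  have convergence: "\<exists>xlim. x \<longlonglongrightarrow> xlim \<and> is_arg_min \<psi> (\<lambda>z. g z \<le> 0) xlim \<and>
      is_arg_min (\<lambda>z. \<psi> z + ereal (inverse \<gamma>bar * max (g z) 0)) (\<lambda>_. True) xlim"
    if sm: "summable (\<lambda>k. (\<mu> k)\<^sup>2)"
  proof (intro exI conjI)
    show "x \<longlonglongrightarrow> xs" by (rule D.converges_to_cluster_minimiser[OF sm xs F_min q])
    have "\<not> \<psi> y < \<psi> xs" if "g y \<le> 0" for y
      using that opt[of y] \<psi>_notC[of y] xs by (cases "y \<in> C") (auto simp: \<psi>_C g_c not_less)
    then show "is_arg_min \<psi> (\<lambda>z. g z \<le> 0) xs"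
      using g_xs by (auto simp: is_arg_min_def g_c)
    have "f xs + P1 xs \<le> f y + P1 y + inverse \<gamma>bar * max (g y) 0" if "y \<in> C" for y
    proof -
      have "\<gamma>bar * (f xs + P1 xs) \<le> \<gamma>bar * (f y + P1 y + inverse \<gamma>bar * max (g y) 0)"
        using pen[OF that] \<gamma>bar_pos unfolding \<gamma>bar[symmetric] g_c[symmetric]
        by (simp add: distrib_left mult.assoc[symmetric])
      then show ?thesis using \<gamma>bar_pos by (simp add: mult_le_cancel_left)
    qed
    then have "\<psi> xs + ereal (inverse \<gamma>bar * max (g xs) 0) \<le> \<psi> y + ereal (inverse \<gamma>bar * max (g y) 0)" for y
      using g_xs0 xs \<psi>_notC[of y] by (cases "y \<in> C") (auto simp: \<psi>_C g_c)
    then show "is_arg_min (\<lambda>z. \<psi> z + ereal (inverse \<gamma>bar * max (g z) 0)) (\<lambda>_. True) xs"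
      by (auto simp: is_arg_min_def not_less)
  qed

  show ?thesis
    by (intro conjI allI impI; (elim conjE)?; (rule complexity | rule convergence); assumption)
qed

end
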